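(* The category $\mathsf{MC}^\top$ is equivalent to the full subcategory of $\mathsf{HF}$ whose objects have the form $\{(\mathbf{1},J_i)\}_{i\in I}$. Consequently, $\mathsf{MC}^\top$ is dually equivalent to the category $\mathbb{DP}_{fin}$ of finite DP-algebras and their homomorphisms.
   Context: For an integer $k>0$, $\mathbf{k}$ denotes the $k$-element chain. A DP-algebra is a member of the variety of MTL-algebras (bounded commutative integral prelinear residuated lattices) generated by the MTL-chains in which $x*y=0$ whenever $x,y<1$ and $x*y=\min\{x,y\}$ otherwise. $\mathsf{HF}$ is the category of finite hall forests: objects are finite multisets of pairs $(T,J)$ with $T$ a finite tree (a poset with a minimum in which the downset of each element is a chain) and $J$ a possibly empty finite chain; a morphism $h\colon\{(T_i,J_i)\}_{i\in I}\to\{(T_k,J_k)\}_{k\in K}$ is a family $\{(f_i,g_i)\}_{i\in I}$ such that for each $i$ there is $k\in K$ with $f_i\colon T_i\to T_k$ and $g_i\colon J_i\to J_k$ order-preserving, downset-preserving maps, with $g_i(\max J_i)=\max J_k$; if $J_k$ is empty, $g_i$ is the partial, nowhere defined map. $\mathsf{MC}$ is the category whose objects are finite multisets of nonempty finite chains and whose morphisms $h\colon\{C_1,\dots,C_m\}\to\{D_1,\dots,D_n\}$ are families $h=\{h_i\}_{i=1}^m$ where each $h_i\colon C_i\twoheadrightarrow D_j$ is an order-preserving surjection onto some $D_j$. $\mathsf{MC}^\top$ is the non-full subcategory of $\mathsf{MC}$ with the same objects whose morphisms additionally satisfy: for each $i$, if the target $D_j$ of $h_i$ is not isomorphic to $\mathbf{1}$,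 then $h_i^{-1}(\max D_j)=\{\max C_i\}$. *)

theory Defs
  imports "HOL-Algebra.Group" "HOL-Library.Infinite_Typeclass"
begin

section \<open>Categories, functors, equivalence\<close>

text \<open>
  Distinct hom-sets may share elements, so functors act on an arrow together with its
  domain and codomain.
\<close>

record ('o, 'm) cat =
  Ob :: "'o set"
  Hom :: "'o \<Rightarrow> 'o \<Rightarrow> 'm set"
  Id :: "'o \<Rightarrow> 'm"
  Comp :: "'m \<Rightarrow> 'm \<Rightarrow> 'm"

locale category =
  fixes C :: "('o, 'm) cat"
  assumes Id_in_Hom: "X \<in> Ob C \<Longrightarrow> Id C X \<in> Hom C X X"
    and Comp_in_Hom: "\<lbrakk>X \<in> Ob C; Y \<in> Ob C; Z \<in> Ob C; f \<in> Hom C X Y; g \<in> Hom C Y Z\<rbrakk>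
      \<Longrightarrow> Comp C g f \<in> Hom C X Z"
    and Comp_Id_right: "\<lbrakk>X \<in> Ob C; Y \<in> Ob C; f \<in> Hom C X Y\<rbrakk> \<Longrightarrow> Comp C f (Id C X) = f"
    and Comp_Id_left: "\<lbrakk>X \<in> Ob C; Y \<in> Ob C; f \<in> Hom C X Y\<rbrakk> \<Longrightarrow> Comp C (Id C Y) f = f"
    and Comp_assoc: "\<lbrakk>W \<in> Ob C; X \<in> Ob C; Y \<in> Ob C; Z \<in> Ob C;
        f \<in> Hom C W X; g \<in> Hom C X Y; h \<in> Hom C Y Z\<rbrakk>
      \<Longrightarrow> Comp C h (Comp C g f) = Comp C (Comp C h g) f"

definition opposite :: "('o, 'm) cat \<Rightarrow> ('o, 'm) cat" where
  "opposite C = \<lparr>Ob = Ob C, Hom = (\<lambda>X Y. Hom C Y X), Id = Id C, Comp = (\<lambda>g f. Comp C f g)\<rparr>"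

definition full_subcat :: "('o, 'm) cat \<Rightarrow> ('o \<Rightarrow> bool) \<Rightarrow> ('o, 'm) cat" where
  "full_subcat C P = C\<lparr>Ob := {X \<in> Ob C. P X}\<rparr>"

record ('o, 'm, 'p, 'n) func =
  FOb :: "'o \<Rightarrow> 'p"
  FArr :: "'o \<Rightarrow> 'o \<Rightarrow> 'm \<Rightarrow> 'n"

locale cat_functor = C: category C + D: category D
  for C :: "('o, 'm) cat" and D :: "('p, 'n) cat" +
  fixes F :: "('o, 'm, 'p, 'n) func"
  assumes FOb_in_Ob: "X \<in> Ob C \<Longrightarrow> FOb F X \<in> Ob D"
    and FArr_in_Hom: "\<lbrakk>X \<in> Ob C; Y \<in> Ob C; f \<in> Hom C X Y\<rbrakk>
      \<Longrightarrow> FArr F X Y f \<in> Hom D (FOb F X) (FOb F Y)"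
    and FArr_Id: "X \<in> Ob C \<Longrightarrow> FArr F X X (Id C X) = Id D (FOb F X)"
    and FArr_Comp: "\<lbrakk>X \<in> Ob C; Y \<in> Ob C; Z \<in> Ob C; f \<in> Hom C X Y; g \<in> Hom C Y Z\<rbrakk>
      \<Longrightarrow> FArr F X Z (Comp C g f) = Comp D (FArr F Y Z g) (FArr F X Y f)"

definition id_func :: "('o, 'm, 'o, 'm) func" where
  "id_func = \<lparr>FOb = (\<lambda>X. X), FArr = (\<lambda>X Y f. f)\<rparr>"

definition comp_func ::
    "('p, 'n, 'q, 'k) func \<Rightarrow> ('o, 'm, 'p, 'n) func \<Rightarrow> ('o, 'm, 'q, 'k) func" where
  "comp_func G F =
    \<lparr>FOb = (\<lambda>X. FOb G (FOb F X)), FArr = (\<lambda>X Y f. FArr G (FOb F X) (FOb F Y) (FArr F X Y f))\<rparr>"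

definition is_iso :: "('o, 'm) cat \<Rightarrow> 'o \<Rightarrow> 'o \<Rightarrow> 'm \<Rightarrow> bool" where
  "is_iso C X Y f \<longleftrightarrow>
    f \<in> Hom C X Y \<and> (\<exists>g \<in> Hom C Y X. Comp C g f = Id C X \<and> Comp C f g = Id C Y)"

definition natural_iso :: "('o, 'm) cat \<Rightarrow> ('p, 'n) cat \<Rightarrow>
    ('o, 'm, 'p, 'n) func \<Rightarrow> ('o, 'm, 'p, 'n) func \<Rightarrow> ('o \<Rightarrow> 'n) \<Rightarrow> bool" where
  "natural_iso C D F G \<eta> \<longleftrightarrow>
    (\<forall>X \<in> Ob C. is_iso D (FOb F X) (FOb G X) (\<eta> X)) \<and>
    (\<forall>X \<in> Ob C. \<forall>Y \<in> Ob C. \<forall>f \<in> Hom C X Y.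
      Comp D (\<eta> Y) (FArr F X Y f) = Comp D (FArr G X Y f) (\<eta> X))"

definition equivalent :: "('o, 'm) cat \<Rightarrow> ('p, 'n) cat \<Rightarrow> bool" where
  "equivalent C D \<longleftrightarrow>
    (\<exists>F G. cat_functor C D F \<and> cat_functor D C G \<and>
      (\<exists>\<eta>. natural_iso C C id_func (comp_func G F) \<eta>) \<and>
      (\<exists>\<epsilon>. natural_iso D D (comp_func F G) id_func \<epsilon>))"

definition dually_equivalent :: "('o, 'm) cat \<Rightarrow> ('p, 'n) cat \<Rightarrow> bool" where
  "dually_equivalent C D \<longleftrightarrow> equivalent C (opposite D)"


section \<open>Finite chains and trees\<close>

text \<open>
  A poset is a reflexive order relation; its underlying set is the field of the relation.
  In particular the empty relation is the empty chain. Maps between posets are partial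
  functions whose domain is recorded, so that they compose by the library's
  composition of maps.
\<close>

definition finite_chain :: "'a rel \<Rightarrow> bool" where
  "finite_chain r \<longleftrightarrow> finite r \<and> Linear_order r"

text \<open>Being isomorphic to the chain with \<open>k\<close> elements.\<close>

definition is_chain_of_size :: "nat \<Rightarrow> 'a rel \<Rightarrow> bool" where
  "is_chain_of_size k r \<longleftrightarrow> finite_chain r \<and> card (Field r) = k"

definition finite_tree :: "'a rel \<Rightarrow> bool" where
  "finite_tree r \<longleftrightarrow> finite r \<and> Partial_order r \<and>
    (\<exists>m \<in> Field r. \<forall>x \<in> Field r. (m, x) \<in> r) \<and>
    (\<forall>x \<in> Field r. under r x \<in> Chains r)"

definition max_elt :: "'a rel \<Rightarrow> 'a" where
  "max_elt r = (THE m. m \<in> Field r \<and> (\<forall>x \<in> Field r. (x, m) \<in> r))"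

definition order_preserving :: "'a rel \<Rightarrow> 'b rel \<Rightarrow> ('a \<rightharpoonup> 'b) \<Rightarrow> bool" where
  "order_preserving r s u \<longleftrightarrow> dom u = Field r \<and> ran u \<subseteq> Field s \<and> compat r s (the \<circ> u)"

text \<open>The library's \<open>ofilter\<close> is closed downwards, i.e. it is the notion of a downset.\<close>

definition downset_preserving :: "'a rel \<Rightarrow> 'b rel \<Rightarrow> ('a \<rightharpoonup> 'b) \<Rightarrow> bool" where
  "downset_preserving r s u \<longleftrightarrow>
    (\<forall>A. Order_Relation.ofilter r A \<longrightarrow> Order_Relation.ofilter s ((the \<circ> u) ` A))"


section \<open>Multisets of finite chains\<close>

text \<open>
  Morphisms are families indexed by the members of a multiset, counted with multiplicity;
  hence a finite multiset is given by an enumeration of its members as a list (reordering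
  the list yields an isomorphic object). The \<open>i\<close>-th entry \<open>(j, u)\<close> of a morphism says
  that \<open>u\<close> maps the \<open>i\<close>-th member of the source to the \<open>j\<close>-th member of the target.
\<close>

definition MC :: "('a rel list, (nat \<times> ('a \<rightharpoonup> 'a)) list) cat" where
  "MC = \<lparr>
    Ob = {X. \<forall>C \<in> set X. finite_chain C \<and> C \<noteq> {}},
    Hom = (\<lambda>X Y. {h. length h = length X \<and>
      (\<forall>i < length X. case h ! i of (j, u) \<Rightarrow>
        j < length Y \<and> order_preserving (X ! i) (Y ! j) u \<and> ran u = Field (Y ! j))}),
    Id = (\<lambda>X. map (\<lambda>i. (i, Some |` Field (X ! i))) [0..<length X]),
    Comp = (\<lambda>h' h. map (\<lambda>(j, u). case h' ! j of (k, v) \<Rightarrow> (k, v \<circ>\<^sub>m u)) h)\<rparr>"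

definition MC_top :: "('a rel list, (nat \<times> ('a \<rightharpoonup> 'a)) list) cat" where
  "MC_top = MC\<lparr>Hom := (\<lambda>X Y. {h \<in> Hom MC X Y.
    \<forall>i < length X. case h ! i of (j, u) \<Rightarrow>
      \<not> is_chain_of_size 1 (Y ! j) \<longrightarrow>
      {x. u x = Some (max_elt (Y ! j))} = {max_elt (X ! i)}})\<rparr>"


section \<open>Finite hall forests\<close>

text \<open>
  If \<open>J'\<close> is nonempty and \<open>J\<close> is empty, then there is no admissible \<open>g\<close> below: it would have
  empty domain, and could not attain the maximum of \<open>J'\<close> at the maximum of \<open>J\<close>.
\<close>

definition hall_map :: "'t rel \<times> 'j rel \<Rightarrow> 't rel \<times> 'j rel \<Rightarrow> ('t \<rightharpoonup> 't) \<Rightarrow> ('j \<rightharpoonup> 'j) \<Rightarrow> bool"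
  where "hall_map = (\<lambda>(T, J) (T', J') f g.
    order_preserving T T' f \<and> downset_preserving T T' f \<and>
    (if J' = {} then g = Map.empty
     else order_preserving J J' g \<and> downset_preserving J J' g \<and>
       g (max_elt J) = Some (max_elt J')))"

definition HF ::
    "(('t rel \<times> 'j rel) list, (nat \<times> ('t \<rightharpoonup> 't) \<times> ('j \<rightharpoonup> 'j)) list) cat" where
  "HF = \<lparr>
    Ob = {X. \<forall>(T, J) \<in> set X. finite_tree T \<and> finite_chain J},
    Hom = (\<lambda>X Y. {h. length h = length X \<and>
      (\<forall>i < length X. case h ! i of (k, f, g) \<Rightarrow>
        k < length Y \<and> hall_map (X ! i) (Y ! k) f g)}),
    Id = (\<lambda>X. map (\<lambda>i. (i, Some |` Field (fst (X ! i)), Some |` Field (snd (X ! i))))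
      [0..<length X]),
    Comp = (\<lambda>h' h. map (\<lambda>(k, f, g). case h' ! k of (l, f', g') \<Rightarrow>
      (l, f' \<circ>\<^sub>m f, g' \<circ>\<^sub>m g)) h)\<rparr>"


section \<open>MTL-algebras and DP-algebras\<close>

record 'a mtl = "'a monoid" +
  wedge :: "'a \<Rightarrow> 'a \<Rightarrow> 'a"
  vee :: "'a \<Rightarrow> 'a \<Rightarrow> 'a"
  impl :: "'a \<Rightarrow> 'a \<Rightarrow> 'a"
  falsum :: "'a"

definition mtl_le :: "'a mtl \<Rightarrow> 'a \<Rightarrow> 'a \<Rightarrow> bool" where
  "mtl_le A x y \<longleftrightarrow> wedge A x y = x"

locale mtl_algebra = comm_monoid A for A :: "'a mtl" +
  assumes wedge_closed: "\<lbrakk>x \<in> carrier A; y \<in> carrier A\<rbrakk> \<Longrightarrow> wedge A x y \<in> carrier A"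
    and vee_closed: "\<lbrakk>x \<in> carrier A; y \<in> carrier A\<rbrakk> \<Longrightarrow> vee A x y \<in> carrier A"
    and impl_closed: "\<lbrakk>x \<in> carrier A; y \<in> carrier A\<rbrakk> \<Longrightarrow> impl A x y \<in> carrier A"
    and falsum_closed: "falsum A \<in> carrier A"
    and wedge_commute: "\<lbrakk>x \<in> carrier A; y \<in> carrier A\<rbrakk> \<Longrightarrow> wedge A x y = wedge A y x"
    and vee_commute: "\<lbrakk>x \<in> carrier A; y \<in> carrier A\<rbrakk> \<Longrightarrow> vee A x y = vee A y x"
    and wedge_assoc: "\<lbrakk>x \<in> carrier A; y \<in> carrier A; z \<in> carrier A\<rbrakk>
      \<Longrightarrow> wedge A (wedge A x y) z = wedge A x (wedge A y z)"
    and vee_assoc: "\<lbrakk>x \<in> carrier A; y \<in> carrier A; z \<in> carrier A\<rbrakk>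
      \<Longrightarrow> vee A (vee A x y) z = vee A x (vee A y z)"
    and wedge_absorb: "\<lbrakk>x \<in> carrier A; y \<in> carrier A\<rbrakk> \<Longrightarrow> wedge A x (vee A x y) = x"
    and vee_absorb: "\<lbrakk>x \<in> carrier A; y \<in> carrier A\<rbrakk> \<Longrightarrow> vee A x (wedge A x y) = x"
    and falsum_least: "x \<in> carrier A \<Longrightarrow> mtl_le A (falsum A) x"
    and integral: "x \<in> carrier A \<Longrightarrow> mtl_le A x \<one>\<^bsub>A\<^esub>"
    and residuation: "\<lbrakk>x \<in> carrier A; y \<in> carrier A; z \<in> carrier A\<rbrakk>
      \<Longrightarrow> mtl_le A (x \<otimes>\<^bsub>A\<^esub> z) y \<longleftrightarrow> mtl_le A z (impl A x y)"
    and prelinear: "\<lbrakk>x \<in> carrier A; y \<in> carrier A\<rbrakk>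
      \<Longrightarrow> vee A (impl A x y) (impl A y x) = \<one>\<^bsub>A\<^esub>"

definition mtl_chain :: "'a mtl \<Rightarrow> bool" where
  "mtl_chain A \<longleftrightarrow> mtl_algebra A \<and>
    (\<forall>x \<in> carrier A. \<forall>y \<in> carrier A. mtl_le A x y \<or> mtl_le A y x)"

definition dp_chain :: "'a mtl \<Rightarrow> bool" where
  "dp_chain A \<longleftrightarrow> mtl_chain A \<and>
    (\<forall>x \<in> carrier A. \<forall>y \<in> carrier A.
      x \<otimes>\<^bsub>A\<^esub> y = (if x \<noteq> \<one>\<^bsub>A\<^esub> \<and> y \<noteq> \<one>\<^bsub>A\<^esub> then falsum A else wedge A x y))"

datatype mtl_term =
    TVar nat
  | TOne
  | TFalsum
  | TMult mtl_term mtl_term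
  | TWedge mtl_term mtl_term
  | TVee mtl_term mtl_term
  | TImpl mtl_term mtl_term

primrec term_val :: "'a mtl \<Rightarrow> (nat \<Rightarrow> 'a) \<Rightarrow> mtl_term \<Rightarrow> 'a" where
  "term_val A v (TVar n) = v n"
| "term_val A v TOne = \<one>\<^bsub>A\<^esub>"
| "term_val A v TFalsum = falsum A"
| "term_val A v (TMult s t) = term_val A v s \<otimes>\<^bsub>A\<^esub> term_val A v t"
| "term_val A v (TWedge s t) = wedge A (term_val A v s) (term_val A v t)"
| "term_val A v (TVee s t) = vee A (term_val A v s) (term_val A v t)"
| "term_val A v (TImpl s t) = impl A (term_val A v s) (term_val A v t)"

definition mtl_models :: "(mtl_term \<times> mtl_term) set \<Rightarrow> 'a mtl set" where
  "mtl_models E = {A. mtl_algebra A \<and>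
    (\<forall>(s, t) \<in> E. \<forall>v. range v \<subseteq> carrier A \<longrightarrow> term_val A v s = term_val A v t)}"

text \<open>The least variety (equational class) of MTL-algebras that contains \<open>K\<close>.\<close>

definition variety_generated :: "'a mtl set \<Rightarrow> 'a mtl set" where
  "variety_generated K = \<Inter> {mtl_models E |E. K \<subseteq> mtl_models E}"

text \<open>
  The generating chains have their carriers in the same infinite type as the algebra.
  This loses no generating identities: an identity that fails in some DP-chain fails in
  the finite subchain that consists of the finitely many values involved, the bounds, and
  the coatom.
\<close>

definition dp_algebra :: "('a::infinite) mtl \<Rightarrow> bool" where
  "dp_algebra A \<longleftrightarrow> A \<in> variety_generated {B. dp_chain B}"

definition mtl_hom :: "'a mtl \<Rightarrow> 'b mtl \<Rightarrow> ('a \<Rightarrow> 'b) set" where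
  "mtl_hom A B = {h \<in> carrier A \<rightarrow> carrier B.
    h \<one>\<^bsub>A\<^esub> = \<one>\<^bsub>B\<^esub> \<and> h (falsum A) = falsum B \<and>
    (\<forall>x \<in> carrier A. \<forall>y \<in> carrier A.
      h (x \<otimes>\<^bsub>A\<^esub> y) = h x \<otimes>\<^bsub>B\<^esub> h y \<and>
      h (wedge A x y) = wedge B (h x) (h y) \<and>
      h (vee A x y) = vee B (h x) (h y) \<and>
      h (impl A x y) = impl B (h x) (h y))}"

definition DP_fin :: "('a::infinite mtl, 'a \<rightharpoonup> 'a) cat" where
  "DP_fin = \<lparr>
    Ob = {A. dp_algebra A \<and> finite (carrier A)},
    Hom = (\<lambda>A B. {(Some \<circ> h) |` carrier A |h. h \<in> mtl_hom A B}),
    Id = (\<lambda>A. Some |` carrier A),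
    Comp = (\<lambda>g f. g \<circ>\<^sub>m f)\<rparr>"

end

theory Submission
  imports Defs
begin

text \<open>
  All three categories are compared with a skeleton. Finite families of chains, of pairs
  \<open>(1, J)\<close> and of DP-chains are free coproduct completions, so for the first equivalence single
  chains suffice. If the target is not a singleton, an arrow of \<open>MC\<^sup>\<top>\<close> sends exactly the maximum to
  the maximum; removing the maxima leaves an order-preserving surjection, and for finite chains
  this is the same as an order- and downset-preserving map that preserves the maximum. If the
  target is a singleton there is exactly one arrow, matching the nowhere defined map.

  A chain with \<open>n + 1\<close> elements is dual to the DP-chain of its \<open>n + 2\<close> downsets. Homomorphisms of
  nontrivial DP-chains are the strictly increasing maps that preserve \<open>0\<close>, \<open>1\<close> and, beyond the
  two-element chain, the coatom; through the Galois connection \<open>x < k c \<longleftrightarrow> u x < c\<close> they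
  correspond to the arrows \<open>u\<close>. A homomorphism from a product to a chain factors through one
  projection, because a chain has no nontrivial idempotents. Finally, in a DP-algebra squares are
  complemented idempotents, and below a minimal nonzero idempotent \<open>e\<close> of a finite DP-algebra the
  identity \<open>(x \<rightarrow> y)\<^sup>2 \<or> (y \<rightarrow> x)\<^sup>2 = 1\<close> makes the order linear; so the maps \<open>x \<mapsto> e x\<close> decompose
  the algebra into a product of DP-chains.
\<close>

section \<open>Weak equivalences\<close>

text \<open>The types carrying chains, trees and algebras are unrelated, so no functor can be the
  identity on underlying sets; every comparison passes through categories on natural numbers, and
  infinite types enter because they realise every finite size. This calls for a notion of comparison
  that can be composed and reversed: functors bijective on hom-sets and essentially surjective, from
  which the two natural isomorphisms in \<open>equivalent\<close> are built once and for all. The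
  delicate cases are degenerate ones: the one-element target, where the condition on the maximum
  lapses; its counterpart, the empty chain, reached from everything by exactly one map; and the
  two-element algebra, whose coatom coincides with \<open>falsum\<close>. The trivial algebra is the
  empty product, dual to the empty family. For algebras, membership in the variety gives only
  equations valid in all DP-chains, so the decomposition is run from four identities about squares.
  Conversely, the generating chains live in the type of the algebra, so standard chains on numbers
  must be copied there before their products can be placed in the variety.\<close>

locale weak_equivalence = cat_functor C D F
  for C :: "('o, 'm) cat" and D :: "('p, 'n) cat" and F :: "('o, 'm, 'p, 'n) func" +
  assumes FArr_bij: "\<lbrakk>X \<in> Ob C; Y \<in> Ob C\<rbrakk>
      \<Longrightarrow> bij_betw (FArr F X Y) (Hom C X Y) (Hom D (FOb F X) (FOb F Y))"
    and FOb_ess_surj: "Z \<in> Ob D \<Longrightarrow> \<exists>X \<in> Ob C. \<exists>f. is_iso D (FOb F X) Z f"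

lemma (in category) is_iso_Id: "X \<in> Ob C \<Longrightarrow> is_iso C X X (Id C X)"
  unfolding is_iso_def using Comp_Id_left Id_in_Hom by blast

lemma (in category) is_iso_Comp:
  assumes ob: "X \<in> Ob C" "Y \<in> Ob C" "Z \<in> Ob C"
    and f: "is_iso C X Y f" and g: "is_iso C Y Z g"
  shows "is_iso C X Z (Comp C g f)"
proof -
  obtain f' where f': "f \<in> Hom C X Y" "f' \<in> Hom C Y X" "Comp C f' f = Id C X" "Comp C f f' = Id C Y"
    using f by (auto simp: is_iso_def)
  obtain g' where g': "g \<in> Hom C Y Z" "g' \<in> Hom C Z Y" "Comp C g' g = Id C Y" "Comp C g g' = Id C Z"
    using g by (auto simp: is_iso_def)
  have gf: "Comp C g f \<in> Hom C X Z" and fg: "Comp C f' g' \<in> Hom C Z X"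
    using f' g' ob Comp_in_Hom by blast+
  have "Comp C (Comp C f' g') (Comp C g f) = Comp C f' (Comp C g' (Comp C g f))"
    using Comp_assoc[OF ob(1,3,2,1) gf g'(2) f'(2)] by simp
  also have "\<dots> = Comp C f' f"
    using Comp_assoc[OF ob(1,2,3,2) f'(1) g'(1,2)] Comp_Id_left[OF ob(1,2) f'(1)] g'(3) by simp
  finally have 1: "Comp C (Comp C f' g') (Comp C g f) = Id C X" using f'(3) by simp
  have "Comp C (Comp C g f) (Comp C f' g') = Comp C g (Comp C f (Comp C f' g'))"
    using Comp_assoc[OF ob(3,1,2,3) fg f'(1) g'(1)] by simp
  also have "\<dots> = Comp C g g'"
    using Comp_assoc[OF ob(3,2,1,2) g'(2) f'(2,1)] Comp_Id_left[OF ob(3,2) g'(2)] f'(4) by simp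
  finally have 2: "Comp C (Comp C g f) (Comp C f' g') = Id C Z" using g'(4) by simp
  show ?thesis unfolding is_iso_def using gf fg 1 2 by blast
qed

lemma (in cat_functor) is_iso_FArr:
  assumes "X \<in> Ob C" "Y \<in> Ob C" "is_iso C X Y f"
  shows "is_iso D (FOb F X) (FOb F Y) (FArr F X Y f)"
  using assms unfolding is_iso_def by (metis FArr_Comp FArr_Id FArr_in_Hom)

lemma (in category) is_iso_inverse:
  "is_iso C X Y f \<Longrightarrow> \<exists>g. is_iso C Y X g \<and> Comp C g f = Id C X \<and> Comp C f g = Id C Y"
  unfolding is_iso_def by blast

text \<open>Conjugation with the inverse isomorphisms undoes it. In \<open>quasi_inverse\<close>
  this is one half of the bijection on hom-sets of the constructed functor.\<close>

lemma (in category) bij_betw_conj_iso: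
  assumes ob: "X \<in> Ob C" "Y \<in> Ob C" "X' \<in> Ob C" "Y' \<in> Ob C"
    and a: "is_iso C X' X a" and b: "is_iso C Y Y' b"
  shows "bij_betw (\<lambda>f. Comp C b (Comp C f a)) (Hom C X Y) (Hom C X' Y')"
proof -
  obtain a' where a': "a \<in> Hom C X' X" "a' \<in> Hom C X X'" "Comp C a' a = Id C X'" "Comp C a a' = Id C X"
    using a by (auto simp: is_iso_def)
  obtain b' where b': "b \<in> Hom C Y Y'" "b' \<in> Hom C Y' Y" "Comp C b' b = Id C Y" "Comp C b b' = Id C Y'"
    using b by (auto simp: is_iso_def)
  \<comment> \<open>Stated for arbitrary \<open>r\<close>, \<open>s\<close>, \<open>p\<close>,
    \<open>q\<close>, since both composites of the two conjugations are instances, with isomorphisms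
    and inverses exchanged.\<close>
  have cancel: "Comp C q (Comp C (Comp C p (Comp C f r)) s) = f"
    if "U \<in> Ob C" "V \<in> Ob C" "U' \<in> Ob C" "V' \<in> Ob C" "f \<in> Hom C U V"
      "r \<in> Hom C U' U" "s \<in> Hom C U U'" "Comp C r s = Id C U"
      "p \<in> Hom C V V'" "q \<in> Hom C V' V" "Comp C q p = Id C V"
    for U V U' V' f r s p q
  proof -
    have fr: "Comp C f r \<in> Hom C U' V" using that Comp_in_Hom by blast
    have "Comp C (Comp C p (Comp C f r)) s = Comp C p (Comp C (Comp C f r) s)"
      using Comp_assoc[OF _ _ _ _ that(7) fr that(9)] that by simp
    also have "Comp C (Comp C f r) s = f"
      using Comp_assoc[OF _ _ _ _ that(7,6,5)] Comp_Id_right[OF _ _ that(5)] that by simp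
    finally show ?thesis
      using Comp_assoc[OF _ _ _ _ that(5,9,10)] Comp_Id_left[OF _ _ that(5)] that by simp
  qed
  show ?thesis
  proof (rule bij_betw_byWitness[where f' = "\<lambda>f. Comp C b' (Comp C f a')"])
    show "\<forall>f\<in>Hom C X Y. Comp C b' (Comp C (Comp C b (Comp C f a)) a') = f"
      using cancel[of X Y X' Y' _ a a' b b'] ob a' b' by simp
    show "\<forall>f\<in>Hom C X' Y'. Comp C b (Comp C (Comp C b' (Comp C f a')) a) = f"
      using cancel[of X' Y' X Y _ a' a b' b] ob a' b' by simp
    show "(\<lambda>f. Comp C b (Comp C f a)) ` Hom C X Y \<subseteq> Hom C X' Y'"
      using ob a' b' Comp_in_Hom by blast
    show "(\<lambda>f. Comp C b' (Comp C f a')) ` Hom C X' Y' \<subseteq> Hom C X Y"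
      using ob a' b' Comp_in_Hom by blast
  qed
qed

lemma weak_equivalence_comp:
  assumes F: "weak_equivalence C D F" and G: "weak_equivalence D E G"
  shows "weak_equivalence C E (comp_func G F)"
proof -
  interpret F: weak_equivalence C D F by fact
  interpret G: weak_equivalence D E G by fact
  show ?thesis
  proof
    fix X Y assume "X \<in> Ob C" "Y \<in> Ob C"
    then show "bij_betw (FArr (comp_func G F) X Y) (Hom C X Y)
        (Hom E (FOb (comp_func G F) X) (FOb (comp_func G F) Y))"
      using bij_betw_trans[OF F.FArr_bij G.FArr_bij] by (simp add: comp_func_def F.FOb_in_Ob comp_def)
  next
    fix Z assume Z: "Z \<in> Ob E"
    then obtain Y g where Y: "Y \<in> Ob D" "is_iso E (FOb G Y) Z g" using G.FOb_ess_surj by blast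
    then obtain X f where X: "X \<in> Ob C" "is_iso D (FOb F X) Y f" using F.FOb_ess_surj by blast
    have "is_iso E (FOb G (FOb F X)) Z (Comp E g (FArr G (FOb F X) Y f))"
      using X Y Z by (intro G.D.is_iso_Comp[of _ "FOb G Y"] G.is_iso_FArr G.FOb_in_Ob F.FOb_in_Ob)
    with X(1) show "\<exists>X\<in>Ob C. \<exists>f. is_iso E (FOb (comp_func G F) X) Z f"
      by (auto simp: comp_func_def)
  qed (auto simp: comp_func_def F.FOb_in_Ob G.FOb_in_Ob F.FArr_in_Hom G.FArr_in_Hom
      F.FArr_Id G.FArr_Id F.FArr_Comp intro!: G.FArr_Comp)
qed

text \<open>Choice picks for each \<open>Y\<close> an object \<open>g Y\<close> and an isomorphism
  \<open>\<epsilon> Y\<close> from its image to \<open>Y\<close>; the value on an arrow is then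
  forced, as the unique preimage under \<open>F\<close> of its conjugate. Equations in
  \<open>C\<close> are checked after applying \<open>F\<close>, which is faithful. The inverse is
  again a weak equivalence, whence symmetry.\<close>

lemma (in weak_equivalence) quasi_inverse:
  "\<exists>G. weak_equivalence D C G \<and>
    (\<exists>\<eta>. natural_iso C C id_func (comp_func G F) \<eta>) \<and>
    (\<exists>\<epsilon>. natural_iso D D (comp_func F G) id_func \<epsilon>)"
proof -
  have "\<forall>Y\<in>Ob D. \<exists>p. fst p \<in> Ob C \<and> is_iso D (FOb F (fst p)) Y (snd p)"
    using FOb_ess_surj by force
  then obtain p where p: "\<And>Y. Y \<in> Ob D \<Longrightarrow> fst (p Y) \<in> Ob C"
      "\<And>Y. Y \<in> Ob D \<Longrightarrow> is_iso D (FOb F (fst (p Y))) Y (snd (p Y))"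
    by (metis (lifting) bchoice)
  define g where "g Y = fst (p Y)" for Y
  define \<epsilon> where "\<epsilon> Y = snd (p Y)" for Y
  have g: "g Y \<in> Ob C" and Fg: "FOb F (g Y) \<in> Ob D" and \<epsilon>: "is_iso D (FOb F (g Y)) Y (\<epsilon> Y)"
    if "Y \<in> Ob D" for Y
    using p that by (auto simp: g_def \<epsilon>_def FOb_in_Ob)
  have "\<forall>Y\<in>Ob D. \<exists>d. is_iso D Y (FOb F (g Y)) d \<and>
      Comp D d (\<epsilon> Y) = Id D (FOb F (g Y)) \<and> Comp D (\<epsilon> Y) d = Id D Y"
    using \<epsilon> D.is_iso_inverse by blast
  then obtain \<delta> where \<delta>: "\<And>Y. Y \<in> Ob D \<Longrightarrow> is_iso D Y (FOb F (g Y)) (\<delta> Y)"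
      and \<delta>\<epsilon>: "\<And>Y. Y \<in> Ob D \<Longrightarrow> Comp D (\<delta> Y) (\<epsilon> Y) = Id D (FOb F (g Y))"
      and \<epsilon>\<delta>: "\<And>Y. Y \<in> Ob D \<Longrightarrow> Comp D (\<epsilon> Y) (\<delta> Y) = Id D Y"
    by (metis (lifting) bchoice)
  have \<epsilon>h: "\<epsilon> Y \<in> Hom D (FOb F (g Y)) Y" and \<delta>h: "\<delta> Y \<in> Hom D Y (FOb F (g Y))" if "Y \<in> Ob D" for Y
    using \<epsilon> \<delta> that by (auto simp: is_iso_def)
  define L where "L X Y = inv_into (Hom C X Y) (FArr F X Y)" for X Y
  have L_bij: "bij_betw (L X Y) (Hom D (FOb F X) (FOb F Y)) (Hom C X Y)"
    if "X \<in> Ob C" "Y \<in> Ob C" for X Y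
    unfolding L_def using FArr_bij[OF that] by (rule bij_betw_inv_into)
  have L_in: "L X Y k \<in> Hom C X Y" if "X \<in> Ob C" "Y \<in> Ob C" "k \<in> Hom D (FOb F X) (FOb F Y)" for X Y k
    using L_bij[OF that(1,2)] that(3) by (auto simp: bij_betw_def)
  have F_L: "FArr F X Y (L X Y k) = k" if "X \<in> Ob C" "Y \<in> Ob C" "k \<in> Hom D (FOb F X) (FOb F Y)" for X Y k
    unfolding L_def using bij_betw_inv_into_right[OF FArr_bij[OF that(1,2)] that(3)] .
  have F_inj: "f = f'" if "FArr F X Y f = FArr F X Y f'" "X \<in> Ob C" "Y \<in> Ob C"
      "f \<in> Hom C X Y" "f' \<in> Hom C X Y" for X Y f f'
    using FArr_bij[OF that(2,3)] that by (auto simp: bij_betw_def inj_on_def)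
  define G where "G = \<lparr>FOb = g, FArr = (\<lambda>Y Y' f. L (g Y) (g Y') (Comp D (\<delta> Y') (Comp D f (\<epsilon> Y))))\<rparr>"
  have conj_bij: "bij_betw (\<lambda>f. Comp D (\<delta> Y') (Comp D f (\<epsilon> Y))) (Hom D Y Y')
      (Hom D (FOb F (g Y)) (FOb F (g Y')))" if "Y \<in> Ob D" "Y' \<in> Ob D" for Y Y'
    using that by (intro D.bij_betw_conj_iso Fg \<epsilon> \<delta>)
  have conj_in: "Comp D (\<delta> Y') (Comp D f (\<epsilon> Y)) \<in> Hom D (FOb F (g Y)) (FOb F (g Y'))"
    if "Y \<in> Ob D" "Y' \<in> Ob D" "f \<in> Hom D Y Y'" for Y Y' f
    using conj_bij[OF that(1,2)] that(3) by (auto simp: bij_betw_def)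
  have FG: "FArr F (g Y) (g Y') (FArr G Y Y' f) = Comp D (\<delta> Y') (Comp D f (\<epsilon> Y))"
    if "Y \<in> Ob D" "Y' \<in> Ob D" "f \<in> Hom D Y Y'" for Y Y' f
    using F_L[OF g g conj_in] that by (simp add: G_def)
  have G_in: "FArr G Y Y' f \<in> Hom C (g Y) (g Y')" if "Y \<in> Ob D" "Y' \<in> Ob D" "f \<in> Hom D Y Y'" for Y Y' f
    using L_in[OF g g conj_in] that by (simp add: G_def)
  have iso_L: "is_iso C X Y (L X Y k)"
    if XY: "X \<in> Ob C" "Y \<in> Ob C" and k: "is_iso D (FOb F X) (FOb F Y) k" for X Y k
  proof -
    obtain k' where k': "k \<in> Hom D (FOb F X) (FOb F Y)" "k' \<in> Hom D (FOb F Y) (FOb F X)"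
        "Comp D k' k = Id D (FOb F X)" "Comp D k k' = Id D (FOb F Y)"
      using k by (auto simp: is_iso_def)
    note Lk = L_in[OF XY k'(1)] and Lk' = L_in[OF XY(2,1) k'(2)]
    have "Comp C (L Y X k') (L X Y k) = Id C X"
      by (rule F_inj[OF _ XY(1,1)])
        (use XY k' Lk Lk' in \<open>auto simp: FArr_Comp F_L FArr_Id intro: C.Comp_in_Hom C.Id_in_Hom\<close>)
    moreover have "Comp C (L X Y k) (L Y X k') = Id C Y"
      by (rule F_inj[OF _ XY(2,2)])
        (use XY k' Lk Lk' in \<open>auto simp: FArr_Comp F_L FArr_Id intro: C.Comp_in_Hom C.Id_in_Hom\<close>)
    ultimately show ?thesis using Lk Lk' by (auto simp: is_iso_def)
  qed
  \<comment> \<open>The unit at \<open>X\<close> is the lift through \<open>F\<close> of the inverse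
    counit at \<open>FOb F X\<close>, so its naturality reduces to cancelling
    \<open>\<epsilon>\<close> against \<open>\<delta>\<close>.\<close>
  define \<eta> where "\<eta> X = L X (g (FOb F X)) (\<delta> (FOb F X))" for X
  have \<eta>: "is_iso C X (g (FOb F X)) (\<eta> X)" if "X \<in> Ob C" for X
    unfolding \<eta>_def using that by (intro iso_L g \<delta> FOb_in_Ob)
  have F\<eta>: "FArr F X (g (FOb F X)) (\<eta> X) = \<delta> (FOb F X)" if "X \<in> Ob C" for X
    unfolding \<eta>_def using that by (intro F_L g \<delta>h FOb_in_Ob)
  have G_we: "weak_equivalence D C G"
  proof
    fix Y assume Y: "Y \<in> Ob D"
    show "FOb G Y \<in> Ob C" using g[OF Y] by (simp add: G_def)
    show "FArr G Y Y (Id D Y) = Id C (FOb G Y)"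
      by (rule F_inj[of "g Y" "g Y"])
        (use Y in \<open>auto simp: FG G_in D.Id_in_Hom C.Id_in_Hom g FArr_Id G_def[THEN arg_cong, of FOb]
          D.Comp_Id_left[OF Fg _ \<epsilon>h] \<delta>\<epsilon>\<close>)
  next
    fix Y Y' f assume "Y \<in> Ob D" "Y' \<in> Ob D" "f \<in> Hom D Y Y'"
    then show "FArr G Y Y' f \<in> Hom C (FOb G Y) (FOb G Y')"
      using G_in by (simp add: G_def)
  next
    fix X Y Z f h assume ob: "X \<in> Ob D" "Y \<in> Ob D" "Z \<in> Ob D"
      and f: "f \<in> Hom D X Y" and h: "h \<in> Hom D Y Z"
    note hf = D.Comp_in_Hom[OF ob f h]
    have "FArr G X Z (Comp D h f) = Comp C (FArr G Y Z h) (FArr G X Y f)"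
    proof (rule F_inj[of "g X" "g Z"])
      let ?f = "Comp D f (\<epsilon> X)"
      have f\<epsilon>: "?f \<in> Hom D (FOb F (g X)) Y" and h\<epsilon>: "Comp D h (\<epsilon> Y) \<in> Hom D (FOb F (g Y)) Z"
        and \<delta>f: "Comp D (\<delta> Y) ?f \<in> Hom D (FOb F (g X)) (FOb F (g Y))"
        using ob f h Fg \<epsilon>h \<delta>h D.Comp_in_Hom by meson+
      \<comment> \<open>After applying \<open>F\<close> both factors are conjugates, and the inner
        pair \<open>\<epsilon> Y\<close>, \<open>\<delta> Y\<close> cancels.\<close>
      have "Comp D (Comp D (\<delta> Z) (Comp D h (\<epsilon> Y))) (Comp D (\<delta> Y) ?f)
          = Comp D (\<delta> Z) (Comp D (Comp D h (\<epsilon> Y)) (Comp D (\<delta> Y) ?f))"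
        using D.Comp_assoc[OF _ _ _ _ \<delta>f h\<epsilon> \<delta>h] ob Fg by simp
      also have "Comp D (Comp D h (\<epsilon> Y)) (Comp D (\<delta> Y) ?f) = Comp D h (Comp D (\<epsilon> Y) (Comp D (\<delta> Y) ?f))"
        using D.Comp_assoc[OF _ _ _ _ \<delta>f \<epsilon>h h] ob Fg by simp
      also have "Comp D (\<epsilon> Y) (Comp D (\<delta> Y) ?f) = ?f"
        using D.Comp_assoc[OF _ _ _ _ f\<epsilon> \<delta>h \<epsilon>h] \<epsilon>\<delta> D.Comp_Id_left[OF _ _ f\<epsilon>] ob Fg by simp
      also have "Comp D h ?f = Comp D (Comp D h f) (\<epsilon> X)"
        using D.Comp_assoc[OF _ _ _ _ \<epsilon>h f h] ob Fg by simp
      finally show "FArr F (g X) (g Z) (FArr G X Z (Comp D h f)) =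
          FArr F (g X) (g Z) (Comp C (FArr G Y Z h) (FArr G X Y f))"
        using ob f h hf by (simp add: FG FArr_Comp[OF g g g G_in G_in])
    qed (use ob f h hf g G_in in \<open>auto intro: C.Comp_in_Hom[where Y = "g Y"]\<close>)
    then show "FArr G X Z (Comp D h f) = Comp C (FArr G Y Z h) (FArr G X Y f)" .
  next
    fix Y Y' assume "Y \<in> Ob D" "Y' \<in> Ob D"
    then show "bij_betw (FArr G Y Y') (Hom D Y Y') (Hom C (FOb G Y) (FOb G Y'))"
      using bij_betw_trans[OF conj_bij L_bij[OF g g]] by (simp add: G_def comp_def)
  next
    \<comment> \<open>Every \<open>X\<close> is reached from \<open>FOb F X\<close>, by the inverse
      of the unit.\<close>
    fix X assume X: "X \<in> Ob C"
    then show "\<exists>Y\<in>Ob D. \<exists>f. is_iso C (FOb G Y) X f"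
      using FOb_in_Ob[OF X] C.is_iso_inverse[OF \<eta>[OF X]] by (auto simp: G_def)
  qed
  have "natural_iso C C id_func (comp_func G F) \<eta>"
    unfolding natural_iso_def
  proof (intro conjI ballI)
    fix X assume "X \<in> Ob C"
    then show "is_iso C (FOb id_func X) (FOb (comp_func G F) X) (\<eta> X)"
      using \<eta> by (simp add: id_func_def comp_func_def G_def)
  next
    fix X Y f assume X: "X \<in> Ob C" and Y: "Y \<in> Ob C" and f: "f \<in> Hom C X Y"
    note FX = FOb_in_Ob[OF X] and FY = FOb_in_Ob[OF Y] and Ff = FArr_in_Hom[OF X Y f]
    have \<eta>X: "\<eta> X \<in> Hom C X (g (FOb F X))" and \<eta>Y: "\<eta> Y \<in> Hom C Y (g (FOb F Y))"
      using \<eta> X Y by (auto simp: is_iso_def)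
    have "Comp C (\<eta> Y) f = Comp C (FArr G (FOb F X) (FOb F Y) (FArr F X Y f)) (\<eta> X)"
    proof (rule F_inj[OF _ X g[OF FY]])
      have f\<epsilon>: "Comp D (FArr F X Y f) (\<epsilon> (FOb F X)) \<in> Hom D (FOb F (g (FOb F X))) (FOb F Y)"
        using FX FY Ff Fg \<epsilon>h D.Comp_in_Hom by meson
      have "Comp D (Comp D (\<delta> (FOb F Y)) (Comp D (FArr F X Y f) (\<epsilon> (FOb F X)))) (\<delta> (FOb F X))
          = Comp D (\<delta> (FOb F Y)) (FArr F X Y f)"
        using D.Comp_assoc[OF _ _ _ _ \<delta>h f\<epsilon> \<delta>h] D.Comp_assoc[OF _ _ _ _ \<delta>h \<epsilon>h Ff] \<epsilon>\<delta>
          D.Comp_Id_right[OF _ _ Ff] FX FY Fg by simp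
      then show "FArr F X (g (FOb F Y)) (Comp C (\<eta> Y) f) =
          FArr F X (g (FOb F Y)) (Comp C (FArr G (FOb F X) (FOb F Y) (FArr F X Y f)) (\<eta> X))"
        using FArr_Comp[OF X Y g[OF FY] f \<eta>Y] FArr_Comp[OF X g[OF FX] g[OF FY] \<eta>X G_in[OF FX FY Ff]]
          FG[OF FX FY Ff] F\<eta>[OF X] F\<eta>[OF Y] by simp
    qed (use X Y f FX FY Ff \<eta>X \<eta>Y g G_in in \<open>auto intro: C.Comp_in_Hom[where Y = Y] C.Comp_in_Hom[where Y = "g (FOb F X)"]\<close>)
    then show "Comp C (\<eta> Y) (FArr id_func X Y f) = Comp C (FArr (comp_func G F) X Y f) (\<eta> X)"
      by (simp add: id_func_def comp_func_def)
  qed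
  moreover have "natural_iso D D (comp_func F G) id_func \<epsilon>"
    unfolding natural_iso_def
  proof (intro conjI ballI)
    fix Y assume "Y \<in> Ob D"
    then show "is_iso D (FOb (comp_func F G) Y) (FOb id_func Y) (\<epsilon> Y)"
      using \<epsilon> by (simp add: id_func_def comp_func_def G_def)
  next
    fix X Y f assume X: "X \<in> Ob D" and Y: "Y \<in> Ob D" and f: "f \<in> Hom D X Y"
    have f\<epsilon>: "Comp D f (\<epsilon> X) \<in> Hom D (FOb F (g X)) Y"
      using X Y f Fg \<epsilon>h D.Comp_in_Hom by meson
    have "Comp D (\<epsilon> Y) (FArr F (g X) (g Y) (FArr G X Y f)) = Comp D f (\<epsilon> X)"
      using D.Comp_assoc[OF _ _ _ _ f\<epsilon> \<delta>h \<epsilon>h] \<epsilon>\<delta> D.Comp_Id_left[OF _ _ f\<epsilon>] FG[OF X Y f] X Y Fg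
      by simp
    then show "Comp D (\<epsilon> Y) (FArr (comp_func F G) X Y f) = Comp D (FArr id_func X Y f) (\<epsilon> X)"
      by (simp add: id_func_def comp_func_def G_def)
  qed
  ultimately show ?thesis using G_we by blast
qed

text \<open>Quantifying the functor away leaves a symmetric and transitive relation, so comparisons
  can be chained through a skeleton and traversed in either direction.\<close>

definition weakly_equivalent :: "('o, 'm) cat \<Rightarrow> ('p, 'n) cat \<Rightarrow> bool" where
  "weakly_equivalent C D \<longleftrightarrow> (\<exists>F. weak_equivalence C D F)"

lemma weakly_equivalent_sym: "weakly_equivalent C D \<Longrightarrow> weakly_equivalent D C"
  unfolding weakly_equivalent_def using weak_equivalence.quasi_inverse by blast

lemma weakly_equivalent_trans:
  "weakly_equivalent C D \<Longrightarrow> weakly_equivalent D E \<Longrightarrow> weakly_equivalent C E"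
  unfolding weakly_equivalent_def using weak_equivalence_comp by blast

lemma weakly_equivalent_imp_equivalent: "weakly_equivalent C D \<Longrightarrow> equivalent C D"
  unfolding weakly_equivalent_def equivalent_def
  using weak_equivalence.quasi_inverse weak_equivalence.axioms(1) by metis

section \<open>Families\<close>

text \<open>The free finite coproduct completion; a family is a list, as in the definition of \<^const>\<open>MC\<close>.\<close>

definition Fam :: "('o, 'm) cat \<Rightarrow> ('o list, (nat \<times> 'm) list) cat" where
  "Fam C = \<lparr>
    Ob = {X. set X \<subseteq> Ob C},
    Hom = (\<lambda>X Y. {h. length h = length X \<and>
      (\<forall>i < length X. case h ! i of (j, u) \<Rightarrow> j < length Y \<and> u \<in> Hom C (X ! i) (Y ! j))}),
    Id = (\<lambda>X. map (\<lambda>i. (i, Id C (X ! i))) [0..<length X]),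
    Comp = (\<lambda>h' h. map (\<lambda>(j, u). case h' ! j of (k, v) \<Rightarrow> (k, Comp C v u)) h)\<rparr>"

definition Fam_func :: "('o, 'm, 'p, 'n) func \<Rightarrow>
    ('o list, (nat \<times> 'm) list, 'p list, (nat \<times> 'n) list) func" where
  "Fam_func F = \<lparr>FOb = map (FOb F),
    FArr = (\<lambda>X Y h. map (\<lambda>i. case h ! i of (j, u) \<Rightarrow> (j, FArr F (X ! i) (Y ! j) u)) [0..<length h])\<rparr>"

lemma Fam_Hom_iff: "h \<in> Hom (Fam C) X Y \<longleftrightarrow> length h = length X \<and>
    (\<forall>i < length X. fst (h ! i) < length Y \<and> snd (h ! i) \<in> Hom C (X ! i) (Y ! fst (h ! i)))"
  by (auto simp: Fam_def split_def)

lemma Fam_Ob_iff: "X \<in> Ob (Fam C) \<longleftrightarrow> (\<forall>i < length X. X ! i \<in> Ob C)"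
  by (auto simp: Fam_def subset_iff in_set_conv_nth)

lemma length_Fam_Id [simp]: "length (Id (Fam C) X) = length X"
  by (simp add: Fam_def)

lemma Fam_Id_nth [simp]: "i < length X \<Longrightarrow> Id (Fam C) X ! i = (i, Id C (X ! i))"
  by (simp add: Fam_def)

lemma length_Fam_Comp [simp]: "length (Comp (Fam C) h' h) = length h"
  by (simp add: Fam_def)

lemma Fam_Comp_nth [simp]: "i < length h \<Longrightarrow>
    Comp (Fam C) h' h ! i = (fst (h' ! fst (h ! i)), Comp C (snd (h' ! fst (h ! i))) (snd (h ! i)))"
  by (simp add: Fam_def split_def)

lemma category_Fam: "category C \<Longrightarrow> category (Fam C)"
proof -
  assume "category C"
  then interpret category C .
  show ?thesis
  proof
    fix X assume "X \<in> Ob (Fam C)"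
    then show "Id (Fam C) X \<in> Hom (Fam C) X X"
      by (auto simp: Fam_Hom_iff Id_in_Hom Fam_Ob_iff)
  next
    fix X Y Z f g assume "X \<in> Ob (Fam C)" "Y \<in> Ob (Fam C)" "Z \<in> Ob (Fam C)"
      "f \<in> Hom (Fam C) X Y" "g \<in> Hom (Fam C) Y Z"
    then show "Comp (Fam C) g f \<in> Hom (Fam C) X Z"
      by (auto simp: Fam_Hom_iff Fam_Ob_iff intro!: Comp_in_Hom[where Y = "Y ! fst (f ! _)"])
  next
    fix X Y f assume "X \<in> Ob (Fam C)" "Y \<in> Ob (Fam C)" "f \<in> Hom (Fam C) X Y"
    then have f: "length f = length X" "\<And>i. i < length X \<Longrightarrow> fst (f ! i) < length Y"
      "\<And>i. i < length X \<Longrightarrow> Comp C (snd (f ! i)) (Id C (X ! i)) = snd (f ! i)"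
      "\<And>i. i < length X \<Longrightarrow> Comp C (Id C (Y ! fst (f ! i))) (snd (f ! i)) = snd (f ! i)"
      using Comp_Id_right Comp_Id_left by (auto simp: Fam_Hom_iff Fam_Ob_iff)
    then show "Comp (Fam C) f (Id (Fam C) X) = f" "Comp (Fam C) (Id (Fam C) Y) f = f"
      by (auto simp: prod_eq_iff intro!: nth_equalityI)
  next
    fix W X Y Z f g h
    assume ob: "W \<in> Ob (Fam C)" "X \<in> Ob (Fam C)" "Y \<in> Ob (Fam C)" "Z \<in> Ob (Fam C)"
      and f: "f \<in> Hom (Fam C) W X" and g: "g \<in> Hom (Fam C) X Y" and h: "h \<in> Hom (Fam C) Y Z"
    show "Comp (Fam C) h (Comp (Fam C) g f) = Comp (Fam C) (Comp (Fam C) h g) f"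
    proof (rule nth_equalityI)
      fix i assume "i < length (Comp (Fam C) h (Comp (Fam C) g f))"
      then show "Comp (Fam C) h (Comp (Fam C) g f) ! i = Comp (Fam C) (Comp (Fam C) h g) f ! i"
        using ob f g h
        by (auto simp: Fam_Hom_iff Fam_Ob_iff intro!: Comp_assoc
          [where W = "W ! i" and X = "X ! fst (f ! i)" and Y = "Y ! fst (g ! fst (f ! i))"
            and Z = "Z ! fst (h ! fst (g ! fst (f ! i)))"])
    qed simp
  qed
qed

lemma FOb_Fam_func [simp]: "FOb (Fam_func F) = map (FOb F)"
  by (simp add: Fam_func_def)

lemma length_FArr_Fam_func [simp]: "length (FArr (Fam_func F) X Y h) = length h"
  by (simp add: Fam_func_def)

lemma FArr_Fam_func_nth [simp]: "i < length h \<Longrightarrow>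
    FArr (Fam_func F) X Y h ! i = (fst (h ! i), FArr F (X ! i) (Y ! fst (h ! i)) (snd (h ! i)))"
  by (simp add: Fam_func_def split_def)

text \<open>A morphism of families is a reindexing together with arrows between members. The functor
  leaves the reindexing alone, so every requirement can be met member by member.\<close>

lemma weak_equivalence_Fam:
  assumes "weak_equivalence C D F"
  shows "weak_equivalence (Fam C) (Fam D) (Fam_func F)"
proof -
  interpret weak_equivalence C D F by fact
  interpret FC: category "Fam C" by (rule category_Fam) unfold_locales
  interpret FD: category "Fam D" by (rule category_Fam) unfold_locales
  show ?thesis
  proof
    fix X assume X: "X \<in> Ob (Fam C)"
    then show "FOb (Fam_func F) X \<in> Ob (Fam D)"
      by (auto simp: Fam_Ob_iff FOb_in_Ob)
    show "FArr (Fam_func F) X X (Id (Fam C) X) = Id (Fam D) (FOb (Fam_func F) X)"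
      using X by (auto intro!: nth_equalityI simp: Fam_Ob_iff FArr_Id)
  next
    fix X Y f assume "X \<in> Ob (Fam C)" "Y \<in> Ob (Fam C)" "f \<in> Hom (Fam C) X Y"
    then show "FArr (Fam_func F) X Y f \<in> Hom (Fam D) (FOb (Fam_func F) X) (FOb (Fam_func F) Y)"
      by (auto simp: Fam_Ob_iff Fam_Hom_iff FArr_in_Hom)
  next
    fix X Y Z f g assume "X \<in> Ob (Fam C)" "Y \<in> Ob (Fam C)" "Z \<in> Ob (Fam C)"
      "f \<in> Hom (Fam C) X Y" "g \<in> Hom (Fam C) Y Z"
    then show "FArr (Fam_func F) X Z (Comp (Fam C) g f)
        = Comp (Fam D) (FArr (Fam_func F) Y Z g) (FArr (Fam_func F) X Y f)"
      by (auto intro!: nth_equalityI FArr_Comp simp: Fam_Ob_iff Fam_Hom_iff)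
  next
    fix X Y assume X: "X \<in> Ob (Fam C)" and Y: "Y \<in> Ob (Fam C)"
    have bij: "bij_betw (FArr F (X ! i) (Y ! j)) (Hom C (X ! i) (Y ! j))
        (Hom D (FOb F (X ! i)) (FOb F (Y ! j)))" if "i < length X" "j < length Y" for i j
      using that X Y by (auto simp: Fam_Ob_iff intro: FArr_bij)
    \<comment> \<open>The target index survives the functor, so it tells in which hom-set each
      component has to be inverted.\<close>
    define R where "R h = map (\<lambda>i. (fst (h ! i), inv_into (Hom C (X ! i) (Y ! fst (h ! i)))
        (FArr F (X ! i) (Y ! fst (h ! i))) (snd (h ! i)))) [0..<length h]" for h :: "(nat \<times> 'd) list"
    show "bij_betw (FArr (Fam_func F) X Y) (Hom (Fam C) X Y)
        (Hom (Fam D) (FOb (Fam_func F) X) (FOb (Fam_func F) Y))"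
    proof (rule bij_betw_byWitness[where f' = R])
      show "\<forall>h\<in>Hom (Fam C) X Y. R (FArr (Fam_func F) X Y h) = h"
        by (auto intro!: nth_equalityI bij_betw_inv_into_left[OF bij]
          simp: R_def Fam_Hom_iff prod_eq_iff)
      show "\<forall>h\<in>Hom (Fam D) (FOb (Fam_func F) X) (FOb (Fam_func F) Y). FArr (Fam_func F) X Y (R h) = h"
        by (auto intro!: nth_equalityI bij_betw_inv_into_right[OF bij]
          simp: R_def Fam_Hom_iff prod_eq_iff cong: conj_cong)
      show "FArr (Fam_func F) X Y ` Hom (Fam C) X Y \<subseteq> Hom (Fam D) (FOb (Fam_func F) X) (FOb (Fam_func F) Y)"
        using X Y by (auto simp: Fam_Ob_iff Fam_Hom_iff FArr_in_Hom)
      show "R ` Hom (Fam D) (FOb (Fam_func F) X) (FOb (Fam_func F) Y) \<subseteq> Hom (Fam C) X Y"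
        by (auto simp: R_def Fam_Hom_iff intro!: bij_betw_apply[OF bij_betw_inv_into[OF bij]] cong: conj_cong)
    qed
  next
    fix Y assume Y: "Y \<in> Ob (Fam D)"
    then have "\<forall>i\<in>{..<length Y}. \<exists>p. fst p \<in> Ob C \<and> is_iso D (FOb F (fst p)) (Y ! i) (snd p)"
      using FOb_ess_surj by (fastforce simp: Fam_Ob_iff)
    then obtain p where p: "\<And>i. i < length Y \<Longrightarrow> fst (p i) \<in> Ob C"
        "\<And>i. i < length Y \<Longrightarrow> is_iso D (FOb F (fst (p i))) (Y ! i) (snd (p i))"
      by (metis (lifting) bchoice lessThan_iff)
    then have "\<forall>i\<in>{..<length Y}. \<exists>k. k \<in> Hom D (Y ! i) (FOb F (fst (p i))) \<and>
        Comp D k (snd (p i)) = Id D (FOb F (fst (p i))) \<and> Comp D (snd (p i)) k = Id D (Y ! i)"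
      by (auto simp: is_iso_def)
    then obtain k where k: "\<And>i. i < length Y \<Longrightarrow> k i \<in> Hom D (Y ! i) (FOb F (fst (p i))) \<and>
        Comp D (k i) (snd (p i)) = Id D (FOb F (fst (p i))) \<and> Comp D (snd (p i)) (k i) = Id D (Y ! i)"
      by (metis (lifting) bchoice lessThan_iff)
    let ?X = "map (\<lambda>i. fst (p i)) [0..<length Y]"
    have "is_iso (Fam D) (FOb (Fam_func F) ?X) Y (map (\<lambda>i. (i, snd (p i))) [0..<length Y])"
      unfolding is_iso_def
    proof (intro conjI bexI[where x = "map (\<lambda>i. (i, k i)) [0..<length Y]"])
    qed (use p k in \<open>auto simp: Fam_Hom_iff is_iso_def intro!: nth_equalityI\<close>)
    moreover have "?X \<in> Ob (Fam C)" using p by (auto simp: Fam_Ob_iff)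
    ultimately show "\<exists>X\<in>Ob (Fam C). \<exists>f. is_iso (Fam D) (FOb (Fam_func F) X) Y f" by blast
  qed
qed

lemma weakly_equivalent_Fam: "weakly_equivalent C D \<Longrightarrow> weakly_equivalent (Fam C) (Fam D)"
  unfolding weakly_equivalent_def using weak_equivalence_Fam by blast

section \<open>Transport along bijections\<close>

text \<open>Arrows of the source are conjugated by bijections \<open>\<theta> X\<close> of the underlying sets.\<close>

lemma weak_equivalence_transport:
  fixes C :: "('o, 'a \<rightharpoonup> 'a) cat" and D :: "('p, 'b \<rightharpoonup> 'b) cat"
  assumes C: "category C" "Comp C = (\<circ>\<^sub>m)" "\<And>X. X \<in> Ob C \<Longrightarrow> Id C X = Some |` A X"
    and D: "category D" "Comp D = (\<circ>\<^sub>m)" "\<And>Y. Y \<in> Ob D \<Longrightarrow> Id D Y = Some |` B Y"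
    and ob: "\<And>X. X \<in> Ob C \<Longrightarrow> g X \<in> Ob D"
    and inv: "\<And>X. X \<in> Ob C \<Longrightarrow> \<theta>' X \<circ>\<^sub>m \<theta> X = Some |` A X"
      "\<And>X. X \<in> Ob C \<Longrightarrow> \<theta> X \<circ>\<^sub>m \<theta>' X = Some |` B (g X)"
    and fwd: "\<And>X Y u. \<lbrakk>X \<in> Ob C; Y \<in> Ob C; u \<in> Hom C X Y\<rbrakk>
      \<Longrightarrow> \<theta> Y \<circ>\<^sub>m (u \<circ>\<^sub>m \<theta>' X) \<in> Hom D (g X) (g Y)"
    and bwd: "\<And>X Y v. \<lbrakk>X \<in> Ob C; Y \<in> Ob C; v \<in> Hom D (g X) (g Y)\<rbrakk>
      \<Longrightarrow> \<theta>' Y \<circ>\<^sub>m (v \<circ>\<^sub>m \<theta> X) \<in> Hom C X Y"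
    and surj: "\<And>Y. Y \<in> Ob D \<Longrightarrow> \<exists>X \<in> Ob C. \<exists>f. is_iso D (g X) Y f"
  shows "weak_equivalence C D \<lparr>FOb = g, FArr = (\<lambda>X Y u. \<theta> Y \<circ>\<^sub>m (u \<circ>\<^sub>m \<theta>' X))\<rparr>"
proof -
  interpret C: category C by fact
  interpret D: category D by fact
  have assoc: "(u \<circ>\<^sub>m v) \<circ>\<^sub>m w = u \<circ>\<^sub>m (v \<circ>\<^sub>m w)" for u :: "'x \<rightharpoonup> 'y" and v :: "'z \<rightharpoonup> 'x" and w :: "'w \<rightharpoonup> 'z"
    by (auto simp: map_comp_def fun_eq_iff split: option.splits)
  have invC: "\<theta>' X \<circ>\<^sub>m \<theta> X = Id C X" "\<theta> X \<circ>\<^sub>m \<theta>' X = Id D (g X)" if "X \<in> Ob C" for X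
    using inv that C D ob by auto
  have Cr: "u \<circ>\<^sub>m Id C X = u" and Cl: "Id C Y \<circ>\<^sub>m u = u"
    if "X \<in> Ob C" "Y \<in> Ob C" "u \<in> Hom C X Y" for X Y u
    using C.Comp_Id_right C.Comp_Id_left that unfolding C(2) by auto
  have Dr: "u \<circ>\<^sub>m Id D X = u" and Dl: "Id D Y \<circ>\<^sub>m u = u"
    if "X \<in> Ob D" "Y \<in> Ob D" "u \<in> Hom D X Y" for X Y u
    using D.Comp_Id_right D.Comp_Id_left that unfolding D(2) by auto
  \<comment> \<open>Composites are reassociated to the right, so the cancellation is needed with an
    arbitrary factor \<open>w\<close> behind \<open>u\<close>.\<close>
  have C_absorb: "\<theta>' Y \<circ>\<^sub>m (\<theta> Y \<circ>\<^sub>m (u \<circ>\<^sub>m w)) = u \<circ>\<^sub>m w"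
    if "X \<in> Ob C" "Y \<in> Ob C" "u \<in> Hom C X Y" for X Y u and w :: "'z \<rightharpoonup> 'a"
    using Cl[OF that] invC[OF that(2)] by (metis assoc)
  have Cl': "\<theta>' Y \<circ>\<^sub>m (\<theta> Y \<circ>\<^sub>m u) = u" if "X \<in> Ob C" "Y \<in> Ob C" "u \<in> Hom C X Y" for X Y u
    using Cl[OF that] invC[OF that(2)] by (metis assoc)
  have D_absorb: "\<theta> Y \<circ>\<^sub>m (\<theta>' Y \<circ>\<^sub>m (u \<circ>\<^sub>m w)) = u \<circ>\<^sub>m w"
    if "X \<in> Ob C" "Y \<in> Ob C" "u \<in> Hom D (g X) (g Y)" for X Y u and w :: "'z \<rightharpoonup> 'b"
    using Dl[OF ob[OF that(1)] ob[OF that(2)] that(3)] invC[OF that(2)] by (metis assoc)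
  have Dl': "\<theta> Y \<circ>\<^sub>m (\<theta>' Y \<circ>\<^sub>m u) = u"
    if "X \<in> Ob C" "Y \<in> Ob C" "u \<in> Hom D (g X) (g Y)" for X Y u
    using Dl[OF ob[OF that(1)] ob[OF that(2)] that(3)] invC[OF that(2)] by (metis assoc)
  show ?thesis
  proof
    fix X assume X: "X \<in> Ob C"
    then show "FOb \<lparr>FOb = g, FArr = (\<lambda>X Y u. \<theta> Y \<circ>\<^sub>m (u \<circ>\<^sub>m \<theta>' X))\<rparr> X \<in> Ob D"
      by (simp add: ob)
    have "\<theta> X \<circ>\<^sub>m ((\<theta>' X \<circ>\<^sub>m \<theta> X) \<circ>\<^sub>m \<theta>' X) = Id D (g X)"
      using Dr[OF ob[OF X] ob[OF X] D.Id_in_Hom[OF ob[OF X]]] invC(2)[OF X] by (metis assoc)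
    then show "FArr \<lparr>FOb = g, FArr = (\<lambda>X Y u. \<theta> Y \<circ>\<^sub>m (u \<circ>\<^sub>m \<theta>' X))\<rparr> X X (Id C X)
        = Id D (FOb \<lparr>FOb = g, FArr = (\<lambda>X Y u. \<theta> Y \<circ>\<^sub>m (u \<circ>\<^sub>m \<theta>' X))\<rparr> X)"
      using X by (simp add: invC)
  next
    fix X Y Z f h assume "X \<in> Ob C" "Y \<in> Ob C" "Z \<in> Ob C" "f \<in> Hom C X Y" "h \<in> Hom C Y Z"
    then show "FArr \<lparr>FOb = g, FArr = (\<lambda>X Y u. \<theta> Y \<circ>\<^sub>m (u \<circ>\<^sub>m \<theta>' X))\<rparr> X Z (Comp C h f)
      = Comp D (FArr \<lparr>FOb = g, FArr = (\<lambda>X Y u. \<theta> Y \<circ>\<^sub>m (u \<circ>\<^sub>m \<theta>' X))\<rparr> Y Z h)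
         (FArr \<lparr>FOb = g, FArr = (\<lambda>X Y u. \<theta> Y \<circ>\<^sub>m (u \<circ>\<^sub>m \<theta>' X))\<rparr> X Y f)"
      by (simp add: C(2) D(2) assoc C_absorb)
  next
    fix X Y assume XY: "X \<in> Ob C" "Y \<in> Ob C"
    show "bij_betw (FArr \<lparr>FOb = g, FArr = (\<lambda>X Y u. \<theta> Y \<circ>\<^sub>m (u \<circ>\<^sub>m \<theta>' X))\<rparr> X Y) (Hom C X Y)
      (Hom D (FOb \<lparr>FOb = g, FArr = (\<lambda>X Y u. \<theta> Y \<circ>\<^sub>m (u \<circ>\<^sub>m \<theta>' X))\<rparr> X)
        (FOb \<lparr>FOb = g, FArr = (\<lambda>X Y u. \<theta> Y \<circ>\<^sub>m (u \<circ>\<^sub>m \<theta>' X))\<rparr> Y))"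
      by (rule bij_betw_byWitness[where f' = "\<lambda>v. \<theta>' Y \<circ>\<^sub>m (v \<circ>\<^sub>m \<theta> X)"])
        (use XY in \<open>auto simp: fwd bwd assoc C_absorb D_absorb invC Cr Dr[OF ob ob] Cl' Dl'\<close>)
  qed (auto simp: fwd surj)
qed

section \<open>Finite chains\<close>

lemma finite_chain_refl: "finite_chain r \<Longrightarrow> x \<in> Field r \<Longrightarrow> (x, x) \<in> r"
  by (auto simp: finite_chain_def order_on_defs refl_on_def)

lemma finite_chain_trans: "finite_chain r \<Longrightarrow> (x, y) \<in> r \<Longrightarrow> (y, z) \<in> r \<Longrightarrow> (x, z) \<in> r"
  by (auto simp: finite_chain_def order_on_defs elim: transE)

lemma finite_chain_antisym: "finite_chain r \<Longrightarrow> (x, y) \<in> r \<Longrightarrow> (y, x) \<in> r \<Longrightarrow> x = y"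
  by (auto simp: finite_chain_def order_on_defs dest: antisymD)

lemma finite_chain_total: "finite_chain r \<Longrightarrow> x \<in> Field r \<Longrightarrow> y \<in> Field r \<Longrightarrow> (x, y) \<in> r \<or> (y, x) \<in> r"
  by (cases "x = y") (auto simp: finite_chain_refl finite_chain_def order_on_defs total_on_def)

lemma finite_chain_finite_Field: "finite_chain r \<Longrightarrow> finite (Field r)"
  by (simp add: finite_chain_def finite_Field)

lemma finite_chain_has_max:
  assumes r: "finite_chain r" and A: "A \<subseteq> Field r" "A \<noteq> {}"
  shows "\<exists>m\<in>A. \<forall>x\<in>A. (x, m) \<in> r"
proof -
  have "finite A" using A(1) finite_chain_finite_Field[OF r] finite_subset by blast
  then show ?thesis using A(2,1)
  proof (induction rule: finite_ne_induct)
    case (singleton x)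
    then show ?case using finite_chain_refl[OF r] by auto
  next
    case (insert x F)
    then obtain m where m: "m \<in> F" "\<And>y. y \<in> F \<Longrightarrow> (y, m) \<in> r" by auto
    consider "(x, m) \<in> r" | "(m, x) \<in> r"
      using finite_chain_total[OF r, of x m] m insert.prems by auto
    then show ?case
    proof cases
      case 1
      then show ?thesis using m by auto
    next
      case 2
      then have "(y, x) \<in> r" if "y \<in> F" for y
        using finite_chain_trans[OF r m(2)[OF that]] by blast
      then show ?thesis using finite_chain_refl[OF r, of x] insert.prems by auto
    qed
  qed
qed

lemma max_elt_eqI:
  "finite_chain r \<Longrightarrow> m \<in> Field r \<Longrightarrow> (\<And>x. x \<in> Field r \<Longrightarrow> (x, m) \<in> r) \<Longrightarrow> max_elt r = m"
  unfolding max_elt_def by (rule the_equality) (simp_all add: finite_chain_antisym)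

lemma max_elt:
  assumes "finite_chain r" "r \<noteq> {}"
  shows "max_elt r \<in> Field r" "x \<in> Field r \<Longrightarrow> (x, max_elt r) \<in> r"
proof -
  have "Field r \<noteq> {}" using assms(2) by (auto simp: Field_def)
  then obtain m where "m \<in> Field r" "\<forall>x\<in>Field r. (x, m) \<in> r"
    using finite_chain_has_max[OF assms(1) subset_refl] by blast
  moreover from this have "max_elt r = m" using max_elt_eqI[OF assms(1)] by blast
  ultimately show "max_elt r \<in> Field r" "x \<in> Field r \<Longrightarrow> (x, max_elt r) \<in> r" by auto
qed

section \<open>Order-preserving partial maps\<close>

lemma order_preserving_dom: "order_preserving r s u \<Longrightarrow> dom u = Field r"
  by (simp add: order_preserving_def)

lemma order_preserving_ran: "order_preserving r s u \<Longrightarrow> u x = Some a \<Longrightarrow> a \<in> Field s"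
  unfolding order_preserving_def using ranI[of u x a] by auto

lemma order_preserving_mono:
  assumes "order_preserving r s u" "(x, y) \<in> r" "u x = Some a" "u y = Some b"
  shows "(a, b) \<in> s"
proof -
  have "((the \<circ> u) x, (the \<circ> u) y) \<in> s" using assms(1,2) by (simp add: order_preserving_def compat_def)
  then show ?thesis using assms(3,4) by simp
qed

text \<open>The range condition is implied: reflexivity of \<open>r\<close> at \<open>x\<close>
  gives \<open>(a, a) \<in> s\<close> for the value \<open>a\<close>. Speaking of values instead of
  \<open>the\<close> suits case distinctions on partial maps.\<close>

lemma order_preserving_iff:
  assumes "finite_chain r"
  shows "order_preserving r s u \<longleftrightarrow> dom u = Field r \<and>
    (\<forall>x y a b. (x, y) \<in> r \<longrightarrow> u x = Some a \<longrightarrow> u y = Some b \<longrightarrow> (a, b) \<in> s)" (is "_ \<longleftrightarrow> ?R")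
proof
  assume u: "order_preserving r s u"
  then show ?R using order_preserving_mono[OF u] by (simp add: order_preserving_def)
next
  assume R: ?R
  have "ran u \<subseteq> Field s"
  proof
    fix a assume "a \<in> ran u"
    then obtain x where "u x = Some a" by (auto simp: ran_def)
    with R have "(a, a) \<in> s" using finite_chain_refl[OF assms] by blast
    then show "a \<in> Field s" by (auto simp: Field_def)
  qed
  moreover have "compat r s (the \<circ> u)"
    unfolding compat_def
  proof (intro allI impI)
    fix x y assume xy: "(x, y) \<in> r"
    then have "x \<in> dom u" "y \<in> dom u" using R by (auto simp: Field_def)
    then show "((the \<circ> u) x, (the \<circ> u) y) \<in> s" using R xy by fastforce
  qed
  ultimately show "order_preserving r s u" using R by (simp add: order_preserving_def)
qed

lemma order_preserving_comp:
  assumes "order_preserving r s u" "order_preserving s t v"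
  shows "order_preserving r t (v \<circ>\<^sub>m u)"
proof -
  have "dom (v \<circ>\<^sub>m u) = Field r"
  proof -
    have "\<exists>c. (v \<circ>\<^sub>m u) x = Some c" if x: "x \<in> Field r" for x
    proof -
      obtain a where a: "u x = Some a" using x order_preserving_dom[OF assms(1)] domD by metis
      then have "a \<in> dom v"
        using order_preserving_ran[OF assms(1)] order_preserving_dom[OF assms(2)] by simp
      then show ?thesis using a by auto
    qed
    then show ?thesis using order_preserving_dom[OF assms(1)]
      by (auto simp: map_comp_Some_iff dom_def)
  qed
  moreover have "ran (v \<circ>\<^sub>m u) \<subseteq> Field t"
    using order_preserving_ran[OF assms(2)] by (auto simp: ran_def map_comp_Some_iff)
  moreover have "compat r t (the \<circ> (v \<circ>\<^sub>m u))"
    unfolding compat_def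
  proof (intro allI impI)
    fix x y assume xy: "(x, y) \<in> r"
    then have "x \<in> Field r" "y \<in> Field r" by (auto simp: Field_def)
    then obtain c d where "(v \<circ>\<^sub>m u) x = Some c" "(v \<circ>\<^sub>m u) y = Some d"
      using \<open>dom (v \<circ>\<^sub>m u) = Field r\<close> domD by metis
    moreover from this have "(c, d) \<in> t"
      using order_preserving_mono[OF assms(1) xy] order_preserving_mono[OF assms(2)]
      unfolding map_comp_Some_iff by blast
    ultimately show "((the \<circ> (v \<circ>\<^sub>m u)) x, (the \<circ> (v \<circ>\<^sub>m u)) y) \<in> t" by simp
  qed
  ultimately show ?thesis by (simp add: order_preserving_def)
qed

lemma order_preserving_id: "finite_chain r \<Longrightarrow> order_preserving r r (Some |` Field r)"
  by (auto simp: order_preserving_iff restrict_map_def dom_def split: if_splits)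

lemma ran_map_comp:
  assumes "ran u = dom v"
  shows "ran (v \<circ>\<^sub>m u) = ran v"
proof -
  have "\<exists>x. (v \<circ>\<^sub>m u) x = Some c" if c: "v b = Some c" for b c
  proof -
    have "b \<in> ran u" using c assms by blast
    then show ?thesis using c by (auto simp: ran_def map_comp_Some_iff)
  qed
  then show ?thesis by (auto simp: ran_def map_comp_Some_iff)
qed

lemma ran_Some_restrict [simp]: "ran (Some |` A) = A"
  by (auto simp: ran_def restrict_map_def)

lemma map_comp_id_right: "dom u \<subseteq> A \<Longrightarrow> u \<circ>\<^sub>m (Some |` A) = u"
proof
  fix x assume "dom u \<subseteq> A"
  then show "(u \<circ>\<^sub>m (Some |` A)) x = u x"
    by (cases "x \<in> A"; cases "u x") (auto simp: map_comp_def restrict_map_def)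
qed

lemma map_comp_id_left: "ran u \<subseteq> A \<Longrightarrow> (Some |` A) \<circ>\<^sub>m u = u"
  by (auto simp: fun_eq_iff map_comp_def restrict_map_def ran_def split: option.splits)

lemma map_comp_assoc: "(u \<circ>\<^sub>m v) \<circ>\<^sub>m w = u \<circ>\<^sub>m (v \<circ>\<^sub>m w)"
  by (auto simp: map_comp_def fun_eq_iff split: option.splits)

section \<open>Standard chains and isomorphisms of chains\<close>

definition std_chain :: "nat \<Rightarrow> nat rel" where
  "std_chain n = {(i, j). i \<le> j \<and> j < n}"

lemma std_chain_iff [simp]: "(i, j) \<in> std_chain n \<longleftrightarrow> i \<le> j \<and> j < n"
  by (simp add: std_chain_def)

lemma Field_std_chain [simp]: "Field (std_chain n) = {..<n}"
  by (auto simp: Field_def Domain_iff Range_iff)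

lemma std_chain_empty_iff [simp]: "std_chain n = {} \<longleftrightarrow> n = 0"
  by (auto simp: std_chain_def)

lemma finite_chain_std_chain [simp]: "finite_chain (std_chain n)"
proof -
  have "finite (std_chain n)" by (rule finite_subset[of _ "{..<n} \<times> {..<n}"]) (auto simp: std_chain_def)
  then show ?thesis
    unfolding finite_chain_def order_on_defs
    by (auto simp: refl_on_def trans_def antisym_def total_on_def)
qed

lemma max_elt_std_chain [simp]: "max_elt (std_chain (Suc n)) = n"
  by (rule max_elt_eqI) auto

text \<open>Both directions are carried as data because \<open>weak_equivalence_transport\<close>
  takes the bijection and its inverse as separate arguments.\<close>

definition chain_iso :: "'a rel \<Rightarrow> 'b rel \<Rightarrow> ('a \<rightharpoonup> 'b) \<Rightarrow> ('b \<rightharpoonup> 'a) \<Rightarrow> bool" where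
  "chain_iso r s u v \<longleftrightarrow> order_preserving r s u \<and> order_preserving s r v \<and>
    v \<circ>\<^sub>m u = Some |` Field r \<and> u \<circ>\<^sub>m v = Some |` Field s"

lemma chain_iso_sym: "chain_iso r s u v \<Longrightarrow> chain_iso s r v u"
  by (simp add: chain_iso_def)

lemma chain_iso_ran:
  assumes "chain_iso r s u v"
  shows "ran u = Field s"
proof
  show "ran u \<subseteq> Field s" using assms by (simp add: chain_iso_def order_preserving_def)
  show "Field s \<subseteq> ran u"
  proof
    fix y assume "y \<in> Field s"
    then have "(u \<circ>\<^sub>m v) y = Some y" using assms by (simp add: chain_iso_def)
    then show "y \<in> ran u" by (auto simp: map_comp_Some_iff ran_def)
  qed
qed

text \<open>Totality makes the inverse monotone: if it failed on a pair, the preimages would be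
  comparable the other way round, and antisymmetry in \<open>s\<close> would identify the two
  points.\<close>

lemma chain_iso_of_bij:
  assumes r: "finite_chain r" and s: "finite_chain s" and f: "bij_betw f (Field r) (Field s)"
    and mono: "\<And>x y. (x, y) \<in> r \<Longrightarrow> (f x, f y) \<in> s"
  shows "chain_iso r s ((Some \<circ> f) |` Field r) ((Some \<circ> inv_into (Field r) f) |` Field s)"
proof -
  have inv_mono: "(inv_into (Field r) f a, inv_into (Field r) f b) \<in> r" if ab: "(a, b) \<in> s" for a b
  proof -
    let ?g = "inv_into (Field r) f"
    have *: "a \<in> Field s" "b \<in> Field s" using ab by (auto simp: Field_def)
    then have g: "?g a \<in> Field r" "?g b \<in> Field r" "f (?g a) = a" "f (?g b) = b"
      using f by (auto simp: bij_betw_def inv_into_into f_inv_into_f)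
    show ?thesis
    proof (rule ccontr)
      assume n: "(?g a, ?g b) \<notin> r"
      then have ba: "(?g b, ?g a) \<in> r" using finite_chain_total[OF r g(1,2)] by blast
      then have "(b, a) \<in> s" using mono g by metis
      then have "a = b" using finite_chain_antisym[OF s ab] by blast
      then show False using ba n by simp
    qed
  qed
  have g1: "inv_into (Field r) f (f x) = x" if "x \<in> Field r" for x
    using f that by (auto simp: bij_betw_def)
  have g2: "f (inv_into (Field r) f y) = y" "inv_into (Field r) f y \<in> Field r" if "y \<in> Field s" for y
    using f that by (auto simp: bij_betw_def inv_into_into f_inv_into_f)
  have fx: "f x \<in> Field s" if "x \<in> Field r" for x
    using f that by (auto simp: bij_betw_def)
  show ?thesis unfolding chain_iso_def order_preserving_iff[OF r] order_preserving_iff[OF s]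
    using mono inv_mono g1 g2 fx
    by (auto simp: restrict_map_def dom_def map_comp_def fun_eq_iff split: if_splits)
qed

text \<open>The position of an element is the number of its strict predecessors. This is strictly
  monotone, hence injective into \<open>n\<close> values, hence onto by counting.\<close>

lemma chain_iso_exists:
  assumes r: "finite_chain r" and n: "card (Field r) = n"
  shows "\<exists>u v. chain_iso r (std_chain n) u v"
proof -
  define f where "f x = card (underS r x)" for x
  have fin: "finite (underS r x)" for x
    by (rule finite_subset[OF _ finite_chain_finite_Field[OF r]]) (auto simp: underS_def Field_def)
  have lt: "f x < f y" if "(x, y) \<in> r" "x \<noteq> y" for x y
    unfolding f_def using that finite_chain_trans[OF r] finite_chain_antisym[OF r]
    by (intro psubset_card_mono fin) (auto simp: underS_def)
  have "f x < n" if "x \<in> Field r" for x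
    unfolding f_def n[symmetric] using that
    by (intro psubset_card_mono finite_chain_finite_Field[OF r]) (auto simp: underS_def Field_def)
  moreover have inj: "inj_on f (Field r)"
    by (rule inj_onI) (metis lt finite_chain_total[OF r] less_irrefl)
  ultimately have "f ` Field r = {..<n}"
    using n by (intro card_subset_eq) (auto simp: card_image)
  then have "bij_betw f (Field r) (Field (std_chain n))" using inj by (simp add: bij_betw_def)
  moreover have "(f x, f y) \<in> std_chain n" if "(x, y) \<in> r" for x y
  proof -
    have "y \<in> Field r" using that by (auto simp: Field_def)
    with \<open>f ` Field r = {..<n}\<close> have "f y < n" by blast
    then show ?thesis using lt[OF that] by (cases "x = y") auto
  qed
  ultimately show ?thesis using chain_iso_of_bij[OF r finite_chain_std_chain] by blast
qed

text \<open>An infinite type contains an injective image of the natural numbers, along which the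
  standard chain is carried over. This is the source of essential surjectivity onto the
  skeletons.\<close>

lemma finite_chain_of_size_exists: "\<exists>r :: ('a::infinite) rel. finite_chain r \<and> card (Field r) = n"
proof -
  obtain f :: "nat \<Rightarrow> 'a" where f: "inj f" using arb_countable_map[of "{}"] by auto
  let ?r = "map_prod f f ` std_chain n"
  have Fr: "Field ?r = f ` {..<n}"
    unfolding Field_std_chain[symmetric] by (force simp: Field_def Domain_iff Range_iff)
  have mem_r: "(f i, f j) \<in> ?r \<longleftrightarrow> (i, j) \<in> std_chain n" for i j
    using f by (auto simp: inj_eq intro: image_eqI[where x = "(i, j)"])
  have "finite_chain ?r"
    unfolding finite_chain_def order_on_defs
  proof (intro conjI)
    show "finite ?r" using finite_chain_std_chain[of n] by (auto simp: finite_chain_def)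
    show "?r \<subseteq> Field ?r \<times> Field ?r" by (auto simp: Field_def)
    show "refl_on (Field ?r) ?r" unfolding Fr by (force simp: refl_on_def mem_r)
    show "total_on (Field ?r) ?r" unfolding Fr by (auto simp: total_on_def mem_r)
    show "trans ?r" by (rule transI) (auto simp: inj_eq[OF f] intro: image_eqI[where x = "(_, _)"])
    show "antisym ?r" by (rule antisymI) (auto simp: inj_eq[OF f])
  qed
  moreover have "card (Field ?r) = n"
    unfolding Fr using f by (simp add: card_image inj_on_subset)
  ultimately show ?thesis by blast
qed

section \<open>The categories of single chains\<close>

definition top_epi :: "'a rel \<Rightarrow> 'b rel \<Rightarrow> ('a \<rightharpoonup> 'b) \<Rightarrow> bool" where
  "top_epi r s u \<longleftrightarrow> order_preserving r s u \<and> ran u = Field s \<and>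
    (\<not> is_chain_of_size 1 s \<longrightarrow> {x. u x = Some (max_elt s)} = {max_elt r})"

text \<open>The second component of a hall map with its two conditions replaced by surjectivity;
  \<open>hall_map_one_iff\<close> justifies the replacement.\<close>

definition hall_epi :: "'a rel \<Rightarrow> 'b rel \<Rightarrow> ('a \<rightharpoonup> 'b) \<Rightarrow> bool" where
  "hall_epi r s u \<longleftrightarrow> (if s = {} then u = Map.empty else order_preserving r s u \<and> ran u = Field s)"

definition Chain_top :: "('a rel, 'a \<rightharpoonup> 'a) cat" where
  "Chain_top = \<lparr>Ob = {r. finite_chain r \<and> r \<noteq> {}}, Hom = (\<lambda>r s. {u. top_epi r s u}),
    Id = (\<lambda>r. Some |` Field r), Comp = (\<circ>\<^sub>m)\<rparr>"

definition Hall_chain :: "('a rel, 'a \<rightharpoonup> 'a) cat" where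
  "Hall_chain = \<lparr>Ob = {r. finite_chain r}, Hom = (\<lambda>r s. {u. hall_epi r s u}),
    Id = (\<lambda>r. Some |` Field r), Comp = (\<circ>\<^sub>m)\<rparr>"

definition Hall_one :: "('t rel \<times> 'j rel, ('t \<rightharpoonup> 't) \<times> ('j \<rightharpoonup> 'j)) cat" where
  "Hall_one = \<lparr>Ob = {(T, J). is_chain_of_size 1 T \<and> finite_chain J},
    Hom = (\<lambda>X Y. {(f, g). hall_map X Y f g}),
    Id = (\<lambda>(T, J). (Some |` Field T, Some |` Field J)),
    Comp = (\<lambda>(f', g') (f, g). (f' \<circ>\<^sub>m f, g' \<circ>\<^sub>m g))\<rparr>"

text \<open>Skeletons of \<^const>\<open>Chain_top\<close> and \<^const>\<open>Hall_chain\<close>. In the former \<open>n\<close> stands for the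
  chain with \<open>n + 1\<close> elements, so that removing the top matches the two indexings.\<close>

definition Nat_top :: "(nat, nat \<rightharpoonup> nat) cat" where
  "Nat_top = \<lparr>Ob = UNIV, Hom = (\<lambda>n m. {u. top_epi (std_chain (Suc n)) (std_chain (Suc m)) u}),
    Id = (\<lambda>n. Some |` {..<Suc n}), Comp = (\<circ>\<^sub>m)\<rparr>"

definition Nat_hall :: "(nat, nat \<rightharpoonup> nat) cat" where
  "Nat_hall = \<lparr>Ob = UNIV, Hom = (\<lambda>n m. {u. hall_epi (std_chain n) (std_chain m) u}),
    Id = (\<lambda>n. Some |` {..<n}), Comp = (\<circ>\<^sub>m)\<rparr>"

section \<open>From families to their members, and composition of the resulting maps\<close>

lemma MC_top_eq_Fam: "MC_top = Fam Chain_top"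
  unfolding MC_top_def MC_def Fam_def Chain_top_def top_epi_def
  by (auto simp: fun_eq_iff split_def subset_iff)

text \<open>Absorbs the tree condition on objects of \<open>HF\<close> into the size condition when
  the full subcategory is rewritten as families.\<close>

lemma finite_tree_singleton: "is_chain_of_size 1 T \<Longrightarrow> finite_tree T"
proof -
  assume "is_chain_of_size 1 T"
  then have T: "finite_chain T" and "card (Field T) = 1" by (auto simp: is_chain_of_size_def)
  then obtain t where t: "Field T = {t}" by (auto simp: card_1_singleton_iff)
  show ?thesis
    using T t finite_chain_refl[OF T, of t]
    by (auto simp: finite_tree_def finite_chain_def linear_order_on_def under_def Chains_def
        dest: FieldI1)
qed

lemma full_subcat_HF_eq_Fam:
  "full_subcat HF (\<lambda>X. \<forall>(T, J) \<in> set X. is_chain_of_size 1 T) = Fam Hall_one"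
  unfolding full_subcat_def HF_def Fam_def Hall_one_def
  by (auto simp: fun_eq_iff split_def subset_iff finite_tree_singleton simp del: One_nat_def)

text \<open>A surjection from a one-element chain has a one-element target. So if \<open>t\<close>
  is not a singleton, neither is \<open>s\<close>, and the condition on the maximum is available for
  both factors.\<close>

lemma top_epi_comp:
  assumes fin: "finite_chain r" "finite_chain s" "finite_chain t"
    and u: "top_epi r s u" and v: "top_epi s t v"
  shows "top_epi r t (v \<circ>\<^sub>m u)"
proof -
  have uv: "ran u = dom v"
    using u v by (simp add: top_epi_def order_preserving_def)
  have "\<not> is_chain_of_size 1 s" if "\<not> is_chain_of_size 1 t"
  proof
    assume "is_chain_of_size 1 s"
    then obtain x where x: "Field s = {x}" by (auto simp: is_chain_of_size_def card_1_singleton_iff)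
    then have dv: "dom v = {x}" using v by (simp add: top_epi_def order_preserving_def)
    then obtain a where "v = [x \<mapsto> a]" by (auto simp: dom_eq_singleton_conv)
    then have "Field t = {a}" using v by (simp add: top_epi_def)
    then show False using that fin by (simp add: is_chain_of_size_def)
  qed
  moreover have "{x. (v \<circ>\<^sub>m u) x = Some (max_elt t)} = {max_elt r}" if "\<not> is_chain_of_size 1 t"
  proof -
    have U: "u x = Some (max_elt s) \<longleftrightarrow> x = max_elt r" for x
      using u that calculation unfolding top_epi_def by blast
    have V: "v x = Some (max_elt t) \<longleftrightarrow> x = max_elt s" for x
      using v that unfolding top_epi_def by blast
    show ?thesis by (simp add: map_comp_Some_iff V U)
  qed
  moreover have "order_preserving r t (v \<circ>\<^sub>m u)" "ran (v \<circ>\<^sub>m u) = Field t"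
    using u v order_preserving_comp[of r s u t v] ran_map_comp[OF uv] by (simp_all add: top_epi_def)
  ultimately show ?thesis by (simp add: top_epi_def)
qed

text \<open>If \<open>t\<close> is empty, the composite is nowhere defined because \<open>v\<close>
  is. If \<open>t\<close> is nonempty, surjectivity of \<open>v\<close> makes \<open>s\<close>
  nonempty, so \<open>u\<close> is not the exceptional empty map.\<close>

lemma hall_epi_comp:
  assumes u: "hall_epi r s u" and v: "hall_epi s t v"
  shows "hall_epi r t (v \<circ>\<^sub>m u)"
proof (cases "t = {}")
  case True
  then show ?thesis using v by (simp add: hall_epi_def)
next
  case False
  then have v': "order_preserving s t v" "ran v = Field t" using v by (auto simp: hall_epi_def)
  have "s \<noteq> {}"
  proof
    assume "s = {}"
    then have "v = Map.empty" using v'(1) by (simp add: order_preserving_def)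
    then show False using v'(2) False by (auto simp: Field_def)
  qed
  then have u': "order_preserving r s u" "ran u = Field s" using u by (auto simp: hall_epi_def)
  then have "ran u = dom v" using v' by (simp add: order_preserving_def)
  then show ?thesis
    using False v'(2) order_preserving_comp[OF u'(1) v'(1)] by (simp add: hall_epi_def ran_map_comp)
qed

lemma chain_iso_max:
  assumes r: "finite_chain r" "r \<noteq> {}" and s: "finite_chain s" and iso: "chain_iso r s u v"
  shows "{x. u x = Some (max_elt s)} = {max_elt r}"
proof -
  have u: "order_preserving r s u" and v: "order_preserving s r v"
    and vu: "v \<circ>\<^sub>m u = Some |` Field r" and uv: "u \<circ>\<^sub>m v = Some |` Field s"
    using iso by (auto simp: chain_iso_def)
  have m: "max_elt r \<in> Field r" using max_elt(1)[OF r] .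
  obtain a where a: "u (max_elt r) = Some a" using m order_preserving_dom[OF u] domD by metis
  have "max_elt s = a"
  proof (rule max_elt_eqI[OF s])
    show "a \<in> Field s" using order_preserving_ran[OF u a] .
    fix y assume y: "y \<in> Field s"
    then obtain x where x: "v y = Some x" using order_preserving_dom[OF v] domD by metis
    have "(u \<circ>\<^sub>m v) y = Some y" using y uv by simp
    then have "u x = Some y" using x by simp
    then show "(y, a) \<in> s"
      using order_preserving_mono[OF u max_elt(2)[OF r order_preserving_ran[OF v x]] _ a] by blast
  qed
  moreover have "x = max_elt r" if x: "u x = Some a" for x
  proof -
    have "x \<in> Field r" using x order_preserving_dom[OF u] by auto
    then have "(v \<circ>\<^sub>m u) x = Some x" "(v \<circ>\<^sub>m u) (max_elt r) = Some (max_elt r)" using vu m by auto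
    then show ?thesis using x a by simp
  qed
  ultimately have "u x = Some (max_elt s) \<longleftrightarrow> x = max_elt r" for x using a by metis
  then show ?thesis by simp
qed

lemma top_epi_iso:
  "finite_chain r \<Longrightarrow> r \<noteq> {} \<Longrightarrow> finite_chain s \<Longrightarrow> chain_iso r s u v \<Longrightarrow> top_epi r s u"
  using chain_iso_max[of r s u v] chain_iso_ran[of r s u v] by (simp add: top_epi_def chain_iso_def)

lemma hall_epi_iso: "chain_iso r s u v \<Longrightarrow> hall_epi r s u"
proof -
  assume iso: "chain_iso r s u v"
  then have u: "order_preserving r s u" by (simp add: chain_iso_def)
  have "u = Map.empty" if "s = {}"
  proof
    fix x show "u x = None" using order_preserving_ran[OF u, of x] that by (cases "u x") auto
  qed
  then show ?thesis using u chain_iso_ran[OF iso] by (simp add: hall_epi_def)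
qed

lemma chain_iso_id: "finite_chain r \<Longrightarrow> chain_iso r r (Some |` Field r) (Some |` Field r)"
  by (simp add: chain_iso_def order_preserving_id map_comp_id_left)

lemma top_epi_id: "finite_chain r \<Longrightarrow> r \<noteq> {} \<Longrightarrow> top_epi r r (Some |` Field r)"
  using top_epi_iso[OF _ _ _ chain_iso_id] by blast

lemma top_epi_dom_ran: "top_epi r s u \<Longrightarrow> dom u \<subseteq> Field r \<and> ran u \<subseteq> Field s"
  by (simp add: top_epi_def order_preserving_def)

lemma hall_epi_dom_ran: "hall_epi r s u \<Longrightarrow> dom u \<subseteq> Field r \<and> ran u \<subseteq> Field s"
  by (auto simp: hall_epi_def order_preserving_def split: if_splits)

lemma top_epi_id_right: "top_epi r s u \<Longrightarrow> u \<circ>\<^sub>m (Some |` Field r) = u"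
  using top_epi_dom_ran[of r s u] by (simp add: map_comp_id_right)

lemma top_epi_id_left: "top_epi r s u \<Longrightarrow> (Some |` Field s) \<circ>\<^sub>m u = u"
  using top_epi_dom_ran[of r s u] by (simp add: map_comp_id_left)

lemma hall_epi_id_right: "hall_epi r s u \<Longrightarrow> u \<circ>\<^sub>m (Some |` Field r) = u"
  using hall_epi_dom_ran[of r s u] by (simp add: map_comp_id_right)

lemma hall_epi_id_left: "hall_epi r s u \<Longrightarrow> (Some |` Field s) \<circ>\<^sub>m u = u"
  using hall_epi_dom_ran[of r s u] by (simp add: map_comp_id_left)

lemma category_Chain_top: "category Chain_top"
  by unfold_locales
    (simp_all add: Chain_top_def top_epi_id_left top_epi_id_right map_comp_assoc top_epi_id,
      blast intro: top_epi_comp)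

lemma category_Hall_chain: "category Hall_chain"
  by unfold_locales
    (simp_all add: Hall_chain_def hall_epi_id_left hall_epi_id_right map_comp_assoc
      hall_epi_iso[OF chain_iso_id], blast intro: hall_epi_comp)

lemma category_Nat_top: "category Nat_top"
  unfolding Nat_top_def Field_std_chain[symmetric]
  by unfold_locales
    (simp_all add: top_epi_id_left top_epi_id_right map_comp_assoc top_epi_id del: Field_std_chain,
      blast intro: top_epi_comp finite_chain_std_chain)

lemma category_Nat_hall: "category Nat_hall"
  unfolding Nat_hall_def Field_std_chain[symmetric]
  by unfold_locales
    (simp_all add: hall_epi_id_left hall_epi_id_right map_comp_assoc
      hall_epi_iso[OF chain_iso_id] del: Field_std_chain, blast intro: hall_epi_comp)

text \<open>Arrows are conjugated with chosen isomorphisms onto standard chains; infinity of the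
  type makes every number the index of some chain.\<close>

lemma weakly_equivalent_Chain_top_Nat_top:
  "weakly_equivalent (Chain_top :: ('a::infinite rel, _) cat) Nat_top"
proof -
  \<comment> \<open>Objects of \<open>Chain_top\<close> are nonempty, so the truncated subtraction
    is exact and \<open>Suc (g r)\<close> is the size of \<open>r\<close>.\<close>
  define g where "g r = card (Field r) - 1" for r :: "'a rel"
  have g: "card (Field r) = Suc (g r)" if "finite_chain r" "r \<noteq> {}" for r :: "'a rel"
    using that finite_chain_finite_Field[OF that(1)] max_elt(1)[OF that]
    by (cases "card (Field r)") (auto simp: g_def)
  have "\<forall>r::'a rel. \<exists>p. finite_chain r \<longrightarrow> r \<noteq> {} \<longrightarrow> chain_iso r (std_chain (Suc (g r))) (fst p) (snd p)"
    using chain_iso_exists g by (metis fst_conv snd_conv)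
  then obtain p where p: "\<And>r::'a rel. finite_chain r \<Longrightarrow> r \<noteq> {}
      \<Longrightarrow> chain_iso r (std_chain (Suc (g r))) (fst (p r)) (snd (p r))"
    by metis
  have p1: "top_epi r (std_chain (Suc (g r))) (fst (p r))"
    and p2: "top_epi (std_chain (Suc (g r))) r (snd (p r))"
    if "finite_chain r" "r \<noteq> {}" for r :: "'a rel"
    using top_epi_iso[OF that _ p[OF that]] top_epi_iso[OF _ _ that(1) chain_iso_sym[OF p[OF that]]]
    by auto
  have "weak_equivalence Chain_top Nat_top
      \<lparr>FOb = g, FArr = (\<lambda>X Y u. fst (p Y) \<circ>\<^sub>m (u \<circ>\<^sub>m snd (p X)))\<rparr>"
  proof (rule weak_equivalence_transport[where A = Field and B = "\<lambda>n. {..<Suc n}"])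
    fix X assume "X \<in> Ob (Chain_top :: ('a rel, _) cat)"
    then have "chain_iso X (std_chain (Suc (g X))) (fst (p X)) (snd (p X))"
      using p by (simp add: Chain_top_def)
    then show "snd (p X) \<circ>\<^sub>m fst (p X) = Some |` Field X" "fst (p X) \<circ>\<^sub>m snd (p X) = Some |` {..<Suc (g X)}"
      unfolding chain_iso_def by (simp_all only: Field_std_chain)
  next
    fix X Y :: "'a rel" and u
    assume "X \<in> Ob Chain_top" "Y \<in> Ob Chain_top" "u \<in> Hom Chain_top X Y"
    then show "fst (p Y) \<circ>\<^sub>m (u \<circ>\<^sub>m snd (p X)) \<in> Hom Nat_top (g X) (g Y)"
      using p1[of Y] p2[of X]
      by (auto simp: Chain_top_def Nat_top_def
        intro!: top_epi_comp[of _ Y _ _ "fst (p Y)"] top_epi_comp[of _ X _ "snd (p X)"])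
  next
    fix X Y :: "'a rel" and u
    assume "X \<in> Ob Chain_top" "Y \<in> Ob Chain_top" "u \<in> Hom Nat_top (g X) (g Y)"
    then show "snd (p Y) \<circ>\<^sub>m (u \<circ>\<^sub>m fst (p X)) \<in> Hom Chain_top X Y"
      using p2[of Y] p1[of X]
      by (auto simp: Chain_top_def Nat_top_def 
        intro!: top_epi_comp[of _ "std_chain (Suc (g Y))" _ _ "snd (p Y)"]
          top_epi_comp[of _ "std_chain (Suc (g X))" _ "fst (p X)"])
  next
    fix n
    obtain r :: "'a rel" where r: "finite_chain r" "card (Field r) = Suc n"
      using finite_chain_of_size_exists by blast
    then have "r \<in> Ob Chain_top" "g r = n" by (auto simp: Chain_top_def g_def)
    then show "\<exists>X\<in>Ob (Chain_top :: ('a rel, _) cat). \<exists>f. is_iso Nat_top (g X) n f"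
      using category.is_iso_Id[OF category_Nat_top, of n] by (auto simp: Nat_top_def)
  qed (auto simp: category_Chain_top category_Nat_top, auto simp: Chain_top_def Nat_top_def)
  then show ?thesis unfolding weakly_equivalent_def by blast
qed

lemma weakly_equivalent_Hall_chain_Nat_hall:
  "weakly_equivalent (Hall_chain :: ('a::infinite rel, _) cat) Nat_hall"
proof -
  define g where "g r = card (Field r)" for r :: "'a rel"
  have "\<forall>r::'a rel. \<exists>p. finite_chain r \<longrightarrow> chain_iso r (std_chain (g r)) (fst p) (snd p)"
    using chain_iso_exists g_def by (metis fst_conv snd_conv)
  then obtain p where p: "\<And>r::'a rel. finite_chain r
      \<Longrightarrow> chain_iso r (std_chain (g r)) (fst (p r)) (snd (p r))"
    by metis
  have "weak_equivalence Hall_chain Nat_hall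
      \<lparr>FOb = g, FArr = (\<lambda>X Y u. fst (p Y) \<circ>\<^sub>m (u \<circ>\<^sub>m snd (p X)))\<rparr>"
  proof (rule weak_equivalence_transport[where A = Field and B = lessThan])
    fix X assume "X \<in> Ob (Hall_chain :: ('a rel, _) cat)"
    then have "chain_iso X (std_chain (g X)) (fst (p X)) (snd (p X))"
      using p by (simp add: Hall_chain_def)
    then show "snd (p X) \<circ>\<^sub>m fst (p X) = Some |` Field X" "fst (p X) \<circ>\<^sub>m snd (p X) = Some |` {..<g X}"
      unfolding chain_iso_def by (simp_all only: Field_std_chain)
  next
    fix X Y :: "'a rel" and u
    assume "X \<in> Ob Hall_chain" "Y \<in> Ob Hall_chain" "u \<in> Hom Hall_chain X Y"
    then show "fst (p Y) \<circ>\<^sub>m (u \<circ>\<^sub>m snd (p X)) \<in> Hom Nat_hall (g X) (g Y)"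
      using hall_epi_iso[OF p[of Y]] hall_epi_iso[OF chain_iso_sym[OF p[of X]]]
      by (auto simp: Hall_chain_def Nat_hall_def
        intro!: hall_epi_comp[of _ Y _ _ "fst (p Y)"] hall_epi_comp[of _ X "snd (p X)"])
  next
    fix X Y :: "'a rel" and u
    assume "X \<in> Ob Hall_chain" "Y \<in> Ob Hall_chain" "u \<in> Hom Nat_hall (g X) (g Y)"
    then show "snd (p Y) \<circ>\<^sub>m (u \<circ>\<^sub>m fst (p X)) \<in> Hom Hall_chain X Y"
      using hall_epi_iso[OF chain_iso_sym[OF p[of Y]]] hall_epi_iso[OF p[of X]]
      by (auto simp: Hall_chain_def Nat_hall_def 
        intro!: hall_epi_comp[of _ "std_chain (g Y)" _ _ "snd (p Y)"]
          hall_epi_comp[of _ "std_chain (g X)" "fst (p X)"])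
  next
    fix n
    obtain r :: "'a rel" where r: "finite_chain r" "card (Field r) = n"
      using finite_chain_of_size_exists by blast
    then have "r \<in> Ob Hall_chain" "g r = n" by (auto simp: Hall_chain_def g_def)
    then show "\<exists>X\<in>Ob (Hall_chain :: ('a rel, _) cat). \<exists>f. is_iso Nat_hall (g X) n f"
      using category.is_iso_Id[OF category_Nat_hall, of n] by (auto simp: Nat_hall_def)
  qed (auto simp: category_Hall_chain category_Nat_hall, auto simp: Hall_chain_def Nat_hall_def)
  then show ?thesis unfolding weakly_equivalent_def by blast
qed

section \<open>Hall maps between one-element trees with chains attached\<close>

lemma order_preserving_surj_max:
  assumes r: "finite_chain r" "r \<noteq> {}" and s: "finite_chain s"
    and u: "order_preserving r s u" "ran u = Field s"
  shows "u (max_elt r) = Some (max_elt s)"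
proof -
  obtain a where a: "u (max_elt r) = Some a"
    using max_elt(1)[OF r] order_preserving_dom[OF u(1)] domD by metis
  have "max_elt s = a"
  proof (rule max_elt_eqI[OF s])
    show "a \<in> Field s" using order_preserving_ran[OF u(1) a] .
    fix y assume "y \<in> Field s"
    then obtain x where x: "u x = Some y" using u(2) by (auto simp: ran_def)
    then have "x \<in> Field r" using order_preserving_dom[OF u(1)] by auto
    then show "(y, a) \<in> s" using order_preserving_mono[OF u(1) max_elt(2)[OF r] x a] by blast
  qed
  then show ?thesis using a by simp
qed

text \<open>Let \<open>y\<close> lie below the value at \<open>x\<close> and let \<open>z\<close> be
  a preimage of \<open>y\<close>. By totality either \<open>z\<close> is below \<open>x\<close>,
  hence in the downset, or \<open>x\<close> is below \<open>z\<close>, and then antisymmetry forces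
  \<open>y\<close> to be the value at \<open>x\<close> itself.\<close>

lemma downset_preserving_surj:
  assumes r: "finite_chain r" and s: "finite_chain s"
    and u: "order_preserving r s u" "ran u = Field s"
  shows "downset_preserving r s u"
  unfolding downset_preserving_def
proof (intro allI impI)
  fix A assume A: "Order_Relation.ofilter r A"
  have A': "x \<in> A \<Longrightarrow> x \<in> Field r" "x \<in> A \<Longrightarrow> (y, x) \<in> r \<Longrightarrow> y \<in> A" for x y
    using A by (auto simp: Order_Relation.ofilter_def under_def)
  have im: "\<exists>a. u x = Some a" if "x \<in> A" for x
    using A'(1)[OF that] order_preserving_dom[OF u(1)] domD by metis
  have "y \<in> (the \<circ> u) ` A" if x: "x \<in> A" and y: "(y, the (u x)) \<in> s" for x y
  proof -
    obtain a where a: "u x = Some a" using im[OF x] by blast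
    have "y \<in> Field s" using y by (auto simp: Field_def)
    then obtain z where z: "u z = Some y" using u(2) by (auto simp: ran_def)
    then have "z \<in> Field r" using order_preserving_dom[OF u(1)] by auto
    then consider "(z, x) \<in> r" | "(x, z) \<in> r" using finite_chain_total[OF r] A'(1)[OF x] by blast
    then show ?thesis
    proof cases
      case 1
      then show ?thesis using A'(2)[OF x] z by force
    next
      case 2
      then have "(a, y) \<in> s" using order_preserving_mono[OF u(1) _ a z] by blast
      then have "y = a" using y a finite_chain_antisym[OF s] by auto
      then show ?thesis using x a by force
    qed
  qed
  moreover have "(the \<circ> u) ` A \<subseteq> Field s"
    using im order_preserving_ran[OF u(1)] by fastforce
  ultimately show "Order_Relation.ofilter s ((the \<circ> u) ` A)"
    by (auto simp: Order_Relation.ofilter_def under_def)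
qed

text \<open>The whole field is a downset, so its image is a downset; containing the maximum, it is
  everything.\<close>

lemma ran_eq_of_downset_preserving:
  assumes r: "finite_chain r" "r \<noteq> {}" and s: "finite_chain s" "s \<noteq> {}"
    and u: "order_preserving r s u" "downset_preserving r s u" "u (max_elt r) = Some (max_elt s)"
  shows "ran u = Field s"
proof
  show "ran u \<subseteq> Field s" using u(1) by (simp add: order_preserving_def)
  have "Order_Relation.ofilter r (Field r)"
    by (auto simp: Order_Relation.ofilter_def under_def Field_def)
  then have "Order_Relation.ofilter s ((the \<circ> u) ` Field r)"
    using u(2) by (simp add: downset_preserving_def)
  moreover have "max_elt s \<in> (the \<circ> u) ` Field r" using u(3) max_elt(1)[OF r] by force
  ultimately have "under s (max_elt s) \<subseteq> (the \<circ> u) ` Field r"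
    unfolding Order_Relation.ofilter_def by blast
  then have "Field s \<subseteq> (the \<circ> u) ` Field r" using max_elt(2)[OF s] by (auto simp: under_def)
  also have "\<dots> \<subseteq> ran u"
    unfolding order_preserving_dom[OF u(1), symmetric] by (auto intro: ranI)
  finally show "Field s \<subseteq> ran u" .
qed

text \<open>Between one-element trees the first component is forced to be the unique total map,
  which leaves the comparison of the conditions on the second.\<close>

lemma hall_map_one_iff:
  assumes J: "finite_chain J" and J': "finite_chain J'"
  shows "hall_map ({(t, t)}, J) ({(t', t')}, J') f g \<longleftrightarrow> f = [t \<mapsto> t'] \<and> hall_epi J J' g"
proof -
  have "order_preserving {(t, t)} {(t', t')} f \<and> downset_preserving {(t, t)} {(t', t')} f
      \<longleftrightarrow> f = [t \<mapsto> t']"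
  proof (intro iffI conjI)
    assume "order_preserving {(t, t)} {(t', t')} f \<and> downset_preserving {(t, t)} {(t', t')} f"
    then have "dom f = {t}" "ran f \<subseteq> {t'}" by (auto simp: order_preserving_def Field_def)
    then show "f = [t \<mapsto> t']" by (auto simp: dom_eq_singleton_conv)
  next
    assume f: "f = [t \<mapsto> t']"
    then show "order_preserving {(t, t)} {(t', t')} f"
      by (auto simp: order_preserving_def compat_def Field_def)
    show "downset_preserving {(t, t)} {(t', t')} f"
      unfolding downset_preserving_def Order_Relation.ofilter_def f by (auto simp: under_def Field_def)
  qed
  moreover have "(if J' = {} then g = Map.empty else order_preserving J J' g \<and> downset_preserving J J' g \<and>
      g (max_elt J) = Some (max_elt J')) \<longleftrightarrow> hall_epi J J' g"
  proof (cases "J' = {}")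
    case True
    then show ?thesis by (simp add: hall_epi_def)
  next
    case J'ne: False
    show ?thesis
    proof (cases "J = {}")
      case True
      \<comment> \<open>An order-preserving map from the empty chain is nowhere defined, so over a
        nonempty target both sides of the equivalence are false.\<close>
      have "Field J' \<noteq> {}" using J'ne by (auto simp: Field_def)
      moreover have "g = Map.empty" if "order_preserving J J' g"
        using order_preserving_dom[OF that] True by simp
      ultimately show ?thesis using J'ne by (auto simp: hall_epi_def)
    next
      case False
      then show ?thesis
        using J'ne downset_preserving_surj[OF J J'] ran_eq_of_downset_preserving[OF J False J' J'ne]
          order_preserving_surj_max[OF J False J'] by (auto simp: hall_epi_def)
    qed
  qed
  ultimately show ?thesis unfolding hall_map_def by (simp only: prod.case) blast
qed

lemma is_chain_of_size_1D: "is_chain_of_size 1 T \<Longrightarrow> \<exists>t. T = {(t, t)}"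
proof -
  assume "is_chain_of_size 1 T"
  then have T: "finite_chain T" and "card (Field T) = 1" by (auto simp: is_chain_of_size_def)
  then obtain t where t: "Field T = {t}" by (auto simp: card_1_singleton_iff)
  then have "T \<subseteq> {(t, t)}" by (auto dest: FieldI1 FieldI2)
  moreover have "(t, t) \<in> T" using t finite_chain_refl[OF T] by simp
  ultimately show ?thesis by auto
qed

lemma is_chain_of_size_1_singleton: "is_chain_of_size 1 {(t, t)}"
  by (simp add: is_chain_of_size_def finite_chain_def Field_def)

text \<open>The tree component of an arrow is determined by source and target, so projecting to the
  second component is bijective on hom-sets.\<close>

lemma weakly_equivalent_Hall_one_Hall_chain:
  "weakly_equivalent (Hall_one :: ('t rel \<times> 'j rel, _) cat) (Hall_chain :: ('j rel, _) cat)"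
proof -
  have Ob: "\<exists>t J. X = ({(t, t)}, J) \<and> finite_chain J" if "X \<in> Ob Hall_one" for X :: "'t rel \<times> 'j rel"
    using that by (auto simp: Hall_one_def simp del: One_nat_def dest: is_chain_of_size_1D)
  have Hom: "Hom Hall_one ({(t, t)}, J) ({(t', t')}, J') = {([t \<mapsto> t'], g) |g. hall_epi J J' g}"
    if "finite_chain J" "finite_chain J'" for t t' :: 't and J J' :: "'j rel"
    by (auto simp: Hall_one_def hall_map_one_iff[OF that])
  have Idt: "Some |` {t} = [t \<mapsto> t]" for t :: 't
    by (rule ext) (simp add: restrict_map_def)
  have Id: "Id Hall_one ({(t, t)}, J) = ([t \<mapsto> t], Some |` Field J)" for t :: 't and J :: "'j rel"
    by (simp add: Hall_one_def Idt)
  have Comp: "Comp Hall_one (f', g') (f, g) = (f' \<circ>\<^sub>m f, g' \<circ>\<^sub>m g)"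
    for f f' :: "'t \<rightharpoonup> 't" and g g' :: "'j \<rightharpoonup> 'j" by (simp add: Hall_one_def)
  have sing: "[t' \<mapsto> t''] \<circ>\<^sub>m [t \<mapsto> t'] = [t \<mapsto> t'']" for t t' t'' :: 't
    by (rule ext) (simp add: map_comp_def)
  interpret H: category "Hall_chain :: ('j rel, _) cat" by (rule category_Hall_chain)
  interpret O: category "Hall_one :: ('t rel \<times> 'j rel, _) cat"
  proof
    fix X assume "X \<in> Ob (Hall_one :: ('t rel \<times> 'j rel, _) cat)"
    then obtain t J where X: "X = ({(t, t)}, J)" "finite_chain J" using Ob by blast
    then show "Id Hall_one X \<in> Hom Hall_one X X"
      using hall_epi_iso[OF chain_iso_id[OF X(2)]] by (simp add: Hom Id)
  next
    fix X Y Z :: "'t rel \<times> 'j rel" and f g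
    assume *: "X \<in> Ob Hall_one" "Y \<in> Ob Hall_one" "Z \<in> Ob Hall_one" "f \<in> Hom Hall_one X Y" "g \<in> Hom Hall_one Y Z"
    then obtain t J t' J' t'' J'' where "X = ({(t, t)}, J)" "finite_chain J" "Y = ({(t', t')}, J')"
      "finite_chain J'" "Z = ({(t'', t'')}, J'')" "finite_chain J''" using Ob by metis
    then show "Comp Hall_one g f \<in> Hom Hall_one X Z"
      using * by (auto simp: Hom Comp sing intro: hall_epi_comp)
  next
    fix X Y :: "'t rel \<times> 'j rel" and f
    assume *: "X \<in> Ob Hall_one" "Y \<in> Ob Hall_one" "f \<in> Hom Hall_one X Y"
    then obtain t J t' J' where "X = ({(t, t)}, J)" "finite_chain J" "Y = ({(t', t')}, J')"
      "finite_chain J'" using Ob by metis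
    then show "Comp Hall_one f (Id Hall_one X) = f" "Comp Hall_one (Id Hall_one Y) f = f"
      using * by (auto simp: Hom Comp Id sing hall_epi_dom_ran map_comp_id_left map_comp_id_right)
  next
    fix f g h :: "('t \<rightharpoonup> 't) \<times> ('j \<rightharpoonup> 'j)"
    show "Comp Hall_one h (Comp Hall_one g f) = Comp Hall_one (Comp Hall_one h g) f"
      by (simp add: Hall_one_def split_def map_comp_assoc)
  qed
  have "weak_equivalence (Hall_one :: ('t rel \<times> 'j rel, _) cat) (Hall_chain :: ('j rel, _) cat) \<lparr>FOb = snd, FArr = (\<lambda>X Y. snd)\<rparr>"
  proof
    fix X Y assume "X \<in> Ob (Hall_one :: ('t rel \<times> 'j rel, _) cat)" "Y \<in> Ob (Hall_one :: ('t rel \<times> 'j rel, _) cat)"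
    then obtain t J t' J' where X: "X = ({(t, t)}, J)" "finite_chain J" and Y: "Y = ({(t', t')}, J')"
      "finite_chain J'" using Ob by metis
    have "bij_betw snd (Hom Hall_one X Y) (Hom Hall_chain J J')"
      by (rule bij_betw_byWitness[where f' = "\<lambda>g. ([t \<mapsto> t'], g)"])
        (auto simp: X(1) Y(1) Hom[OF X(2) Y(2)] Hall_chain_def)
    then show "bij_betw (FArr \<lparr>FOb = snd, FArr = (\<lambda>X Y. snd)\<rparr> X Y) (Hom Hall_one X Y)
        (Hom Hall_chain (FOb \<lparr>FOb = snd, FArr = (\<lambda>X Y. snd)\<rparr> X) (FOb \<lparr>FOb = snd, FArr = (\<lambda>X Y. snd)\<rparr> Y))"
      by (simp add: X Y)
    fix f assume "f \<in> Hom Hall_one X Y"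
    then show "FArr \<lparr>FOb = snd, FArr = (\<lambda>X Y. snd)\<rparr> X Y f
        \<in> Hom Hall_chain (FOb \<lparr>FOb = snd, FArr = (\<lambda>X Y. snd)\<rparr> X) (FOb \<lparr>FOb = snd, FArr = (\<lambda>X Y. snd)\<rparr> Y)"
      by (auto simp: X(1) Y(1) Hom[OF X(2) Y(2)] Hall_chain_def)
  next
    fix J :: "'j rel" assume J: "J \<in> Ob Hall_chain"
    \<comment> \<open>Any point serves as the one-element tree over \<open>J\<close>;
      \<open>undefined\<close> is just an available value of the type.\<close>
    then have "({(undefined, undefined)}, J) \<in> Ob (Hall_one :: ('t rel \<times> 'j rel, _) cat)"
      by (simp add: Hall_one_def Hall_chain_def is_chain_of_size_1_singleton del: One_nat_def)
    then show "\<exists>X\<in>Ob (Hall_one :: ('t rel \<times> 'j rel, _) cat).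
        \<exists>f. is_iso Hall_chain (FOb \<lparr>FOb = snd, FArr = (\<lambda>X Y. snd)\<rparr> X) J f"
      using H.is_iso_Id[OF J] by force
  qed (auto simp: Hall_one_def Hall_chain_def split_def)
  then show ?thesis unfolding weakly_equivalent_def by blast
qed

section \<open>Removing the top of a chain\<close>

lemma Nat_top_Hom_iff: "u \<in> Hom Nat_top n m \<longleftrightarrow> dom u = {..n} \<and> ran u = {..m} \<and>
    (\<forall>x y a b. x \<le> y \<longrightarrow> u x = Some a \<longrightarrow> u y = Some b \<longrightarrow> a \<le> b) \<and>
    (m \<noteq> 0 \<longrightarrow> (\<forall>x. u x = Some m \<longleftrightarrow> x = n))"
proof -
  have A: "order_preserving (std_chain (Suc n)) (std_chain (Suc m)) u \<and> ran u = Field (std_chain (Suc m)) \<longleftrightarrow>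
     dom u = {..n} \<and> ran u = {..m} \<and> (\<forall>x y a b. x \<le> y \<longrightarrow> u x = Some a \<longrightarrow> u y = Some b \<longrightarrow> a \<le> b)"
  proof -
    have "y \<le> n" if "dom u = {..n}" "u y = Some b" for y b using that by auto
    moreover have "b \<le> m" if "ran u = {..m}" "u y = Some b" for y b using that ranI[of u y b] by auto
    ultimately show ?thesis
      unfolding order_preserving_iff[OF finite_chain_std_chain]
      by (simp only: std_chain_iff Field_std_chain lessThan_Suc_atMost less_Suc_eq_le) blast
  qed
  \<comment> \<open>Because of the shifted indexing, the exceptional singleton target is the index
    0.\<close>
  have B: "is_chain_of_size 1 (std_chain (Suc m)) \<longleftrightarrow> m = 0"
    by (simp add: is_chain_of_size_def)
  have C: "{x. u x = Some m} = {n} \<longleftrightarrow> (\<forall>x. u x = Some m \<longleftrightarrow> x = n)"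
    by (rule iffI) (simp_all add: set_eq_iff)
  have "u \<in> Hom Nat_top n m \<longleftrightarrow>
    (order_preserving (std_chain (Suc n)) (std_chain (Suc m)) u \<and> ran u = Field (std_chain (Suc m))) \<and>
    (m \<noteq> 0 \<longrightarrow> {x. u x = Some m} = {n})"
    by (simp add: Nat_top_def top_epi_def B[simplified])
  then show ?thesis unfolding A C by (simp only: conj_assoc)
qed

lemma Nat_hall_Hom_iff: "u \<in> Hom Nat_hall n m \<longleftrightarrow> (if m = 0 then u = Map.empty else
    dom u = {..<n} \<and> ran u = {..<m} \<and> (\<forall>x y a b. x \<le> y \<longrightarrow> u x = Some a \<longrightarrow> u y = Some b \<longrightarrow> a \<le> b))"
proof -
  have "y < n" if "dom u = {..<n}" "u y = Some b" for y b using that by auto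
  moreover have "b < m" if "ran u = {..<m}" "u y = Some b" for y b using that ranI[of u y b] by auto
  ultimately have "dom u = {..<n} \<and> ran u = {..<m} \<and>
      (\<forall>x y a b. x \<le> y \<longrightarrow> u x = Some a \<longrightarrow> u y = Some b \<longrightarrow> a \<le> b) \<longleftrightarrow>
      order_preserving (std_chain n) (std_chain m) u \<and> ran u = {..<m}"
    unfolding order_preserving_iff[OF finite_chain_std_chain] by (simp only: std_chain_iff Field_std_chain) blast
  then show ?thesis by (simp add: Nat_hall_def hall_epi_def)
qed

lemma Nat_top_HomD:
  assumes "u \<in> Hom Nat_top n m"
  shows "x \<le> n \<Longrightarrow> \<exists>a. a \<le> m \<and> u x = Some a" "u x = Some a \<Longrightarrow> x \<le> n" "u x = Some a \<Longrightarrow> a \<le> m"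
    "a \<le> m \<Longrightarrow> \<exists>x. u x = Some a" "x \<le> y \<Longrightarrow> u x = Some a \<Longrightarrow> u y = Some b \<Longrightarrow> a \<le> b"
    "m \<noteq> 0 \<Longrightarrow> u x = Some m \<longleftrightarrow> x = n"
proof -
  have d: "dom u = {..n}" and r: "ran u = {..m}"
    and mono: "\<forall>x y a b. x \<le> y \<longrightarrow> u x = Some a \<longrightarrow> u y = Some b \<longrightarrow> a \<le> b"
    and top: "m \<noteq> 0 \<longrightarrow> (\<forall>x. u x = Some m \<longleftrightarrow> x = n)"
    using assms unfolding Nat_top_Hom_iff by blast+
  show "u x = Some a \<Longrightarrow> x \<le> n" using d domI[of u x a] by simp
  show ra: "u x = Some a \<Longrightarrow> a \<le> m" for x a using r ranI[of u x a] by simp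
  show "\<exists>a. a \<le> m \<and> u x = Some a" if "x \<le> n"
  proof -
    have "x \<in> dom u" using \<open>x \<le> n\<close> d by simp
    then show ?thesis using ra by (metis domD)
  qed
  show "\<exists>x. u x = Some a" if "a \<le> m"
  proof -
    have "a \<in> ran u" using \<open>a \<le> m\<close> r by simp
    then show ?thesis unfolding ran_def by simp
  qed
  show "x \<le> y \<Longrightarrow> u x = Some a \<Longrightarrow> u y = Some b \<Longrightarrow> a \<le> b" using mono by blast
  show "m \<noteq> 0 \<Longrightarrow> u x = Some m \<longleftrightarrow> x = n" using top by blast
qed

text \<open>The functor is the identity on indices: removing the top turns \<open>n + 1\<close>
  elements into \<open>n\<close>. \<open>R\<close> and \<open>E\<close> are mutually inverse on
  hom-sets, so functoriality is checked for \<open>R\<close> alone.\<close>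

lemma weakly_equivalent_Nat_top_Nat_hall: "weakly_equivalent Nat_top Nat_hall"
proof -
  define R where "R n m u = (if m = 0 then Map.empty else u |` {..<n})" for n m :: nat and u :: "nat \<rightharpoonup> nat"
  \<comment> \<open>Onto a one-element chain only the constant map exists, whatever \<open>u\<close>
    is; otherwise the removed top comes back as the only element with value
    \<open>m\<close>.\<close>
  define E where "E n m u = (if m = 0 then (\<lambda>x. if x \<le> n then Some 0 else None) else u(n \<mapsto> m))"
    for n m :: nat and u :: "nat \<rightharpoonup> nat"
  interpret T: category Nat_top by (rule category_Nat_top)
  interpret H: category Nat_hall by (rule category_Nat_hall)
  have R_in: "R n m u \<in> Hom Nat_hall n m" if u: "u \<in> Hom Nat_top n m" for n m u
  proof (cases "m = 0")
    case True
    then show ?thesis by (simp add: Nat_hall_Hom_iff R_def)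
  next
    case False
    note uD = Nat_top_HomD[OF u]
    \<comment> \<open>Here the condition on the maximum enters: the elements strictly below the top
      are exactly those with value strictly below the top.\<close>
    have lt: "a < m \<longleftrightarrow> x < n" if x: "u x = Some a" for x a
    proof -
      have "a = m \<longleftrightarrow> x = n" using uD(6)[OF False, of x] x by simp
      then show ?thesis using uD(2,3)[OF x] by linarith
    qed
    have "dom u = {..n}" using u unfolding Nat_top_Hom_iff by blast
    then have "dom (u |` {..<n}) = {..<n}" unfolding dom_restrict by auto
    moreover have "ran (u |` {..<n}) = {..<m}"
    proof (intro equalityI subsetI)
      fix a assume "a \<in> ran (u |` {..<n})"
      then obtain x where "x < n" "u x = Some a" by (auto dest!: ran_restrictD)
      then show "a \<in> {..<m}" using lt by simp
    next
      fix a assume "a \<in> {..<m}"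
      then obtain x where x: "u x = Some a" "a < m" using uD(4)[of a] by auto
      then have "x < n" using lt by simp
      then show "a \<in> ran (u |` {..<n})" using x by (auto intro: ranI[of _ x])
    qed
    moreover have "a \<le> b" if "x \<le> y" "(u |` {..<n}) x = Some a" "(u |` {..<n}) y = Some b" for x y a b
      using that uD(5) by (auto simp: restrict_map_def split: if_splits)
    ultimately show ?thesis using False by (simp add: Nat_hall_Hom_iff R_def)
  qed
  have E_in: "E n m u \<in> Hom Nat_top n m" if u: "u \<in> Hom Nat_hall n m" for n m u
  proof (cases "m = 0")
    case True
    have "dom (\<lambda>x. if x \<le> n then Some 0 else None) = {..n}" by (auto simp: dom_def)
    moreover have "ran (\<lambda>x. if x \<le> n then Some (0::nat) else None) = {..0}" by (auto simp: ran_def)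
    ultimately show ?thesis using True by (simp add: Nat_top_Hom_iff E_def)
  next
    case False
    then have u': "dom u = {..<n}" "ran u = {..<m}"
        "\<And>x y a b. x \<le> y \<Longrightarrow> u x = Some a \<Longrightarrow> u y = Some b \<Longrightarrow> a \<le> b"
      using u False by (simp_all add: Nat_hall_Hom_iff)
    have d: "x < n \<and> a < m" if "u x = Some a" for x a
      using domI[of u x a] ranI[of u x a] that unfolding u'(1,2) by simp
    have "n \<notin> dom u" unfolding u'(1) by simp
    then have "u n = None" by (simp add: domIff)
    then have "ran (u(n \<mapsto> m)) = insert m {..<m}" "dom (u(n \<mapsto> m)) = insert n {..<n}"
      unfolding u'(1,2)[symmetric] by simp_all
    moreover have "insert m {..<m} = {..m}" "insert n {..<n} = {..n}" by auto
    moreover have "a \<le> b" if xy: "x \<le> y" "(u(n \<mapsto> m)) x = Some a" "(u(n \<mapsto> m)) y = Some b" for x y a b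
    proof (cases "y = n")
      case True
      then show ?thesis using xy d[of x a] by (cases "x = n") auto
    next
      case False
      then have "u y = Some b" using xy by simp
      then show ?thesis using xy d[of y b] u'(3)[of x y] by (cases "x = n") auto
    qed
    moreover have "(u(n \<mapsto> m)) x = Some m \<longleftrightarrow> x = n" for x using d[of x m] by auto
    ultimately show ?thesis using False unfolding Nat_top_Hom_iff E_def by presburger
  qed
  have RE: "R n m (E n m u) = u" if u: "u \<in> Hom Nat_hall n m" for n m u
  proof (cases "m = 0")
    case False
    then have "dom u = {..<n}" using u by (simp add: Nat_hall_Hom_iff)
    then have "u x = None" if "\<not> x < n" for x using that domIff[of x u] by simp
    then show ?thesis using False by (auto simp: R_def E_def fun_eq_iff restrict_map_def)
  qed (use u in \<open>auto simp: R_def Nat_hall_Hom_iff\<close>)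
  have ER: "E n m (R n m u) = u" if u: "u \<in> Hom Nat_top n m" for n m u
  proof
    fix x
    note uD = Nat_top_HomD[OF u]
    show "E n m (R n m u) x = u x"
      using uD(1)[of x] uD(2)[of x] uD(6)[of x]
      by (cases "u x") (auto simp: E_def R_def restrict_map_def)
  qed
  have "weak_equivalence Nat_top Nat_hall \<lparr>FOb = (\<lambda>n. n), FArr = R\<rparr>"
  proof
    fix X Y Z f g assume f: "f \<in> Hom Nat_top X Y" and g: "g \<in> Hom Nat_top Y Z"
    note fD = Nat_top_HomD[OF f] and gD = Nat_top_HomD[OF g]
    show "FArr \<lparr>FOb = (\<lambda>n. n), FArr = R\<rparr> X Z (Comp Nat_top g f) =
      Comp Nat_hall (FArr \<lparr>FOb = (\<lambda>n. n), FArr = R\<rparr> Y Z g) (FArr \<lparr>FOb = (\<lambda>n. n), FArr = R\<rparr> X Y f)"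
    proof (cases "Z = 0")
      case True
      then show ?thesis by (simp add: R_def Nat_top_def Nat_hall_def)
    next
      case Z: False
      \<comment> \<open>A one-element chain does not map onto a larger one. For \<open>Y = 0\<close>
        the image of \<open>f\<close> under \<open>R\<close> would be the empty map, although the
        composite restricts to a map onto a nonempty chain.\<close>
      have Y: "Y \<noteq> 0"
      proof
        assume "Y = 0"
        obtain x where x: "g x = Some 0" using gD(4)[of 0] by blast
        then have "x = Y" using gD(2) \<open>Y = 0\<close> by auto
        then show False using x Z gD(6)[OF Z, of x] by auto
      qed
      have "f x = Some a \<Longrightarrow> x < X \<Longrightarrow> a < Y" for x a
        using fD(3)[of x a] fD(6)[OF Y, of x] by (cases "a = Y") auto
      then show ?thesis using Y Z
        by (auto simp: R_def Nat_top_def Nat_hall_def fun_eq_iff map_comp_def restrict_map_def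
            split: option.splits)
    qed
  next
    fix n m
    show "bij_betw (FArr \<lparr>FOb = (\<lambda>n. n), FArr = R\<rparr> n m) (Hom Nat_top n m)
      (Hom Nat_hall (FOb \<lparr>FOb = (\<lambda>n. n), FArr = R\<rparr> n) (FOb \<lparr>FOb = (\<lambda>n. n), FArr = R\<rparr> m))"
      by (rule bij_betw_byWitness[where f' = "E n m"]) (auto simp: R_in E_in RE ER)
  next
    fix n assume "n \<in> Ob Nat_hall"
    then show "\<exists>X\<in>Ob Nat_top. \<exists>f. is_iso Nat_hall (FOb \<lparr>FOb = (\<lambda>n. n), FArr = R\<rparr> X) n f"
      using H.is_iso_Id by (auto simp: Nat_top_def)
  next
    fix n assume "n \<in> Ob Nat_top"
    show "FArr \<lparr>FOb = (\<lambda>n. n), FArr = R\<rparr> n n (Id Nat_top n) = Id Nat_hall (FOb \<lparr>FOb = (\<lambda>n. n), FArr = R\<rparr> n)"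
      by (auto simp: R_def Nat_top_def Nat_hall_def fun_eq_iff restrict_map_def)
  qed (auto simp: R_in, auto simp: Nat_hall_def)
  then show ?thesis unfolding weakly_equivalent_def by blast
qed

text \<open>\<open>Nat_hall\<close> is the meeting point of the unrelated types; the leg from
  \<open>Hall_one\<close> is traversed backwards.\<close>

lemma weakly_equivalent_MC_top_HF_one:
  "weakly_equivalent (MC_top :: ('a::infinite rel list, _) cat)
    (full_subcat (HF :: (('t rel \<times> 'j::infinite rel) list, _) cat)
      (\<lambda>X. \<forall>(T, J) \<in> set X. is_chain_of_size 1 T))"
  unfolding MC_top_eq_Fam full_subcat_HF_eq_Fam
  by (rule weakly_equivalent_Fam[OF weakly_equivalent_trans[OF
    weakly_equivalent_trans[OF weakly_equivalent_Chain_top_Nat_top weakly_equivalent_Nat_top_Nat_hall]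
    weakly_equivalent_sym[OF weakly_equivalent_trans[OF weakly_equivalent_Hall_one_Hall_chain
      weakly_equivalent_Hall_chain_Nat_hall]]]])

section \<open>Products and images of MTL-algebras\<close>

text \<open>Elements are extensional functions on \<open>I\<close>, so that equality of carrier
  elements is equality of coordinates.\<close>

definition mtl_prod :: "'i set \<Rightarrow> ('i \<Rightarrow> 'a mtl) \<Rightarrow> ('i \<Rightarrow> 'a) mtl" where
  "mtl_prod I B = \<lparr>carrier = (\<Pi>\<^sub>E i\<in>I. carrier (B i)),
    monoid.mult = (\<lambda>x y. \<lambda>i\<in>I. x i \<otimes>\<^bsub>B i\<^esub> y i), one = (\<lambda>i\<in>I. \<one>\<^bsub>B i\<^esub>),
    wedge = (\<lambda>x y. \<lambda>i\<in>I. wedge (B i) (x i) (y i)),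
    vee = (\<lambda>x y. \<lambda>i\<in>I. vee (B i) (x i) (y i)),
    impl = (\<lambda>x y. \<lambda>i\<in>I. impl (B i) (x i) (y i)), falsum = (\<lambda>i\<in>I. falsum (B i))\<rparr>"

text \<open>Transport of structure along a map meant to be injective on the carrier. It is the means
  of moving an algebra to another type.\<close>

definition mtl_image :: "('a \<Rightarrow> 'b) \<Rightarrow> 'a mtl \<Rightarrow> 'b mtl" where
  "mtl_image f A = (let g = inv_into (carrier A) f in \<lparr>carrier = f ` carrier A,
    monoid.mult = (\<lambda>x y. f (g x \<otimes>\<^bsub>A\<^esub> g y)), one = f \<one>\<^bsub>A\<^esub>,
    wedge = (\<lambda>x y. f (wedge A (g x) (g y))), vee = (\<lambda>x y. f (vee A (g x) (g y))),
    impl = (\<lambda>x y. f (impl A (g x) (g y))), falsum = f (falsum A)\<rparr>)"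

lemma mtl_prod_simps [simp]:
  "carrier (mtl_prod I B) = (\<Pi>\<^sub>E i\<in>I. carrier (B i))"
  "x \<otimes>\<^bsub>mtl_prod I B\<^esub> y = (\<lambda>i\<in>I. x i \<otimes>\<^bsub>B i\<^esub> y i)"
  "\<one>\<^bsub>mtl_prod I B\<^esub> = (\<lambda>i\<in>I. \<one>\<^bsub>B i\<^esub>)"
  "wedge (mtl_prod I B) x y = (\<lambda>i\<in>I. wedge (B i) (x i) (y i))"
  "vee (mtl_prod I B) x y = (\<lambda>i\<in>I. vee (B i) (x i) (y i))"
  "impl (mtl_prod I B) x y = (\<lambda>i\<in>I. impl (B i) (x i) (y i))"
  "falsum (mtl_prod I B) = (\<lambda>i\<in>I. falsum (B i))"
  by (simp_all add: mtl_prod_def)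

lemma mtl_image_simps [simp]:
  "carrier (mtl_image f A) = f ` carrier A"
  "x \<otimes>\<^bsub>mtl_image f A\<^esub> y = f (inv_into (carrier A) f x \<otimes>\<^bsub>A\<^esub> inv_into (carrier A) f y)"
  "\<one>\<^bsub>mtl_image f A\<^esub> = f \<one>\<^bsub>A\<^esub>"
  "wedge (mtl_image f A) x y = f (wedge A (inv_into (carrier A) f x) (inv_into (carrier A) f y))"
  "vee (mtl_image f A) x y = f (vee A (inv_into (carrier A) f x) (inv_into (carrier A) f y))"
  "impl (mtl_image f A) x y = f (impl A (inv_into (carrier A) f x) (inv_into (carrier A) f y))"
  "falsum (mtl_image f A) = f (falsum A)"
  by (simp_all add: mtl_image_def Let_def)

text \<open>Extensionality of \<open>x\<close> settles the coordinates outside \<open>I\<close>, so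
  an equation in the product becomes a family of equations.\<close>

lemma restrict_eq_in_prod:
  assumes "x \<in> carrier (mtl_prod I B)"
  shows "(\<lambda>i\<in>I. f i) = x \<longleftrightarrow> (\<forall>i\<in>I. f i = x i)"
proof
  show "\<forall>i\<in>I. f i = x i" if "(\<lambda>i\<in>I. f i) = x" using that by (metis restrict_apply')
  assume fx: "\<forall>i\<in>I. f i = x i"
  show "(\<lambda>i\<in>I. f i) = x"
  proof
    fix i show "(\<lambda>i\<in>I. f i) i = x i"
      using fx PiE_arb[OF assms[unfolded mtl_prod_simps]] by (cases "i \<in> I") simp_all
  qed
qed

lemma mtl_le_prod:
  "x \<in> carrier (mtl_prod I B) \<Longrightarrow>
    mtl_le (mtl_prod I B) x y \<longleftrightarrow> (\<forall>i\<in>I. mtl_le (B i) (x i) (y i))"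
  unfolding mtl_le_def mtl_prod_simps(4) by (rule restrict_eq_in_prod)

lemma mtl_prod_memD: "x \<in> carrier (mtl_prod I B) \<Longrightarrow> i \<in> I \<Longrightarrow> x i \<in> carrier (B i)"
  unfolding mtl_prod_simps by (rule PiE_mem)

lemma restrict_in_mtl_prod:
  "(\<And>i. i \<in> I \<Longrightarrow> f i \<in> carrier (B i)) \<Longrightarrow> (\<lambda>i\<in>I. f i) \<in> carrier (mtl_prod I B)"
  by simp

lemma mtl_algebra_prod:
  assumes "\<And>i. i \<in> I \<Longrightarrow> mtl_algebra (B i)"
  shows "mtl_algebra (mtl_prod I B)"
proof -
  have comm: "comm_monoid (B i)" if "i \<in> I" for i
    using assms[OF that] by (rule mtl_algebra.axioms)
  note mon = comm_monoid.axioms(1)[OF comm]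
  note m = mtl_prod_memD and cI = restrict_in_mtl_prod and r = restrict_eq_in_prod
  \<comment> \<open>Keeping the carrier of the product folded lets the membership rules
    \<open>m\<close> and \<open>cI\<close> match.\<close>
  note [simp del] = mtl_prod_simps(1)
  show ?thesis
  proof (unfold_locales, goal_cases)
    \<comment> \<open>Cases 1 to 6 are the commutative monoid laws, cases 7 to 20 the assumptions of
      \<open>mtl_algebra\<close> in their declared order.\<close>
    case 1 then show ?case by (simp add: cI m monoid.m_closed[OF mon])
  next
    case 2 then show ?case by (simp add: m monoid.m_assoc[OF mon] cong: restrict_cong)
  next
    case 3 then show ?case by (simp add: cI monoid.one_closed[OF mon])
  next
    case 4 then show ?case by (simp add: r m monoid.l_one[OF mon])
  next
    case 5 then show ?case by (simp add: r m monoid.r_one[OF mon])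
  next
    case 6 show ?case unfolding mtl_prod_simps(2) by (rule restrict_ext, rule comm_monoid.m_comm[OF comm]) (use 6 in \<open>simp_all add: m\<close>)
  next
    case 7 then show ?case by (simp add: cI m mtl_algebra.wedge_closed[OF assms])
  next
    case 8 then show ?case by (simp add: cI m mtl_algebra.vee_closed[OF assms])
  next
    case 9 then show ?case by (simp add: cI m mtl_algebra.impl_closed[OF assms])
  next
    case 10 then show ?case by (simp add: cI mtl_algebra.falsum_closed[OF assms])
  next
    case 11 show ?case unfolding mtl_prod_simps(4) by (rule restrict_ext, rule mtl_algebra.wedge_commute[OF assms]) (use 11 in \<open>simp_all add: m\<close>)
  next
    case 12 show ?case unfolding mtl_prod_simps(5) by (rule restrict_ext, rule mtl_algebra.vee_commute[OF assms]) (use 12 in \<open>simp_all add: m\<close>)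
  next
    case 13 then show ?case by (simp add: m mtl_algebra.wedge_assoc[OF assms] cong: restrict_cong)
  next
    case 14 then show ?case by (simp add: m mtl_algebra.vee_assoc[OF assms] cong: restrict_cong)
  next
    case 15 then show ?case by (simp add: r m mtl_algebra.wedge_absorb[OF assms])
  next
    case 16 then show ?case by (simp add: r m mtl_algebra.vee_absorb[OF assms])
  next
    case 17 then show ?case by (simp add: mtl_le_prod cI m mtl_algebra.falsum_closed[OF assms] mtl_algebra.falsum_least[OF assms])
  next
    case 18 then show ?case by (simp add: mtl_le_prod m mtl_algebra.integral[OF assms])
  next
    case 19 then show ?case by (simp add: mtl_le_prod cI m monoid.m_closed[OF mon] mtl_algebra.residuation[OF assms])
  next
    case 20 then show ?case by (simp add: m mtl_algebra.prelinear[OF assms] cong: restrict_cong)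
  qed
qed

lemma mtl_algebra_image:
  assumes "mtl_algebra A" and inj: "inj_on f (carrier A)"
  shows "mtl_algebra (mtl_image f A)"
proof -
  interpret mtl_algebra A by fact
  have eq: "f x = f y \<longleftrightarrow> x = y" if "x \<in> carrier A" "y \<in> carrier A" for x y
    using inj that by (auto simp: inj_on_def)
  show ?thesis
    by unfold_locales
      (auto simp: mtl_le_def inv_into_f_f[OF inj] eq m_assoc wedge_closed vee_closed impl_closed
        falsum_closed wedge_assoc vee_assoc wedge_absorb vee_absorb residuation[unfolded mtl_le_def]
        falsum_least[unfolded mtl_le_def] integral[unfolded mtl_le_def] prelinear
        intro: m_comm wedge_commute vee_commute)
qed

section \<open>Homomorphisms\<close>

lemma mtl_hom_closed: "h \<in> mtl_hom A B \<Longrightarrow> x \<in> carrier A \<Longrightarrow> h x \<in> carrier B"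
  by (auto simp: mtl_hom_def)

lemma mtl_homD:
  assumes "h \<in> mtl_hom A B"
  shows "h \<one>\<^bsub>A\<^esub> = \<one>\<^bsub>B\<^esub>" "h (falsum A) = falsum B"
    "\<lbrakk>x \<in> carrier A; y \<in> carrier A\<rbrakk> \<Longrightarrow> h (x \<otimes>\<^bsub>A\<^esub> y) = h x \<otimes>\<^bsub>B\<^esub> h y"
    "\<lbrakk>x \<in> carrier A; y \<in> carrier A\<rbrakk> \<Longrightarrow> h (wedge A x y) = wedge B (h x) (h y)"
    "\<lbrakk>x \<in> carrier A; y \<in> carrier A\<rbrakk> \<Longrightarrow> h (vee A x y) = vee B (h x) (h y)"
    "\<lbrakk>x \<in> carrier A; y \<in> carrier A\<rbrakk> \<Longrightarrow> h (impl A x y) = impl B (h x) (h y)"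
  using assms by (auto simp: mtl_hom_def)

lemma mtl_hom_id: "(\<lambda>x. x) \<in> mtl_hom A A"
  by (auto simp: mtl_hom_def)

lemma mtl_hom_comp: "h \<in> mtl_hom A B \<Longrightarrow> k \<in> mtl_hom B C \<Longrightarrow> k \<circ> h \<in> mtl_hom A C"
  unfolding mtl_hom_def by (auto simp: Pi_iff)

lemma mtl_hom_image: "inj_on f (carrier A) \<Longrightarrow> f \<in> mtl_hom A (mtl_image f A)"
  by (auto simp: mtl_hom_def)

lemma mtl_hom_proj: "i \<in> I \<Longrightarrow> (\<lambda>x. x i) \<in> mtl_hom (mtl_prod I B) (B i)"
  by (auto simp: mtl_hom_def)

lemma mtl_hom_into_prod:
  "(\<And>i. i \<in> I \<Longrightarrow> h i \<in> mtl_hom A (B i)) \<Longrightarrow> (\<lambda>x. \<lambda>i\<in>I. h i x) \<in> mtl_hom A (mtl_prod I B)"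
  unfolding mtl_hom_def[of A "mtl_prod I B"]
  by (intro CollectI conjI Pi_I ballI restrict_in_mtl_prod)
    (auto simp: mtl_homD cong: restrict_cong intro: mtl_hom_closed)

lemma mtl_hom_inv_into:
  assumes A: "mtl_algebra A" and h: "h \<in> mtl_hom A B" and bij: "bij_betw h (carrier A) (carrier B)"
  shows "inv_into (carrier A) h \<in> mtl_hom B A"
proof -
  interpret mtl_algebra A by fact
  have inj: "inj_on h (carrier A)" using bij by (simp add: bij_betw_def)
  have B: "\<exists>x \<in> carrier A. y = h x" if "y \<in> carrier B" for y
    using bij that by (metis bij_betw_imp_surj_on imageE imageI)
  have g: "inv_into (carrier A) h (h x) = x" if "x \<in> carrier A" for x
    using inv_into_f_f[OF inj that] .
  note simps = mtl_homD[OF h, symmetric] g wedge_closed vee_closed impl_closed falsum_closed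
  show ?thesis unfolding mtl_hom_def
  proof (intro CollectI conjI ballI)
    show "inv_into (carrier A) h \<in> carrier B \<rightarrow> carrier A" using B g by (metis Pi_I)
    fix x y assume "x \<in> carrier B" "y \<in> carrier B"
    then obtain a b where "a \<in> carrier A" "x = h a" "b \<in> carrier A" "y = h b" using B by metis
    then show "inv_into (carrier A) h (x \<otimes>\<^bsub>B\<^esub> y) = inv_into (carrier A) h x \<otimes>\<^bsub>A\<^esub> inv_into (carrier A) h y"
      "inv_into (carrier A) h (wedge B x y) = wedge A (inv_into (carrier A) h x) (inv_into (carrier A) h y)"
      "inv_into (carrier A) h (vee B x y) = vee A (inv_into (carrier A) h x) (inv_into (carrier A) h y)"
      "inv_into (carrier A) h (impl B x y) = impl A (inv_into (carrier A) h x) (inv_into (carrier A) h y)"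
      by (simp_all add: simps)
  qed (simp_all add: simps)
qed

section \<open>Lattice order and residuation in an MTL-algebra\<close>

context mtl_algebra
begin

lemma le_refl: "x \<in> carrier A \<Longrightarrow> mtl_le A x x"
  unfolding mtl_le_def by (metis vee_absorb wedge_absorb wedge_closed)

lemma le_antisym: "\<lbrakk>x \<in> carrier A; y \<in> carrier A; mtl_le A x y; mtl_le A y x\<rbrakk> \<Longrightarrow> x = y"
  unfolding mtl_le_def by (metis wedge_commute)

lemma le_trans: "\<lbrakk>x \<in> carrier A; y \<in> carrier A; z \<in> carrier A; mtl_le A x y; mtl_le A y z\<rbrakk> \<Longrightarrow> mtl_le A x z"
  unfolding mtl_le_def by (metis wedge_assoc)

lemma wedge_le1: "\<lbrakk>x \<in> carrier A; y \<in> carrier A\<rbrakk> \<Longrightarrow> mtl_le A (wedge A x y) x"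
  unfolding mtl_le_def by (metis wedge_assoc wedge_commute le_refl mtl_le_def wedge_closed)

lemma wedge_le2: "\<lbrakk>x \<in> carrier A; y \<in> carrier A\<rbrakk> \<Longrightarrow> mtl_le A (wedge A x y) y"
  using wedge_le1 wedge_commute by metis

lemma le_wedge: "\<lbrakk>x \<in> carrier A; y \<in> carrier A; z \<in> carrier A; mtl_le A z x; mtl_le A z y\<rbrakk>
    \<Longrightarrow> mtl_le A z (wedge A x y)"
  unfolding mtl_le_def by (metis wedge_assoc)

lemma le_iff_vee: "\<lbrakk>x \<in> carrier A; y \<in> carrier A\<rbrakk> \<Longrightarrow> mtl_le A x y \<longleftrightarrow> vee A x y = y"
  unfolding mtl_le_def by (metis wedge_absorb vee_absorb wedge_commute vee_commute)

lemma le_vee1: "\<lbrakk>x \<in> carrier A; y \<in> carrier A\<rbrakk> \<Longrightarrow> mtl_le A x (vee A x y)"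
  unfolding mtl_le_def by (rule wedge_absorb)

lemma le_vee2: "\<lbrakk>x \<in> carrier A; y \<in> carrier A\<rbrakk> \<Longrightarrow> mtl_le A y (vee A x y)"
  using le_vee1 vee_commute by metis

lemma vee_le: "\<lbrakk>x \<in> carrier A; y \<in> carrier A; z \<in> carrier A; mtl_le A x z; mtl_le A y z\<rbrakk>
    \<Longrightarrow> mtl_le A (vee A x y) z"
  by (simp add: le_iff_vee vee_closed vee_assoc)

lemma mult_mono_right:
  assumes "x \<in> carrier A" "y \<in> carrier A" "z \<in> carrier A" "mtl_le A x y"
  shows "mtl_le A (z \<otimes>\<^bsub>A\<^esub> x) (z \<otimes>\<^bsub>A\<^esub> y)"
proof -
  have "mtl_le A y (impl A z (z \<otimes>\<^bsub>A\<^esub> y))"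
    using assms residuation[of z "z \<otimes>\<^bsub>A\<^esub> y" y] le_refl by simp
  then have "mtl_le A x (impl A z (z \<otimes>\<^bsub>A\<^esub> y))" using assms le_trans impl_closed m_closed by meson
  then show ?thesis using assms residuation by simp
qed

lemma mult_mono:
  assumes "x \<in> carrier A" "y \<in> carrier A" "z \<in> carrier A" "w \<in> carrier A" "mtl_le A x y" "mtl_le A z w"
  shows "mtl_le A (x \<otimes>\<^bsub>A\<^esub> z) (y \<otimes>\<^bsub>A\<^esub> w)"
  using mult_mono_right[of z w x] mult_mono_right[of x y w] assms
    le_trans[of "x \<otimes>\<^bsub>A\<^esub> z" "x \<otimes>\<^bsub>A\<^esub> w" "y \<otimes>\<^bsub>A\<^esub> w"] m_comm by auto

lemma mult_le1: "\<lbrakk>x \<in> carrier A; y \<in> carrier A\<rbrakk> \<Longrightarrow> mtl_le A (x \<otimes>\<^bsub>A\<^esub> y) x"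
  using mult_mono_right[of y "\<one>\<^bsub>A\<^esub>" x] integral by simp

lemma mult_le2: "\<lbrakk>x \<in> carrier A; y \<in> carrier A\<rbrakk> \<Longrightarrow> mtl_le A (x \<otimes>\<^bsub>A\<^esub> y) y"
  using mult_le1[of y x] m_comm by simp

lemma mult_falsum: "x \<in> carrier A \<Longrightarrow> x \<otimes>\<^bsub>A\<^esub> falsum A = falsum A"
  by (meson falsum_closed falsum_least le_antisym m_closed mult_le2)

text \<open>By residuation, multiplication by \<open>x\<close> is a left adjoint, and left adjoints
  preserve joins.\<close>

lemma mult_vee_distrib:
  assumes "x \<in> carrier A" "y \<in> carrier A" "z \<in> carrier A"
  shows "x \<otimes>\<^bsub>A\<^esub> vee A y z = vee A (x \<otimes>\<^bsub>A\<^esub> y) (x \<otimes>\<^bsub>A\<^esub> z)"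
proof (rule le_antisym)
  let ?w = "vee A (x \<otimes>\<^bsub>A\<^esub> y) (x \<otimes>\<^bsub>A\<^esub> z)"
  have w: "?w \<in> carrier A" using assms vee_closed by simp
  have "mtl_le A y (impl A x ?w)" "mtl_le A z (impl A x ?w)"
    using assms w by (simp_all add: residuation[symmetric] le_vee1 le_vee2)
  then show "mtl_le A (x \<otimes>\<^bsub>A\<^esub> vee A y z) ?w"
    using assms w by (simp add: residuation vee_closed impl_closed vee_le)
  show "mtl_le A ?w (x \<otimes>\<^bsub>A\<^esub> vee A y z)"
    using assms vee_closed by (intro vee_le mult_mono_right le_vee1 le_vee2) auto
qed (use assms vee_closed in auto)

end

text \<open>Bounds, meets and joins are determined by the order, and the residual by the order
  together with the multiplication; so only these two have to be compared when an isomorphism is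
  constructed.\<close>

lemma mtl_hom_of_order_iso:
  assumes A: "mtl_algebra A" and B: "mtl_algebra B" and bij: "bij_betw h (carrier A) (carrier B)"
    and le: "\<And>x y. \<lbrakk>x \<in> carrier A; y \<in> carrier A\<rbrakk> \<Longrightarrow> mtl_le B (h x) (h y) \<longleftrightarrow> mtl_le A x y"
    and mult: "\<And>x y. \<lbrakk>x \<in> carrier A; y \<in> carrier A\<rbrakk> \<Longrightarrow> h (x \<otimes>\<^bsub>A\<^esub> y) = h x \<otimes>\<^bsub>B\<^esub> h y"
  shows "h \<in> mtl_hom A B"
proof -
  interpret A: mtl_algebra A by fact
  interpret B: mtl_algebra B by fact
  have hB: "h x \<in> carrier B" if "x \<in> carrier A" for x using bij that by (metis bij_betw_imp_surj_on imageE imageI)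
  have surj: "\<exists>x \<in> carrier A. h x = y" if "y \<in> carrier B" for y
    using bij that by (metis bij_betw_imp_surj_on imageE imageI)
  note cl = A.wedge_closed A.vee_closed A.impl_closed A.falsum_closed hB
    B.wedge_closed B.vee_closed B.impl_closed B.falsum_closed
  have "h \<one>\<^bsub>A\<^esub> = \<one>\<^bsub>B\<^esub>"
    using surj[OF B.one_closed] le A.integral B.integral B.le_antisym hB by (metis A.one_closed B.one_closed)
  moreover have "h (falsum A) = falsum B"
    using surj[OF B.falsum_closed] le A.falsum_least B.falsum_least B.le_antisym hB
    by (metis A.falsum_closed B.falsum_closed)
  moreover have "h (wedge A x y) = wedge B (h x) (h y)" if xy: "x \<in> carrier A" "y \<in> carrier A" for x y
  proof -
    obtain z where z: "z \<in> carrier A" "h z = wedge B (h x) (h y)" using surj cl xy by metis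
    have "mtl_le A z x" "mtl_le A z y"
      using z xy le B.wedge_le1 B.wedge_le2 hB by metis+
    then have "mtl_le B (wedge B (h x) (h y)) (h (wedge A x y))"
      using z xy le cl A.le_wedge by metis
    moreover have "mtl_le B (h (wedge A x y)) (wedge B (h x) (h y))"
      using xy by (intro B.le_wedge) (simp_all add: le cl A.wedge_le1 A.wedge_le2)
    ultimately show ?thesis using xy by (intro B.le_antisym) (simp_all add: cl)
  qed
  moreover have "h (vee A x y) = vee B (h x) (h y)" if xy: "x \<in> carrier A" "y \<in> carrier A" for x y
  proof -
    obtain z where z: "z \<in> carrier A" "h z = vee B (h x) (h y)" using surj cl xy by metis
    have "mtl_le A x z" "mtl_le A y z"
      using z xy le B.le_vee1 B.le_vee2 hB by metis+
    then have "mtl_le B (h (vee A x y)) (vee B (h x) (h y))"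
      using z xy le cl A.vee_le by metis
    moreover have "mtl_le B (vee B (h x) (h y)) (h (vee A x y))"
      using xy by (intro B.vee_le) (simp_all add: le cl A.le_vee1 A.le_vee2)
    ultimately show ?thesis using xy by (intro B.le_antisym) (simp_all add: cl)
  qed
  moreover have "h (impl A x y) = impl B (h x) (h y)" if xy: "x \<in> carrier A" "y \<in> carrier A" for x y
  proof -
    \<comment> \<open>Both candidates for the residual have the same elements below them, which pins
      them down.\<close>
    have iff: "mtl_le B (h z) (impl B (h x) (h y)) \<longleftrightarrow> mtl_le B (h z) (h (impl A x y))"
      if z: "z \<in> carrier A" for z
      using xy z by (simp add: B.residuation[symmetric] A.residuation[symmetric] cl le mult[symmetric])
    obtain z where z: "z \<in> carrier A" "h z = impl B (h x) (h y)" using surj cl xy by metis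
    show ?thesis
      using iff[OF z(1)] iff[OF A.impl_closed[OF xy]] z xy B.le_refl
      by (intro B.le_antisym) (simp_all add: cl)
  qed
  ultimately show ?thesis using mult hB by (auto simp: mtl_hom_def)
qed

section \<open>Identities\<close>

lemma term_val_closed:
  assumes "mtl_algebra A" "range v \<subseteq> carrier A"
  shows "term_val A v t \<in> carrier A"
proof -
  interpret mtl_algebra A by fact
  show ?thesis using assms(2)
    by (induction t) (auto simp: wedge_closed vee_closed impl_closed falsum_closed)
qed

lemma term_val_hom:
  assumes A: "mtl_algebra A" and h: "h \<in> mtl_hom A B" and v: "range v \<subseteq> carrier A"
  shows "term_val B (h \<circ> v) t = h (term_val A v t)"
  by (induction t) (simp_all add: mtl_homD[OF h] term_val_closed[OF A v])

text \<open>The two sides of an identity are compared after applying \<open>h\<close>. Since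
  \<open>A\<close> and \<open>B\<close> may have different types, this also carries identities
  between an algebra and its copies.\<close>

lemma mtl_models_of_inj_hom:
  assumes B: "B \<in> mtl_models E" and A: "mtl_algebra A"
    and h: "h \<in> mtl_hom A B" and inj: "inj_on h (carrier A)"
  shows "A \<in> mtl_models E"
proof -
  have "term_val A v s = term_val A v t" if st: "(s, t) \<in> E" and v: "range v \<subseteq> carrier A" for s t v
  proof -
    have "range (h \<circ> v) \<subseteq> carrier B" using v mtl_hom_closed[OF h] by auto
    then have "term_val B (h \<circ> v) s = term_val B (h \<circ> v) t" using B st by (auto simp: mtl_models_def)
    then show ?thesis
      using inj term_val_closed[OF A v] by (simp add: term_val_hom[OF A h v] inj_on_eq_iff)
  qed
  then show ?thesis using A by (auto simp: mtl_models_def)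
qed

lemma mtl_models_prod:
  assumes "\<And>i. i \<in> I \<Longrightarrow> B i \<in> mtl_models E"
  shows "mtl_prod I B \<in> mtl_models E"
proof -
  have alg: "mtl_algebra (mtl_prod I B)"
    using assms by (intro mtl_algebra_prod) (auto simp: mtl_models_def)
  have "term_val (mtl_prod I B) v s = term_val (mtl_prod I B) v t"
    if st: "(s, t) \<in> E" and v: "range v \<subseteq> carrier (mtl_prod I B)" for s t v
  proof -
    have "term_val (mtl_prod I B) v s i = term_val (mtl_prod I B) v t i" if i: "i \<in> I" for i
    proof -
      have "range (\<lambda>n. v n i) \<subseteq> carrier (B i)" using v i by (auto simp: PiE_iff subset_iff)
      then have "term_val (B i) (\<lambda>n. v n i) s = term_val (B i) (\<lambda>n. v n i) t"
        using assms[OF i] st by (auto simp: mtl_models_def)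
      then show ?thesis
        using term_val_hom[OF alg mtl_hom_proj[OF i] v] by (simp add: comp_def)
    qed
    moreover have "term_val (mtl_prod I B) v s \<in> carrier (mtl_prod I B)"
      "term_val (mtl_prod I B) v t \<in> carrier (mtl_prod I B)"
      using term_val_closed[OF alg v] by auto
    ultimately show ?thesis unfolding mtl_prod_simps by (blast intro: PiE_ext)
  qed
  then show ?thesis using alg by (auto simp: mtl_models_def)
qed

section \<open>Finite DP-chains\<close>

text \<open>The DP-chain \<open>0 < \<dots> < n < n + 1\<close>, with coatom \<open>n\<close>; it is dual to the chain with
  \<open>n + 1\<close> elements, whose downsets are the initial segments of length \<open>0, \<dots>, n + 1\<close>.\<close>

definition std_dp :: "nat \<Rightarrow> nat mtl" where
  "std_dp n = \<lparr>carrier = {..Suc n},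
    monoid.mult = (\<lambda>x y. if x = Suc n then y else if y = Suc n then x else 0), one = Suc n,
    wedge = min, vee = max,
    impl = (\<lambda>x y. if x \<le> y then Suc n else if x = Suc n then y else n), falsum = 0\<rparr>"

lemma std_dp_simps [simp]:
  "carrier (std_dp n) = {..Suc n}"
  "x \<otimes>\<^bsub>std_dp n\<^esub> y = (if x = Suc n then y else if y = Suc n then x else 0)"
  "\<one>\<^bsub>std_dp n\<^esub> = Suc n" "wedge (std_dp n) = min" "vee (std_dp n) = max"
  "impl (std_dp n) x y = (if x \<le> y then Suc n else if x = Suc n then y else n)"
  "falsum (std_dp n) = 0"
  by (simp_all add: std_dp_def)

lemma mtl_le_std_dp [simp]: "mtl_le (std_dp n) x y \<longleftrightarrow> x \<le> y"
  by (auto simp: mtl_le_def min_def)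

lemma mtl_algebra_std_dp: "mtl_algebra (std_dp n)"
  by unfold_locales (auto simp: min_def max_def)

lemma dp_chain_image_std_dp:
  assumes inj: "inj_on f {..Suc n}"
  shows "dp_chain (mtl_image f (std_dp n))"
proof -
  have inj': "inj_on f (carrier (std_dp n))" using inj by simp
  have eq: "f x = f y \<longleftrightarrow> x = y" if "x \<le> Suc n" "y \<le> Suc n" for x y
    using inj that by (auto simp: inj_on_def)
  have g: "inv_into {..Suc n} f (f x) = x" if "x \<le> Suc n" for x
    using inv_into_f_f[OF inj, of x] that by simp
  show ?thesis
    unfolding dp_chain_def mtl_chain_def
    using mtl_algebra_image[OF mtl_algebra_std_dp inj'] by (auto simp: mtl_le_def eq g min_def)
qed

text \<open>The chain \<open>std_dp n\<close> lives on numbers and so is not itself among the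
  generators of type \<open>'b\<close>. An injection \<open>e\<close> copies it there; equations
  valid in all DP-chains of type \<open>'b\<close> thus return to \<open>std_dp n\<close>, pass to
  the product and reach the image.\<close>

lemma dp_algebra_image_prod:
  fixes f :: "('i \<Rightarrow> nat) \<Rightarrow> 'b::infinite"
  assumes inj: "inj_on f (carrier (mtl_prod I (\<lambda>i. std_dp (m i))))"
  shows "dp_algebra (mtl_image f (mtl_prod I (\<lambda>i. std_dp (m i))))"
proof -
  obtain e :: "nat \<Rightarrow> 'b" where e: "inj e" using arb_countable_map[of "{}"] by auto
  let ?P = "mtl_prod I (\<lambda>i. std_dp (m i))"
  have P: "mtl_algebra ?P" by (rule mtl_algebra_prod) (rule mtl_algebra_std_dp)
  have "mtl_image f ?P \<in> mtl_models E" if E: "{B :: 'b mtl. dp_chain B} \<subseteq> mtl_models E" for E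
  proof -
    have "std_dp n \<in> mtl_models E" for n
    proof (rule mtl_models_of_inj_hom)
      have i: "inj_on e (carrier (std_dp n))" using e by (rule inj_on_subset) simp
      show "mtl_image e (std_dp n) \<in> mtl_models E"
        using E dp_chain_image_std_dp[of e n] i by auto
      show "e \<in> mtl_hom (std_dp n) (mtl_image e (std_dp n))" using i by (rule mtl_hom_image)
      show "inj_on e (carrier (std_dp n))" by (rule i)
    qed (rule mtl_algebra_std_dp)
    then have P_models: "?P \<in> mtl_models E" by (intro mtl_models_prod)
    have bij: "bij_betw f (carrier ?P) (carrier (mtl_image f ?P))"
      using inj by (simp add: bij_betw_def)
    show ?thesis
    proof (rule mtl_models_of_inj_hom[OF P_models])
      show "mtl_algebra (mtl_image f ?P)" using P inj by (rule mtl_algebra_image)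
      show "inv_into (carrier ?P) f \<in> mtl_hom (mtl_image f ?P) ?P"
        using P mtl_hom_image[OF inj] bij by (rule mtl_hom_inv_into)
      show "inj_on (inv_into (carrier ?P) f) (carrier (mtl_image f ?P))"
        using bij_betw_inv_into[OF bij] by (simp only: bij_betw_def)
    qed
  qed
  then show ?thesis unfolding dp_algebra_def variety_generated_def by blast
qed

text \<open>Order-theoretic form of the homomorphisms from \<open>std_dp m\<close> to
  \<open>std_dp n\<close>. For \<open>m = 0\<close> the coatom of the source is its bottom element,
  which goes to 0; hence the proviso in the last clause.\<close>

definition coatom_embedding :: "nat \<Rightarrow> nat \<Rightarrow> (nat \<Rightarrow> nat) \<Rightarrow> bool" where
  "coatom_embedding m n k \<longleftrightarrow> k 0 = 0 \<and> k (Suc m) = Suc n \<and>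
    (\<forall>c c'. c < c' \<longrightarrow> c' \<le> Suc m \<longrightarrow> k c < k c') \<and> (m \<noteq> 0 \<longrightarrow> k m = n)"

text \<open>Implications from the top return their second argument; all others are the top or the
  coatom. Fixing top and coatom therefore takes care of \<open>impl\<close>.\<close>

lemma mtl_hom_of_coatom_embedding:
  assumes k: "coatom_embedding m n k"
  shows "k \<in> mtl_hom (std_dp m) (std_dp n)"
proof -
  have k0: "k 0 = 0" and k1: "k (Suc m) = Suc n" and km: "m \<noteq> 0 \<Longrightarrow> k m = n"
    and mono: "\<And>c c'. c < c' \<Longrightarrow> c' \<le> Suc m \<Longrightarrow> k c < k c'"
    using k by (auto simp: coatom_embedding_def)
  have le: "k c \<le> k c' \<longleftrightarrow> c \<le> c'" if "c \<le> Suc m" "c' \<le> Suc m" for c c'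
    using mono[of c c'] mono[of c' c] that by (cases c c' rule: linorder_cases) auto
  have top: "k c = Suc n \<longleftrightarrow> c = Suc m" if "c \<le> Suc m" for c
    using mono[of c "Suc m"] that k1 by (cases "c = Suc m") auto
  have "k c \<le> Suc n" if "c \<le> Suc m" for c using le[of c "Suc m"] that k1 by simp
  then show ?thesis
    unfolding mtl_hom_def using k0 k1 km le top
    by (auto simp: min_def max_def)
qed

lemma coatom_embedding_of_mtl_hom:
  assumes k: "k \<in> mtl_hom (std_dp m) (std_dp n)"
  shows "coatom_embedding m n k"
proof -
  note h = mtl_homD[OF k, simplified]
  have le: "k c \<le> Suc n" if "c \<le> Suc m" for c using mtl_hom_closed[OF k, of c] that by simp
  \<comment> \<open>Below the top every square is 0, whereas the top is its own square; so nothing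
    but the top can be mapped to the top.\<close>
  have top: "c = Suc m" if "c \<le> Suc m" "k c = Suc n" for c
  proof (rule ccontr)
    assume "c \<noteq> Suc m"
    then have "k (c \<otimes>\<^bsub>std_dp m\<^esub> c) = 0" using h(2) by simp
    moreover have "k (c \<otimes>\<^bsub>std_dp m\<^esub> c) = Suc n"
      using mtl_homD(3)[OF k, of c c] that by simp
    ultimately show False by simp
  qed
  have mono: "k c < k c'" if c: "c < c'" "c' \<le> Suc m" for c c'
  proof (cases "c' = Suc m")
    case True
    then show ?thesis using top[of c] le[of c] c h(1) by fastforce
  next
    case False
    \<comment> \<open>Strictness is read off from implication: \<open>c'\<close> is not below
      \<open>c\<close>, so the implication is not the top, and neither is its image.\<close>
    have "k (impl (std_dp m) c' c) \<noteq> Suc n"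
      using top[of m] False c by auto
    then have "impl (std_dp n) (k c') (k c) \<noteq> Suc n"
      using mtl_homD(6)[OF k, of c' c] c by simp
    then show ?thesis by (simp split: if_splits)
  qed
  \<comment> \<open>For \<open>m \<noteq> 0\<close> the coatom is its own negation. Its image is
    neither bottom nor top, and the negation of such an element is the coatom
    \<open>n\<close>.\<close>
  have "k m = n" if "m \<noteq> 0"
  proof -
    have "0 < k m" using mono[of 0 m] h(2) that by simp
    moreover have "k m \<noteq> Suc n" using top[of m] by auto
    moreover have "k (impl (std_dp m) m 0) = impl (std_dp n) (k m) (k 0)"
      using mtl_homD(6)[OF k, of m 0] by simp
    ultimately show ?thesis using that h(2) by (simp split: if_splits)
  qed
  then show ?thesis using h mono by (simp add: coatom_embedding_def)
qed

text \<open>The action on downsets of the preimage under \<open>u\<close>.\<close>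

definition preimage_map :: "nat \<Rightarrow> (nat \<rightharpoonup> nat) \<Rightarrow> nat \<Rightarrow> nat" where
  "preimage_map n u c = card {x. x \<le> n \<and> the (u x) < c}"

lemma initial_segment_eq:
  fixes S :: "nat set"
  assumes fin: "finite S" and down: "\<And>x y. y \<in> S \<Longrightarrow> x \<le> y \<Longrightarrow> x \<in> S"
  shows "S = {..<card S}"
proof (cases "S = {}")
  case False
  then have "S = {..Max S}" using fin down[OF Max_in[OF fin False]] by (auto intro: Max_ge)
  then have "S = {..<Suc (Max S)}" by (simp add: lessThan_Suc_atMost)
  then show ?thesis by (metis card_lessThan)
qed simp

text \<open>The elements with value below \<open>c\<close> form an initial segment, so membership in
  it is comparison with its size. Negated, this is an adjunction: \<open>preimage_map n u\<close> is
  left adjoint to \<open>u\<close>.\<close>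

lemma preimage_map_galois:
  assumes u: "u \<in> Hom Nat_top n m" and x: "u x = Some a"
  shows "x < preimage_map n u c \<longleftrightarrow> a < c"
proof -
  note uD = Nat_top_HomD[OF u]
  let ?S = "{x. x \<le> n \<and> the (u x) < c}"
  have "?S = {..<card ?S}"
  proof (rule initial_segment_eq)
    fix y z assume y: "y \<in> ?S" and z: "z \<le> y"
    then obtain b d where "u y = Some b" "u z = Some d" using uD(1)[of y] uD(1)[of z] by fastforce
    then show "z \<in> ?S" using y z uD(5)[of z y d b] by auto
  qed simp
  then have "x < preimage_map n u c \<longleftrightarrow> x \<in> ?S" unfolding preimage_map_def by blast
  then show ?thesis using x uD(2)[OF x] by simp
qed

lemma preimage_map_le: "preimage_map n u c \<le> Suc n"
proof -
  have "card {x. x \<le> n \<and> the (u x) < c} \<le> card {..n}" by (rule card_mono) auto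
  then show ?thesis by (simp add: preimage_map_def)
qed

lemma preimage_map_eqI:
  assumes "k \<le> Suc n" "\<And>x. x \<le> n \<Longrightarrow> x < k \<longleftrightarrow> the (u x) < c"
  shows "preimage_map n u c = k"
proof -
  have "x \<le> n \<and> the (u x) < c \<longleftrightarrow> x < k" for x using assms(1) assms(2)[of x] by (cases "x \<le> n") auto
  then have "{x. x \<le> n \<and> the (u x) < c} = {..<k}" by blast
  then show ?thesis by (simp add: preimage_map_def)
qed

text \<open>Surjectivity gives strictness: a preimage of \<open>c\<close> lies in the segment for
  \<open>c'\<close> but not in the one for \<open>c\<close>. The condition on the maximum gives the
  coatom clause.\<close>

lemma coatom_embedding_preimage_map:
  assumes u: "u \<in> Hom Nat_top n m"
  shows "coatom_embedding m n (preimage_map n u)"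
  unfolding coatom_embedding_def
proof (intro conjI allI impI)
  note uD = Nat_top_HomD[OF u]
  have ux: "\<exists>a. a \<le> m \<and> u x = Some a" if "x \<le> n" for x using uD(1)[OF that] .
  show "preimage_map n u 0 = 0" by (simp add: preimage_map_def)
  show "preimage_map n u (Suc m) = Suc n"
    by (rule preimage_map_eqI) (use ux in fastforce)+
  show "preimage_map n u m = n" if "m \<noteq> 0"
  proof (rule preimage_map_eqI)
    fix x assume "x \<le> n"
    then obtain a where a: "a \<le> m" "u x = Some a" using ux by blast
    have "a = m \<longleftrightarrow> x = n" using uD(6)[OF that, of x] a by simp
    then show "x < n \<longleftrightarrow> the (u x) < m" using a \<open>x \<le> n\<close> by auto
  qed simp
  fix c c' :: nat assume c: "c < c'" "c' \<le> Suc m"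
  then obtain x where x: "u x = Some c" using uD(4)[of c] by auto
  show "preimage_map n u c < preimage_map n u c'"
    using preimage_map_galois[OF u x, of c] preimage_map_galois[OF u x, of c'] c by simp
qed

text \<open>The required arrow is the right adjoint of \<open>k\<close>. It is onto because
  \<open>k\<close> is strictly increasing, and it meets the condition on the maximum because
  \<open>k\<close> preserves the coatom.\<close>

lemma preimage_map_surj:
  assumes k: "coatom_embedding m n k"
  shows "\<exists>u \<in> Hom Nat_top n m. \<forall>c \<le> Suc m. preimage_map n u c = k c"
proof -
  have k0: "k 0 = 0" and k1: "k (Suc m) = Suc n" and km: "m \<noteq> 0 \<Longrightarrow> k m = n"
    and mono: "\<And>c c'. c < c' \<Longrightarrow> c' \<le> Suc m \<Longrightarrow> k c < k c'"
    using k by (auto simp: coatom_embedding_def)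
  have mono': "k c \<le> k c' \<longleftrightarrow> c \<le> c'" if "c \<le> Suc m" "c' \<le> Suc m" for c c'
    using mono[of c c'] mono[of c' c] that by (cases c c' rule: linorder_cases) auto
  \<comment> \<open>The largest \<open>c\<close> with \<open>k c \<le> x\<close>; it exists because
    \<open>k 0 = 0\<close>. The bound \<open>c \<le> m\<close> leaves out \<open>Suc m\<close>,
    whose value \<open>Suc n\<close> exceeds every admissible \<open>x\<close>.\<close>
  define w where "w x = Max {c. c \<le> m \<and> k c \<le> x}" for x
  define u where "u x = (if x \<le> n then Some (w x) else None)" for x
  have w: "w x \<le> m" "k (w x) \<le> x" for x
  proof -
    have "w x \<in> {c. c \<le> m \<and> k c \<le> x}" unfolding w_def by (rule Max_in) (auto intro: exI[of _ 0] simp: k0)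
    then show "w x \<le> m" "k (w x) \<le> x" by auto
  qed
  have w_ge: "c \<le> w x" if "c \<le> m" "k c \<le> x" for c x
    unfolding w_def using that by (intro Max_ge) auto
  have galois: "w x < c \<longleftrightarrow> x < k c" if x: "x \<le> n" and c: "c \<le> Suc m" for x c
  proof
    assume "w x < c"
    then show "x < k c" using w_ge[of c x] c x k1 by (cases "c = Suc m") (auto simp: not_less[symmetric])
  next
    assume "x < k c"
    then have "\<not> k c \<le> k (w x)" using w(2)[of x] by simp
    then show "w x < c" using mono'[of c "w x"] w(1)[of x] c by simp
  qed
  have wk: "w (k c) = c" if "c \<le> m" for c
  proof -
    have "k (w (k c)) \<le> k c" using w(2) .
    then show ?thesis using mono'[of "w (k c)" c] w_ge[of c "k c"] w(1)[of "k c"] that by simp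
  qed
  have kn: "k c \<le> n" if "c \<le> m" for c using mono[of c "Suc m"] that k1 by simp
  have "u \<in> Hom Nat_top n m"
    unfolding Nat_top_Hom_iff
  proof (intro conjI allI impI)
    show "dom u = {..n}" by (auto simp: u_def dom_def)
    show "ran u = {..m}"
    proof (intro equalityI subsetI)
      fix c assume "c \<in> {..m}"
      then have "u (k c) = Some c" using wk kn by (simp add: u_def)
      then show "c \<in> ran u" by (rule ranI)
    qed (auto simp: ran_def u_def w(1) split: if_splits)
    fix x y a b assume "x \<le> y" "u x = Some a" "u y = Some b"
    then show "a \<le> b" using w_ge[of "w x" y] w[of x] by (auto simp: u_def split: if_splits)
  next
    fix x assume m: "m \<noteq> 0"
    \<comment> \<open>The value \<open>m\<close> is attained exactly from \<open>k m = n\<close>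
      onwards, that is, only at the maximum of the source.\<close>
    have "w x = m \<longleftrightarrow> n \<le> x" using w[of x] w_ge[of m x] km[OF m] by auto
    then show "u x = Some m \<longleftrightarrow> x = n" by (auto simp: u_def)
  qed
  moreover have "preimage_map n u c = k c" if c: "c \<le> Suc m" for c
  proof (rule preimage_map_eqI)
    show "k c \<le> Suc n" using mono'[of c "Suc m"] c k1 by simp
    show "x < k c \<longleftrightarrow> the (u x) < c" if "x \<le> n" for x using galois[OF that c] that by (simp add: u_def)
  qed
  ultimately show ?thesis by blast
qed

text \<open>A value \<open>a\<close> is recovered from the set of those \<open>c\<close> that exceed
  it; the tests \<open>Suc a\<close> and \<open>Suc b\<close> suffice to identify \<open>a\<close>
  and \<open>b\<close>.\<close>

lemma preimage_map_inj:
  assumes u: "u \<in> Hom Nat_top n m" and v: "v \<in> Hom Nat_top n m"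
    and eq: "\<And>c. c \<le> Suc m \<Longrightarrow> preimage_map n u c = preimage_map n v c"
  shows "u = v"
proof
  fix x show "u x = v x"
  proof (cases "x \<le> n")
    case True
    obtain a b where a: "a \<le> m" "u x = Some a" and b: "b \<le> m" "v x = Some b"
      using Nat_top_HomD(1)[OF u True] Nat_top_HomD(1)[OF v True] by blast
    have "a < c \<longleftrightarrow> b < c" if "c \<le> Suc m" for c
      using preimage_map_galois[OF u a(2), of c] preimage_map_galois[OF v b(2), of c] eq[OF that] by simp
    from this[of "Suc a"] this[of "Suc b"] show ?thesis using a b by simp
  next
    case False
    then show ?thesis using Nat_top_HomD(2)[OF u] Nat_top_HomD(2)[OF v] by (metis not_None_eq)
  qed
qed

text \<open>Left adjoints compose in the reverse order, so passing to preimages is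
  contravariant.\<close>

lemma preimage_map_comp:
  assumes u: "u \<in> Hom Nat_top n m" and v: "v \<in> Hom Nat_top m l"
  shows "preimage_map n (v \<circ>\<^sub>m u) c = preimage_map n u (preimage_map m v c)"
proof (rule preimage_map_eqI[OF preimage_map_le])
  fix x assume "x \<le> n"
  then obtain a where a: "a \<le> m" "u x = Some a" using Nat_top_HomD(1)[OF u] by blast
  obtain b where b: "v a = Some b" using Nat_top_HomD(1)[OF v a(1)] by blast
  show "x < preimage_map n u (preimage_map m v c) \<longleftrightarrow> the ((v \<circ>\<^sub>m u) x) < c"
    using a b preimage_map_galois[OF u a(2)] preimage_map_galois[OF v b] by simp
qed

lemma preimage_map_id: "c \<le> Suc n \<Longrightarrow> preimage_map n (Some |` {..<Suc n}) c = c"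
  by (rule preimage_map_eqI) auto

text \<open>A chain has only the trivial idempotents, so exactly one of the idempotents that split the
  product is mapped to the top.\<close>

lemma mtl_hom_prod_to_chain:
  assumes fin: "finite I" and H: "H \<in> mtl_hom (mtl_prod I (\<lambda>i. std_dp (m i))) (std_dp n)"
  shows "\<exists>j\<in>I. \<exists>k. k \<in> mtl_hom (std_dp (m j)) (std_dp n) \<and>
    (\<forall>d \<in> carrier (mtl_prod I (\<lambda>i. std_dp (m i))). H d = k (d j))"
proof -
  let ?P = "mtl_prod I (\<lambda>i. std_dp (m i))"
  \<comment> \<open>Characteristic functions with top and bottom as values; all of them are
    idempotent.\<close>
  define \<chi> where "\<chi> S = (\<lambda>i\<in>I. if i \<in> S then Suc (m i) else 0)" for S
  have \<chi>_in: "\<chi> S \<in> carrier ?P" for S unfolding \<chi>_def by (rule restrict_in_mtl_prod) simp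
  note HD = mtl_homD[OF H] and Hcl = mtl_hom_closed[OF H]
  have "\<exists>j\<in>I. H (\<chi> {j}) = Suc n"
  proof (rule ccontr)
    assume no: "\<not> ?thesis"
    \<comment> \<open>The image is an idempotent of a chain, hence 0 or the top, and the top is
      excluded by assumption.\<close>
    have zero: "H (\<chi> {j}) = 0" if "j \<in> I" for j
    proof -
      have "\<chi> {j} \<otimes>\<^bsub>?P\<^esub> \<chi> {j} = \<chi> {j}"
        unfolding mtl_prod_simps(2) by (subst restrict_eq_in_prod[OF \<chi>_in]) (auto simp: \<chi>_def)
      then have "H (\<chi> {j}) = H (\<chi> {j}) \<otimes>\<^bsub>std_dp n\<^esub> H (\<chi> {j})" using HD(3)[OF \<chi>_in \<chi>_in] by metis
      then show ?thesis using no that by (auto split: if_splits)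
    qed
    have "H (\<chi> S) = 0" if "finite S" "S \<subseteq> I" for S
      using that
    proof (induction rule: finite_induct)
      case empty
      have "\<chi> {} = falsum ?P" by (simp add: \<chi>_def)
      then show ?case using HD(2) by (metis std_dp_simps(7))
    next
      case (insert j S)
      have "\<chi> (insert j S) = vee ?P (\<chi> {j}) (\<chi> S)"
        unfolding mtl_prod_simps(5) by (rule sym, subst restrict_eq_in_prod[OF \<chi>_in]) (auto simp: \<chi>_def)
      then have "H (\<chi> (insert j S)) = vee (std_dp n) (H (\<chi> {j})) (H (\<chi> S))"
        using HD(5)[OF \<chi>_in \<chi>_in] by metis
      then show ?case using zero[of j] insert by simp
    qed
    \<comment> \<open>The join over all of \<open>I\<close> is the unit, which cannot go to 0. This
      also rules out an empty \<open>I\<close>: the trivial algebra has no homomorphism to a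
      nontrivial chain.\<close>
    from this[OF fin subset_refl] have "H (\<chi> I) = 0" .
    moreover have "\<chi> I = \<one>\<^bsub>?P\<^esub>" by (auto simp: \<chi>_def intro!: restrict_ext)
    ultimately show False using HD(1) by (metis std_dp_simps(3) nat.distinct(1))
  qed
  then obtain j where j: "j \<in> I" "H (\<chi> {j}) = Suc n" by blast
  define \<delta> where "\<delta> x = (\<lambda>i\<in>I. if i = j then x else 0)" for x :: nat
  have \<delta>_in: "\<delta> x \<in> carrier ?P" if "x \<le> Suc (m j)" for x
    unfolding \<delta>_def using that by (intro restrict_in_mtl_prod) simp
  have \<delta>_j: "\<delta> x j = x" for x using j by (simp add: \<delta>_def)
  \<comment> \<open>Multiplying by \<open>\<chi> {j}\<close> erases all coordinates but the one at
    \<open>j\<close>, and leaves the image unchanged since \<open>\<chi> {j}\<close> goes to the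
    top.\<close>
  have Hd: "H d = H (\<delta> (d j))" if d: "d \<in> carrier ?P" for d
  proof -
    have dj: "d j \<le> Suc (m j)" using mtl_prod_memD[OF d j(1)] by simp
    have "d \<otimes>\<^bsub>?P\<^esub> \<chi> {j} = \<delta> (d j)"
      unfolding mtl_prod_simps(2)
      by (subst restrict_eq_in_prod[OF \<delta>_in[OF dj]]) (auto simp: \<chi>_def \<delta>_def)
    then have "H (\<delta> (d j)) = H d \<otimes>\<^bsub>std_dp n\<^esub> H (\<chi> {j})" using HD(3)[OF d \<chi>_in] by metis
    then show ?thesis using j(2) by simp
  qed
  interpret P: mtl_algebra ?P by (rule mtl_algebra_prod) (rule mtl_algebra_std_dp)
  have "(\<lambda>x. H (\<delta> x)) \<in> mtl_hom (std_dp (m j)) (std_dp n)"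
    unfolding mtl_hom_def
  proof (intro CollectI conjI ballI)
    show "(\<lambda>x. H (\<delta> x)) \<in> carrier (std_dp (m j)) \<rightarrow> carrier (std_dp n)"
      using Hcl \<delta>_in by fastforce
    show "H (\<delta> \<one>\<^bsub>std_dp (m j)\<^esub>) = \<one>\<^bsub>std_dp n\<^esub>"
      using Hd[OF P.one_closed] HD(1) j(1) by simp
    show "H (\<delta> (falsum (std_dp (m j)))) = falsum (std_dp n)"
      using Hd[OF P.falsum_closed] HD(2) j(1) by simp
    fix x y assume "x \<in> carrier (std_dp (m j))" "y \<in> carrier (std_dp (m j))"
    then have x: "\<delta> x \<in> carrier ?P" and y: "\<delta> y \<in> carrier ?P" using \<delta>_in by simp_all
    have at_j: "(\<delta> x \<otimes>\<^bsub>?P\<^esub> \<delta> y) j = x \<otimes>\<^bsub>std_dp (m j)\<^esub> y"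
      "wedge ?P (\<delta> x) (\<delta> y) j = wedge (std_dp (m j)) x y"
      "vee ?P (\<delta> x) (\<delta> y) j = vee (std_dp (m j)) x y"
      "impl ?P (\<delta> x) (\<delta> y) j = impl (std_dp (m j)) x y"
      using j(1) by (simp_all add: \<delta>_j)
    show "H (\<delta> (x \<otimes>\<^bsub>std_dp (m j)\<^esub> y)) = H (\<delta> x) \<otimes>\<^bsub>std_dp n\<^esub> H (\<delta> y)"
      using Hd[OF P.m_closed[OF x y]] HD(3)[OF x y] at_j(1) by metis
    show "H (\<delta> (wedge (std_dp (m j)) x y)) = wedge (std_dp n) (H (\<delta> x)) (H (\<delta> y))"
      using Hd[OF P.wedge_closed[OF x y]] HD(4)[OF x y] at_j(2) by metis
    show "H (\<delta> (vee (std_dp (m j)) x y)) = vee (std_dp n) (H (\<delta> x)) (H (\<delta> y))"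
      using Hd[OF P.vee_closed[OF x y]] HD(5)[OF x y] at_j(3) by metis
    show "H (\<delta> (impl (std_dp (m j)) x y)) = impl (std_dp n) (H (\<delta> x)) (H (\<delta> y))"
      using Hd[OF P.impl_closed[OF x y]] HD(6)[OF x y] at_j(4) by metis
  qed
  with j(1) Hd show ?thesis by (intro bexI[of _ j] exI[of _ "\<lambda>x. H (\<delta> x)"]) auto
qed

section \<open>Finite DP-algebras are products of DP-chains\<close>

text \<open>The models of the single equation form one of the equational classes whose intersection
  is the variety.\<close>

lemma dp_algebra_identity:
  fixes A :: "('a::infinite) mtl"
  assumes A: "dp_algebra A"
    and chains: "\<And>(B :: 'a mtl) v. dp_chain B \<Longrightarrow> range v \<subseteq> carrier B \<Longrightarrow> term_val B v s = term_val B v t"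
    and v: "range v \<subseteq> carrier A"
  shows "term_val A v s = term_val A v t"
proof -
  have "{B :: 'a mtl. dp_chain B} \<subseteq> mtl_models {(s, t)}"
    using chains by (auto simp: mtl_models_def dp_chain_def mtl_chain_def)
  then have "A \<in> mtl_models {(s, t)}"
    using A unfolding dp_algebra_def variety_generated_def by blast
  then show ?thesis using v by (auto simp: mtl_models_def)
qed

text \<open>All that the decomposition takes from the variety. On an idempotent,
  \<open>vee_neg_square\<close> makes the negation a complement and \<open>wedge_square\<close>
  turns products into meets; \<open>square_idem\<close> supplies idempotents, and
  \<open>square_prelinear\<close> decides comparisons below an atom.\<close>

locale finite_dp = mtl_algebra +
  assumes fin: "finite (carrier A)"
    and vee_neg_square: "x \<in> carrier A \<Longrightarrow> vee A x (impl A (x \<otimes>\<^bsub>A\<^esub> x) (falsum A)) = \<one>\<^bsub>A\<^esub>"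
    and square_idem: "x \<in> carrier A \<Longrightarrow> (x \<otimes>\<^bsub>A\<^esub> x) \<otimes>\<^bsub>A\<^esub> (x \<otimes>\<^bsub>A\<^esub> x) = x \<otimes>\<^bsub>A\<^esub> x"
    and square_prelinear: "\<lbrakk>x \<in> carrier A; y \<in> carrier A\<rbrakk> \<Longrightarrow>
      vee A (impl A x y \<otimes>\<^bsub>A\<^esub> impl A x y) (impl A y x \<otimes>\<^bsub>A\<^esub> impl A y x) = \<one>\<^bsub>A\<^esub>"
    and wedge_square: "\<lbrakk>x \<in> carrier A; y \<in> carrier A\<rbrakk> \<Longrightarrow>
      wedge A (x \<otimes>\<^bsub>A\<^esub> x) y = (x \<otimes>\<^bsub>A\<^esub> x) \<otimes>\<^bsub>A\<^esub> y"

text \<open>In a DP-chain a square is 1 or \<open>falsum\<close>, so each identity is a short case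
  distinction.\<close>

lemma dp_chain_identities:
  assumes "dp_chain B" and x: "x \<in> carrier B" and y: "y \<in> carrier B"
  shows "vee B x (impl B (x \<otimes>\<^bsub>B\<^esub> x) (falsum B)) = \<one>\<^bsub>B\<^esub>"
    "(x \<otimes>\<^bsub>B\<^esub> x) \<otimes>\<^bsub>B\<^esub> (x \<otimes>\<^bsub>B\<^esub> x) = x \<otimes>\<^bsub>B\<^esub> x"
    "vee B (impl B x y \<otimes>\<^bsub>B\<^esub> impl B x y) (impl B y x \<otimes>\<^bsub>B\<^esub> impl B y x) = \<one>\<^bsub>B\<^esub>"
    "wedge B (x \<otimes>\<^bsub>B\<^esub> x) y = (x \<otimes>\<^bsub>B\<^esub> x) \<otimes>\<^bsub>B\<^esub> y"
proof -
  interpret mtl_algebra B using assms(1) by (simp add: dp_chain_def mtl_chain_def)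
  have sq: "z \<otimes>\<^bsub>B\<^esub> z = (if z = \<one>\<^bsub>B\<^esub> then \<one>\<^bsub>B\<^esub> else falsum B)" if "z \<in> carrier B" for z
    using assms(1) that by (auto simp: dp_chain_def)
  have top: "vee B z \<one>\<^bsub>B\<^esub> = \<one>\<^bsub>B\<^esub>" "vee B \<one>\<^bsub>B\<^esub> z = \<one>\<^bsub>B\<^esub>" if "z \<in> carrier B" for z
    using le_iff_vee[OF that one_closed] integral[OF that] vee_commute[OF that one_closed] by simp_all
  have impl_one: "impl B z w = \<one>\<^bsub>B\<^esub>" if "mtl_le B z w" "z \<in> carrier B" "w \<in> carrier B" for z w
    using residuation[of z w "\<one>\<^bsub>B\<^esub>"] that integral impl_closed le_antisym by simp
  have falsum_mult: "falsum B \<otimes>\<^bsub>B\<^esub> z = falsum B" if "z \<in> carrier B" for z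
    using mult_falsum[OF that] m_comm[OF that falsum_closed] by simp
  show "vee B x (impl B (x \<otimes>\<^bsub>B\<^esub> x) (falsum B)) = \<one>\<^bsub>B\<^esub>"
    using x by (simp add: sq top impl_one le_refl falsum_closed impl_closed)
  show "(x \<otimes>\<^bsub>B\<^esub> x) \<otimes>\<^bsub>B\<^esub> (x \<otimes>\<^bsub>B\<^esub> x) = x \<otimes>\<^bsub>B\<^esub> x"
    using x by (simp add: sq falsum_mult falsum_closed)
  show "wedge B (x \<otimes>\<^bsub>B\<^esub> x) y = (x \<otimes>\<^bsub>B\<^esub> x) \<otimes>\<^bsub>B\<^esub> y"
    using x y integral[OF y] falsum_least[OF y] wedge_commute[of "\<one>\<^bsub>B\<^esub>" y]
    by (simp add: sq falsum_mult mtl_le_def)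
  have "mtl_le B x y \<or> mtl_le B y x" using assms(1) x y by (simp add: dp_chain_def mtl_chain_def)
  then have "impl B x y = \<one>\<^bsub>B\<^esub> \<or> impl B y x = \<one>\<^bsub>B\<^esub>" using impl_one x y by blast
  then show "vee B (impl B x y \<otimes>\<^bsub>B\<^esub> impl B x y) (impl B y x \<otimes>\<^bsub>B\<^esub> impl B y x) = \<one>\<^bsub>B\<^esub>"
    using x y by (auto simp: top impl_closed)
qed

lemma finite_dp_of_dp_algebra:
  fixes A :: "('a::infinite) mtl"
  assumes A: "dp_algebra A" and fin: "finite (carrier A)"
  shows "finite_dp A"
proof -
  \<comment> \<open>The empty set of equations defines the class of all MTL-algebras; this instance
    of the variety shows that \<open>A\<close> is one.\<close>
  have "{B :: 'a mtl. dp_chain B} \<subseteq> mtl_models {}"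
    by (auto simp: mtl_models_def dp_chain_def mtl_chain_def)
  then have "A \<in> mtl_models {}"
    using A unfolding dp_algebra_def variety_generated_def by blast
  then interpret mtl_algebra A by (simp add: mtl_models_def)
  let ?sq = "\<lambda>t. TMult t t" and ?x = "TVar 0" and ?y = "TVar 1"
  have id: "term_val A (\<lambda>n. if n = 0 then x else y) s = term_val A (\<lambda>n. if n = 0 then x else y) t"
    if "x \<in> carrier A" "y \<in> carrier A"
      "\<And>(B :: 'a mtl) v. dp_chain B \<Longrightarrow> range v \<subseteq> carrier B \<Longrightarrow> term_val B v s = term_val B v t" for x y s t
    using that by (intro dp_algebra_identity[OF A]) auto
  have v: "v 0 \<in> carrier B" "v (Suc 0) \<in> carrier B" if "range v \<subseteq> carrier B"
    for v :: "nat \<Rightarrow> 'a" and B :: "'a mtl" using that by auto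
  show ?thesis
  proof
    fix x y assume x: "x \<in> carrier A" and y: "y \<in> carrier A"
    have "term_val A (\<lambda>n. if n = 0 then x else y) (TVee ?x (TImpl (?sq ?x) TFalsum)) = term_val A (\<lambda>n. if n = 0 then x else y) (TOne)"
      by (rule id[OF x y]) (simp add: dp_chain_identities(1)[of B z z for B z] v)
    then show "vee A x (impl A (x \<otimes>\<^bsub>A\<^esub> x) (falsum A)) = \<one>\<^bsub>A\<^esub>" by simp
    have "term_val A (\<lambda>n. if n = 0 then x else y) (?sq (?sq ?x)) = term_val A (\<lambda>n. if n = 0 then x else y) (?sq ?x)"
      by (rule id[OF x y]) (simp add: dp_chain_identities(2)[of B z z for B z] v)
    then show "(x \<otimes>\<^bsub>A\<^esub> x) \<otimes>\<^bsub>A\<^esub> (x \<otimes>\<^bsub>A\<^esub> x) = x \<otimes>\<^bsub>A\<^esub> x" by simp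
    have "term_val A (\<lambda>n. if n = 0 then x else y) (TVee (?sq (TImpl ?x ?y)) (?sq (TImpl ?y ?x))) = term_val A (\<lambda>n. if n = 0 then x else y) (TOne)"
      by (rule id[OF x y]) (simp add: dp_chain_identities(3) v)
    then show "vee A (impl A x y \<otimes>\<^bsub>A\<^esub> impl A x y) (impl A y x \<otimes>\<^bsub>A\<^esub> impl A y x) = \<one>\<^bsub>A\<^esub>" by simp
    have "term_val A (\<lambda>n. if n = 0 then x else y) (TWedge (?sq ?x) ?y) = term_val A (\<lambda>n. if n = 0 then x else y) (TMult (?sq ?x) ?y)"
      by (rule id[OF x y]) (simp add: dp_chain_identities(4) v)
    then show "wedge A (x \<otimes>\<^bsub>A\<^esub> x) y = (x \<otimes>\<^bsub>A\<^esub> x) \<otimes>\<^bsub>A\<^esub> y" by simp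
  qed (rule fin)
qed

section \<open>Idempotents and their atoms\<close>

context finite_dp
begin

definition idem :: "'a \<Rightarrow> bool" where
  "idem e \<longleftrightarrow> e \<in> carrier A \<and> e \<otimes>\<^bsub>A\<^esub> e = e"

text \<open>Minimality is among idempotents: these are the atoms of the Boolean algebra of
  idempotents, and further elements of \<open>A\<close> may lie strictly between
  \<open>falsum\<close> and them.\<close>

definition atoms :: "'a set" where
  "atoms = {e. idem e \<and> e \<noteq> falsum A \<and> (\<forall>f. idem f \<longrightarrow> mtl_le A f e \<longrightarrow> f = falsum A \<or> f = e)}"

definition below :: "'a \<Rightarrow> 'a set" where
  "below e = {z \<in> carrier A. mtl_le A z e}"

text \<open>For an element below an atom this is its position in the chain under that atom, hence
  the coordinate in the standard chain.\<close>

definition rank :: "'a \<Rightarrow> nat" where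
  "rank w = card {z \<in> carrier A. mtl_le A z w \<and> z \<noteq> w}"

lemma idem_carrier: "idem e \<Longrightarrow> e \<in> carrier A"
  by (simp add: idem_def)

lemma idem_square: "x \<in> carrier A \<Longrightarrow> idem (x \<otimes>\<^bsub>A\<^esub> x)"
  by (simp add: idem_def square_idem)

lemma wedge_idem: "idem e \<Longrightarrow> x \<in> carrier A \<Longrightarrow> wedge A e x = e \<otimes>\<^bsub>A\<^esub> x"
  using wedge_square[of e x] by (simp add: idem_def)

lemma le_idem_iff: "idem e \<Longrightarrow> x \<in> carrier A \<Longrightarrow> mtl_le A x e \<longleftrightarrow> e \<otimes>\<^bsub>A\<^esub> x = x"
  using wedge_idem[of e x] wedge_commute[of e x] by (simp add: mtl_le_def idem_def)

lemma idem_mult: "idem e \<Longrightarrow> idem f \<Longrightarrow> idem (e \<otimes>\<^bsub>A\<^esub> f)"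
  unfolding idem_def by (simp add: m_ac) (metis m_assoc m_comm m_closed)

lemma vee_falsum: "x \<in> carrier A \<Longrightarrow> vee A (falsum A) x = x" "x \<in> carrier A \<Longrightarrow> vee A x (falsum A) = x"
  using le_iff_vee[OF falsum_closed, of x] falsum_least vee_commute[OF falsum_closed, of x] by simp_all

lemma le_falsum: "x \<in> carrier A \<Longrightarrow> mtl_le A x (falsum A) \<Longrightarrow> x = falsum A"
  using falsum_least le_antisym falsum_closed by blast

text \<open>The negation is a complement of \<open>e\<close>. Multiplying the join
  \<open>e \<or> b = 1\<close> by \<open>b\<close> and using that \<open>e\<close> annihilates
  \<open>b\<close> gives idempotence of \<open>b\<close>.\<close>

lemma idem_neg:
  assumes e: "idem e"
  shows "e \<otimes>\<^bsub>A\<^esub> impl A e (falsum A) = falsum A" "vee A e (impl A e (falsum A)) = \<one>\<^bsub>A\<^esub>"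
    "idem (impl A e (falsum A))"
proof -
  let ?b = "impl A e (falsum A)"
  have eA: "e \<in> carrier A" and b: "?b \<in> carrier A" and ee: "e \<otimes>\<^bsub>A\<^esub> e = e"
    using e impl_closed falsum_closed by (auto simp: idem_def)
  show eb: "e \<otimes>\<^bsub>A\<^esub> ?b = falsum A"
    using residuation[OF eA falsum_closed b] le_refl[OF b] le_falsum eA b by simp
  show j: "vee A e ?b = \<one>\<^bsub>A\<^esub>" using vee_neg_square[OF eA] ee by simp
  have "?b \<otimes>\<^bsub>A\<^esub> vee A e ?b = vee A (?b \<otimes>\<^bsub>A\<^esub> e) (?b \<otimes>\<^bsub>A\<^esub> ?b)"
    using mult_vee_distrib[OF b eA b] .
  then have "?b = ?b \<otimes>\<^bsub>A\<^esub> ?b" using j eb m_comm[OF b eA] b vee_falsum by simp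
  then show "idem ?b" using b by (simp add: idem_def)
qed

lemma atom_carrier: "e \<in> atoms \<Longrightarrow> e \<in> carrier A"
  by (simp add: atoms_def idem_def)

lemma atom_idem: "e \<in> atoms \<Longrightarrow> idem e"
  by (simp add: atoms_def)

lemma atom_minimal: "e \<in> atoms \<Longrightarrow> idem f \<Longrightarrow> mtl_le A f e \<Longrightarrow> f = falsum A \<or> f = e"
  by (simp add: atoms_def)

text \<open>By finiteness, among the nonzero idempotents below \<open>f\<close> there is one with
  the fewest elements under it; a smaller nonzero idempotent would have fewer.\<close>

lemma atom_below_exists:
  assumes f: "idem f" "f \<noteq> falsum A"
  shows "\<exists>e\<in>atoms. mtl_le A e f"
proof -
  let ?S = "\<lambda>g. idem g \<and> g \<noteq> falsum A \<and> mtl_le A g f"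
  have "?S f" using f le_refl by (simp add: idem_def)
  then obtain e where e: "?S e" and min: "\<And>g. ?S g \<Longrightarrow> card (below e) \<le> card (below g)"
    using ex_has_least_nat[of ?S f "\<lambda>g. card (below g)"] by blast
  have "g = falsum A \<or> g = e" if g: "idem g" "mtl_le A g e" for g
  proof (rule ccontr)
    assume ng: "\<not> ?thesis"
    have gf: "mtl_le A g f" using le_trans[of g e f] g e f by (simp add: idem_def)
    have "below g \<subset> below e"
    proof (rule psubsetI)
      show "below g \<subseteq> below e" using le_trans[of _ g e] g e by (auto simp: below_def idem_def)
      have "e \<in> below e" using e le_refl by (simp add: below_def idem_def)
      moreover have "e \<notin> below g" using ng g e le_antisym[of e g] by (auto simp: below_def idem_def)
      ultimately show "below g \<noteq> below e" by blast
    qed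
    then have "card (below g) < card (below e)" using fin by (intro psubset_card_mono) (simp_all add: below_def)
    then show False using min[of g] g gf ng by simp
  qed
  then show ?thesis using e by (auto simp: atoms_def)
qed

lemma atoms_mult_distinct:
  assumes e: "e \<in> atoms" and f: "f \<in> atoms" and ne: "e \<noteq> f"
  shows "e \<otimes>\<^bsub>A\<^esub> f = falsum A"
proof -
  have "idem (e \<otimes>\<^bsub>A\<^esub> f)" using idem_mult e f atom_idem by blast
  then show ?thesis
    using atom_minimal[OF e, of "e \<otimes>\<^bsub>A\<^esub> f"] atom_minimal[OF f, of "e \<otimes>\<^bsub>A\<^esub> f"] mult_le1 mult_le2
      atom_carrier e f ne by metis
qed

lemma atom_mult_idem:
  assumes e: "e \<in> atoms" and f: "idem f"
  shows "e \<otimes>\<^bsub>A\<^esub> f = falsum A \<or> e \<otimes>\<^bsub>A\<^esub> f = e"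
  using atom_minimal[OF e idem_mult[OF atom_idem[OF e] f]] mult_le1[OF atom_carrier[OF e] idem_carrier[OF f]]
  by blast

text \<open>The squares of the two implications are idempotents with join 1. Multiplied by
  \<open>e\<close>, each becomes \<open>falsum\<close> or \<open>e\<close>, and not both vanish. If
  the one for \<open>x\<close>, \<open>y\<close> survives, then \<open>e\<close> lies below
  \<open>impl A x y\<close>, and residuation gives the comparison.\<close>

lemma atom_mult_linear:
  assumes e: "e \<in> atoms" and x: "x \<in> carrier A" and y: "y \<in> carrier A"
  shows "mtl_le A (e \<otimes>\<^bsub>A\<^esub> x) (e \<otimes>\<^bsub>A\<^esub> y) \<or> mtl_le A (e \<otimes>\<^bsub>A\<^esub> y) (e \<otimes>\<^bsub>A\<^esub> x)"
proof -
  have eA: "e \<in> carrier A" using atom_carrier[OF e] .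
  have *: "mtl_le A (e \<otimes>\<^bsub>A\<^esub> p) (e \<otimes>\<^bsub>A\<^esub> q)"
    if p: "p \<in> carrier A" and q: "q \<in> carrier A"
      and a2: "e \<otimes>\<^bsub>A\<^esub> (impl A p q \<otimes>\<^bsub>A\<^esub> impl A p q) = e" for p q
  proof -
    let ?a = "impl A p q"
    have a: "?a \<in> carrier A" using p q impl_closed by simp
    have "mtl_le A e (?a \<otimes>\<^bsub>A\<^esub> ?a)" using mult_le2[OF eA, of "?a \<otimes>\<^bsub>A\<^esub> ?a"] a2 a by simp
    then have "mtl_le A e ?a" using le_trans[OF eA _ a _ mult_le1[OF a a]] a by simp
    then have "mtl_le A (e \<otimes>\<^bsub>A\<^esub> p) q" using residuation[OF p q eA] m_comm[OF p eA] by simp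
    then have "mtl_le A (e \<otimes>\<^bsub>A\<^esub> (e \<otimes>\<^bsub>A\<^esub> p)) (e \<otimes>\<^bsub>A\<^esub> q)" using mult_mono_right eA p q by simp
    then show ?thesis using atom_idem[OF e] eA p by (simp add: m_assoc[symmetric] idem_def)
  qed
  let ?a2 = "impl A x y \<otimes>\<^bsub>A\<^esub> impl A x y" and ?b2 = "impl A y x \<otimes>\<^bsub>A\<^esub> impl A y x"
  have a2: "?a2 \<in> carrier A" "idem ?a2" and b2: "?b2 \<in> carrier A" "idem ?b2"
    using x y impl_closed idem_square by simp_all
  have "e = e \<otimes>\<^bsub>A\<^esub> vee A ?a2 ?b2" using square_prelinear[OF x y] eA by simp
  also have "\<dots> = vee A (e \<otimes>\<^bsub>A\<^esub> ?a2) (e \<otimes>\<^bsub>A\<^esub> ?b2)" using mult_vee_distrib[OF eA a2(1) b2(1)] .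
  finally have "e \<otimes>\<^bsub>A\<^esub> ?a2 \<noteq> falsum A \<or> e \<otimes>\<^bsub>A\<^esub> ?b2 \<noteq> falsum A"
    using vee_falsum[OF falsum_closed] e by (auto simp: atoms_def)
  then show ?thesis
    using atom_mult_idem[OF e a2(2)] atom_mult_idem[OF e b2(2)] *[OF x y] *[OF y x] by blast
qed

text \<open>If \<open>x\<close> were not below \<open>y\<close>, the square of
  \<open>impl A x y\<close> would have a nonzero complement and so an atom \<open>e\<close> under
  that complement. The comparison at \<open>e\<close> puts \<open>e\<close>, being idempotent, also
  below the square, so \<open>e\<close> would be \<open>falsum\<close>.\<close>

lemma le_iff_atoms:
  assumes x: "x \<in> carrier A" and y: "y \<in> carrier A"
  shows "mtl_le A x y \<longleftrightarrow> (\<forall>e\<in>atoms. mtl_le A (e \<otimes>\<^bsub>A\<^esub> x) (e \<otimes>\<^bsub>A\<^esub> y))"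
proof
  assume le: "\<forall>e\<in>atoms. mtl_le A (e \<otimes>\<^bsub>A\<^esub> x) (e \<otimes>\<^bsub>A\<^esub> y)"
  let ?a = "impl A x y"
  let ?b = "impl A (?a \<otimes>\<^bsub>A\<^esub> ?a) (falsum A)"
  have a: "?a \<in> carrier A" using x y impl_closed by simp
  have a2: "idem (?a \<otimes>\<^bsub>A\<^esub> ?a)" using idem_square[OF a] .
  have bA: "?b \<in> carrier A" using idem_neg(3)[OF a2] by (simp add: idem_def)
  have "?b = falsum A"
  proof (rule ccontr)
    assume "?b \<noteq> falsum A"
    then obtain e where e: "e \<in> atoms" "mtl_le A e ?b" using atom_below_exists idem_neg(3)[OF a2] by blast
    have eA: "e \<in> carrier A" and ee: "e \<otimes>\<^bsub>A\<^esub> e = e" using atom_idem[OF e(1)] by (auto simp: idem_def)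
    have "mtl_le A (e \<otimes>\<^bsub>A\<^esub> x) y"
      using le_trans[of "e \<otimes>\<^bsub>A\<^esub> x" "e \<otimes>\<^bsub>A\<^esub> y" y] le e(1) mult_le2[OF eA y] eA x y by simp
    then have "mtl_le A e ?a" using residuation[OF x y eA] m_comm[OF x eA] by simp
    then have "mtl_le A (e \<otimes>\<^bsub>A\<^esub> e) (?a \<otimes>\<^bsub>A\<^esub> ?a)" using mult_mono eA a by simp
    then have "mtl_le A (e \<otimes>\<^bsub>A\<^esub> e) ((?a \<otimes>\<^bsub>A\<^esub> ?a) \<otimes>\<^bsub>A\<^esub> ?b)"
      using mult_mono[of e "?a \<otimes>\<^bsub>A\<^esub> ?a" e ?b] e(2) eA a bA ee by simp
    then have "e = falsum A" using idem_neg(1)[OF a2] ee le_falsum[OF eA] by simp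
    then show False using e(1) by (simp add: atoms_def)
  qed
  then have "?a \<otimes>\<^bsub>A\<^esub> ?a = \<one>\<^bsub>A\<^esub>" using idem_neg(2)[OF a2] vee_falsum a by simp
  then have "mtl_le A \<one>\<^bsub>A\<^esub> ?a" using mult_le1[OF a a] by simp
  then show "mtl_le A x y" using residuation[OF x y one_closed] x by simp
next
  assume "mtl_le A x y"
  then show "\<forall>e\<in>atoms. mtl_le A (e \<otimes>\<^bsub>A\<^esub> x) (e \<otimes>\<^bsub>A\<^esub> y)"
    using mult_mono_right x y atom_carrier by blast
qed

section \<open>The chain of elements below an atom\<close>

lemma mult_in_below: "e \<in> carrier A \<Longrightarrow> x \<in> carrier A \<Longrightarrow> e \<otimes>\<^bsub>A\<^esub> x \<in> below e"
  by (simp add: below_def mult_le1)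

lemma atom_mult_below: "e \<in> atoms \<Longrightarrow> z \<in> below e \<Longrightarrow> e \<otimes>\<^bsub>A\<^esub> z = z"
  using le_idem_iff atom_idem by (auto simp: below_def)

lemma below_linear: "e \<in> atoms \<Longrightarrow> z \<in> below e \<Longrightarrow> w \<in> below e \<Longrightarrow> mtl_le A z w \<or> mtl_le A w z"
  using atom_mult_linear[of e z w] atom_mult_below[of e] by (simp add: below_def)

lemma rank_less: "z \<in> carrier A \<Longrightarrow> w \<in> carrier A \<Longrightarrow> mtl_le A z w \<Longrightarrow> z \<noteq> w \<Longrightarrow> rank z < rank w"
  unfolding rank_def using fin le_trans[of _ z w] le_antisym[of w z]
  by (intro psubset_card_mono) auto

lemma rank_le_iff:
  assumes e: "e \<in> atoms" and z: "z \<in> below e" and w: "w \<in> below e"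
  shows "rank z \<le> rank w \<longleftrightarrow> mtl_le A z w"
proof -
  have zw: "z \<in> carrier A" "w \<in> carrier A" using z w by (auto simp: below_def)
  show ?thesis
  proof
    assume le: "rank z \<le> rank w"
    show "mtl_le A z w"
    proof (rule ccontr)
      assume n: "\<not> mtl_le A z w"
      then have "mtl_le A w z" using below_linear[OF e z w] by blast
      moreover have "w \<noteq> z" using n le_refl zw by blast
      ultimately show False using rank_less[of w z] zw le by simp
    qed
  next
    assume "mtl_le A z w"
    then show "rank z \<le> rank w" using rank_less[of z w] zw by (cases "z = w") auto
  qed
qed

text \<open>An atom and \<open>falsum\<close> are two different elements below the atom, so the
  truncated subtraction is exact. The number subtracted is 2 because \<open>std_dp n\<close> has
  \<open>n + 2\<close> elements.\<close>

lemma card_below_atom: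
  assumes e: "e \<in> atoms"
  shows "card (below e) = Suc (Suc (card (below e) - 2))"
proof -
  have "{falsum A, e} \<subseteq> below e"
    using atom_carrier[OF e] falsum_closed falsum_least le_refl by (simp add: below_def)
  then have "card {falsum A, e} \<le> card (below e)" using fin by (intro card_mono) (simp_all add: below_def)
  moreover have "falsum A \<noteq> e" using e by (auto simp: atoms_def)
  ultimately show ?thesis by simp
qed

lemma rank_atom:
  assumes e: "e \<in> atoms"
  shows "rank e = Suc (card (below e) - 2)"
proof -
  have "below e = insert e {z \<in> carrier A. mtl_le A z e \<and> z \<noteq> e}"
    using atom_carrier[OF e] le_refl by (auto simp: below_def)
  then have "card (below e) = Suc (rank e)" unfolding rank_def using fin by simp
  then show ?thesis using card_below_atom[OF e] by simp
qed

lemma rank_falsum: "rank (falsum A) = 0"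
proof -
  have "{z \<in> carrier A. mtl_le A z (falsum A) \<and> z \<noteq> falsum A} = {}" using le_falsum by blast
  then show ?thesis by (simp only: rank_def card.empty)
qed

lemma rank_bij:
  assumes e: "e \<in> atoms"
  shows "bij_betw rank (below e) {..Suc (card (below e) - 2)}"
proof -
  have inj: "inj_on rank (below e)"
  proof (rule inj_onI)
    fix z w assume zw: "z \<in> below e" "w \<in> below e" "rank z = rank w"
    then have "mtl_le A z w" "mtl_le A w z"
      using rank_le_iff[OF e zw(1,2)] rank_le_iff[OF e zw(2,1)] by auto
    then show "z = w" using zw le_antisym by (simp add: below_def)
  qed
  have e_in: "e \<in> below e" using atom_carrier[OF e] le_refl by (simp add: below_def)
  have "rank z \<le> Suc (card (below e) - 2)" if z: "z \<in> below e" for z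
  proof -
    have "mtl_le A z e" using z by (simp add: below_def)
    then show ?thesis using rank_le_iff[OF e z e_in] rank_atom[OF e] by simp
  qed
  then have "rank ` below e \<subseteq> {..Suc (card (below e) - 2)}" by auto
  moreover have "card (rank ` below e) = card {..Suc (card (below e) - 2)}"
    using card_image[OF inj] card_below_atom[OF e] by simp
  ultimately have "rank ` below e = {..Suc (card (below e) - 2)}" by (intro card_subset_eq) simp_all
  then show ?thesis using inj by (simp add: bij_betw_def)
qed

text \<open>An element strictly below the atom has a square that is an idempotent strictly below the
  atom, hence \<open>falsum\<close>. By linearity the product of two such elements is bounded by the
  square of the larger one.\<close>

lemma rank_mult:
  assumes e: "e \<in> atoms" and z: "z \<in> below e" and w: "w \<in> below e"
  shows "rank (z \<otimes>\<^bsub>A\<^esub> w) = rank z \<otimes>\<^bsub>std_dp (card (below e) - 2)\<^esub> rank w"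
proof -
  have eA: "e \<in> carrier A" and zA: "z \<in> carrier A" and wA: "w \<in> carrier A"
    using atom_carrier[OF e] z w by (auto simp: below_def)
  have e_in: "e \<in> below e" using eA le_refl by (simp add: below_def)
  have top: "rank v = Suc (card (below e) - 2) \<longleftrightarrow> v = e" if "v \<in> below e" for v
    using rank_bij[OF e] rank_atom[OF e] e_in that by (auto simp: bij_betw_def inj_on_def)
  have sq: "v \<otimes>\<^bsub>A\<^esub> v = falsum A" if v: "v \<in> below e" "v \<noteq> e" for v
  proof -
    have vA: "v \<in> carrier A" "mtl_le A v e" using v by (auto simp: below_def)
    have le: "mtl_le A (v \<otimes>\<^bsub>A\<^esub> v) v" using mult_le1 vA by simp
    then have "mtl_le A (v \<otimes>\<^bsub>A\<^esub> v) e" using le_trans[OF _ _ _ le vA(2)] vA eA by simp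
    then have "v \<otimes>\<^bsub>A\<^esub> v = falsum A \<or> v \<otimes>\<^bsub>A\<^esub> v = e" using atom_minimal[OF e idem_square] vA by blast
    moreover have "v \<otimes>\<^bsub>A\<^esub> v \<noteq> e" using le vA v le_antisym eA by auto
    ultimately show ?thesis by blast
  qed
  consider "z = e" | "w = e" | "z \<noteq> e" "w \<noteq> e" by blast
  then show ?thesis
  proof cases
    case 1
    then show ?thesis using atom_mult_below[OF e w] top[OF z] by simp
  next
    case 2
    then have "z \<otimes>\<^bsub>A\<^esub> w = z" using atom_mult_below[OF e z] m_comm zA wA by simp
    then show ?thesis using 2 top[OF w] top[OF z] by (simp add: rank_atom[OF e])
  next
    case 3
    have "z \<otimes>\<^bsub>A\<^esub> w = falsum A"
    proof (cases "mtl_le A z w")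
      case True
      then have "mtl_le A (z \<otimes>\<^bsub>A\<^esub> w) (w \<otimes>\<^bsub>A\<^esub> w)" using mult_mono le_refl zA wA by simp
      then show ?thesis using sq[OF w 3(2)] le_falsum zA wA by simp
    next
      case False
      then have "mtl_le A w z" using below_linear[OF e z w] by blast
      then have "mtl_le A (z \<otimes>\<^bsub>A\<^esub> w) (z \<otimes>\<^bsub>A\<^esub> z)" using mult_mono le_refl zA wA by simp
      then show ?thesis using sq[OF z 3(1)] le_falsum zA wA by simp
    qed
    then show ?thesis using 3 top[OF z] top[OF w] rank_falsum by simp
  qed
qed

text \<open>The element sought is the join of the prescribed components. Multiplication by an atom
  distributes over the join and annihilates the components under all other atoms; the induction
  keeps coordinates not yet treated at \<open>falsum\<close>.\<close>

lemma glue_atoms: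
  assumes y: "\<And>e. e \<in> atoms \<Longrightarrow> y e \<in> below e"
  shows "\<exists>x \<in> carrier A. \<forall>e\<in>atoms. e \<otimes>\<^bsub>A\<^esub> x = y e"
proof -
  have fin_atoms: "finite atoms" by (rule finite_subset[OF _ fin]) (auto dest: atom_carrier)
  have "\<exists>x \<in> carrier A. (\<forall>e\<in>F. e \<otimes>\<^bsub>A\<^esub> x = y e) \<and> (\<forall>e\<in>atoms - F. e \<otimes>\<^bsub>A\<^esub> x = falsum A)"
    if "finite F" "F \<subseteq> atoms" for F
    using that
  proof (induction rule: finite_induct)
    case empty
    then show ?case using mult_falsum falsum_closed atom_carrier by auto
  next
    case (insert f F)
    then obtain x where x: "x \<in> carrier A" "\<And>e. e \<in> F \<Longrightarrow> e \<otimes>\<^bsub>A\<^esub> x = y e"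
        "\<And>e. e \<in> atoms \<Longrightarrow> e \<notin> F \<Longrightarrow> e \<otimes>\<^bsub>A\<^esub> x = falsum A" by auto
    have f: "f \<in> atoms" "f \<in> carrier A" using insert.prems atom_carrier by auto
    have yf: "y f \<in> carrier A" using y[OF f(1)] by (simp add: below_def)
    have dist: "e \<otimes>\<^bsub>A\<^esub> vee A x (y f) = vee A (e \<otimes>\<^bsub>A\<^esub> x) (e \<otimes>\<^bsub>A\<^esub> y f)" if "e \<in> atoms" for e
      using mult_vee_distrib[OF atom_carrier[OF that] x(1) yf] .
    have other: "e \<otimes>\<^bsub>A\<^esub> y f = falsum A" if e: "e \<in> atoms" "e \<noteq> f" for e
    proof -
      have eA: "e \<in> carrier A" using atom_carrier[OF e(1)] .
      have "e \<otimes>\<^bsub>A\<^esub> y f = e \<otimes>\<^bsub>A\<^esub> (f \<otimes>\<^bsub>A\<^esub> y f)" using atom_mult_below[OF f(1) y[OF f(1)]] by simp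
      also have "\<dots> = (e \<otimes>\<^bsub>A\<^esub> f) \<otimes>\<^bsub>A\<^esub> y f" using m_assoc[OF eA f(2) yf] by simp
      also have "\<dots> = falsum A"
        using atoms_mult_distinct[OF e(1) f(1) e(2)] mult_falsum[OF yf] m_comm[OF yf falsum_closed] by simp
      finally show ?thesis .
    qed
    have self: "f \<otimes>\<^bsub>A\<^esub> y f = y f" using atom_mult_below[OF f(1) y[OF f(1)]] .
    show ?case
    proof (intro bexI conjI ballI)
      show "vee A x (y f) \<in> carrier A" using x yf vee_closed by simp
      fix e assume e: "e \<in> insert f F"
      then have ea: "e \<in> atoms" using insert.prems by auto
      have ye: "y e \<in> carrier A" using y[OF ea] by (simp add: below_def)
      show "e \<otimes>\<^bsub>A\<^esub> vee A x (y f) = y e"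
      proof (cases "e = f")
        case True
        then show ?thesis using dist[OF ea] x(3)[OF ea] insert.hyps self vee_falsum ye by simp
      next
        case False
        then show ?thesis using dist[OF ea] x(2) e other[OF ea False] vee_falsum ye by simp
      qed
    next
      fix e assume "e \<in> atoms - insert f F"
      then show "e \<otimes>\<^bsub>A\<^esub> vee A x (y f) = falsum A"
        using dist[of e] x(3)[of e] other[of e] vee_falsum falsum_closed by simp
    qed
  qed
  from this[OF fin_atoms subset_refl] show ?thesis by blast
qed

text \<open>The coordinates of \<open>x\<close> are the positions of its products with the atoms.
  \<open>le_iff_atoms\<close> gives an order embedding, \<open>glue_atoms\<close> surjectivity, and
  idempotence of atoms multiplicativity. In the trivial algebra there are no atoms and the product
  is empty.\<close>

lemma iso_prod_std_dp:
  "\<exists>ns h. h \<in> mtl_hom A (mtl_prod {..<length ns} (\<lambda>i. std_dp (ns ! i))) \<and>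
    bij_betw h (carrier A) (carrier (mtl_prod {..<length ns} (\<lambda>i. std_dp (ns ! i))))"
proof -
  have "finite atoms" by (rule finite_subset[OF _ fin]) (auto dest: atom_carrier)
  then obtain es where es: "set es = atoms" "distinct es" using finite_distinct_list by blast
  define ns where "ns = map (\<lambda>e. card (below e) - 2) es"
  let ?P = "mtl_prod {..<length ns} (\<lambda>i. std_dp (ns ! i))"
  define h where "h x = (\<lambda>i\<in>{..<length ns}. rank (es ! i \<otimes>\<^bsub>A\<^esub> x))" for x
  have len: "length ns = length es" by (simp add: ns_def)
  have at: "es ! i \<in> atoms" and nsi: "ns ! i = card (below (es ! i)) - 2" if "i < length ns" for i
    using that nth_mem[of i es] unfolding es(1) by (simp_all add: ns_def)
  have in_b: "es ! i \<otimes>\<^bsub>A\<^esub> x \<in> below (es ! i)" if "i < length ns" "x \<in> carrier A" for i x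
    using mult_in_below[OF atom_carrier[OF at[OF that(1)]] that(2)] .
  have h_in: "h x \<in> carrier ?P" if "x \<in> carrier A" for x
    unfolding h_def
  proof (rule restrict_in_mtl_prod)
    fix i assume "i \<in> {..<length ns}"
    then have i: "i < length ns" by simp
    show "rank (es ! i \<otimes>\<^bsub>A\<^esub> x) \<in> carrier (std_dp (ns ! i))"
      using bij_betw_apply[OF rank_bij[OF at[OF i]] in_b[OF i that]] nsi[OF i] by simp
  qed
  have P: "mtl_algebra ?P" by (rule mtl_algebra_prod) (rule mtl_algebra_std_dp)
  interpret P: mtl_algebra ?P by (rule P)
  have le: "mtl_le ?P (h x) (h y) \<longleftrightarrow> mtl_le A x y" if x: "x \<in> carrier A" and y: "y \<in> carrier A" for x y
  proof -
    have "mtl_le ?P (h x) (h y) \<longleftrightarrow> (\<forall>i<length ns. rank (es ! i \<otimes>\<^bsub>A\<^esub> x) \<le> rank (es ! i \<otimes>\<^bsub>A\<^esub> y))"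
      unfolding mtl_le_prod[OF h_in[OF x]] by (auto simp: h_def)
    also have "\<dots> \<longleftrightarrow> (\<forall>i<length ns. mtl_le A (es ! i \<otimes>\<^bsub>A\<^esub> x) (es ! i \<otimes>\<^bsub>A\<^esub> y))"
      using rank_le_iff[OF at in_b[OF _ x] in_b[OF _ y]] by simp
    also have "\<dots> \<longleftrightarrow> (\<forall>e\<in>atoms. mtl_le A (e \<otimes>\<^bsub>A\<^esub> x) (e \<otimes>\<^bsub>A\<^esub> y))"
      unfolding es(1)[symmetric] len by (metis in_set_conv_nth)
    finally show ?thesis using le_iff_atoms[OF x y] by simp
  qed
  have "bij_betw h (carrier A) (carrier ?P)"
    unfolding bij_betw_def
  proof (intro conjI inj_onI equalityI subsetI)
    fix x y assume "x \<in> carrier A" "y \<in> carrier A" "h x = h y"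
    then show "x = y" using le[of x y] le[of y x] P.le_refl[OF h_in] le_antisym by simp
  next
    fix d assume d: "d \<in> carrier ?P"
    \<comment> \<open>The tuple \<open>d\<close> is indexed by positions, the gluing by atoms;
      distinctness of \<open>es\<close> makes the position of an atom unique.\<close>
    define y where "y e = inv_into (below e) rank (d (THE i. i < length es \<and> es ! i = e))" for e
    have idx: "(THE j. j < length es \<and> es ! j = es ! i) = i" if "i < length es" for i
      using that es(2) by (intro the_equality) (auto simp: nth_eq_iff_index_eq)
    have di: "d i \<in> rank ` below (es ! i)" if "i < length ns" for i
      using mtl_prod_memD[OF d, of i] that nsi[OF that] bij_betw_imp_surj_on[OF rank_bij[OF at[OF that]]] by simp
    have y_in: "y (es ! i) \<in> below (es ! i)" and y_rank: "rank (y (es ! i)) = d i" if "i < length ns" for i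
      unfolding y_def using idx that len inv_into_into[OF di[OF that]] f_inv_into_f[OF di[OF that]] by simp_all
    have "y e \<in> below e" if "e \<in> atoms" for e
      using that y_in len unfolding es(1)[symmetric] by (metis in_set_conv_nth)
    then obtain x where x: "x \<in> carrier A" "\<And>e. e \<in> atoms \<Longrightarrow> e \<otimes>\<^bsub>A\<^esub> x = y e" using glue_atoms[of y] by blast
    have "h x = d"
      unfolding h_def by (subst restrict_eq_in_prod[OF d]) (simp add: x(2) at y_rank)
    then show "d \<in> h ` carrier A" using x(1) by blast
  qed (use h_in in blast)
  moreover have "h (x \<otimes>\<^bsub>A\<^esub> y) = h x \<otimes>\<^bsub>?P\<^esub> h y" if x: "x \<in> carrier A" and y: "y \<in> carrier A" for x y
    unfolding mtl_prod_simps(2) h_def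
  proof (rule restrict_ext)
    fix i assume "i \<in> {..<length ns}"
    then have i: "i < length ns" by simp
    let ?e = "es ! i"
    have eA: "?e \<in> carrier A" and ee: "?e \<otimes>\<^bsub>A\<^esub> ?e = ?e" using atom_idem[OF at[OF i]] by (auto simp: idem_def)
    have "(?e \<otimes>\<^bsub>A\<^esub> x) \<otimes>\<^bsub>A\<^esub> (?e \<otimes>\<^bsub>A\<^esub> y) = (?e \<otimes>\<^bsub>A\<^esub> ?e) \<otimes>\<^bsub>A\<^esub> (x \<otimes>\<^bsub>A\<^esub> y)"
      using eA x y by (simp add: m_ac)
    then show "rank (?e \<otimes>\<^bsub>A\<^esub> (x \<otimes>\<^bsub>A\<^esub> y)) =
        (\<lambda>i\<in>{..<length ns}. rank (es ! i \<otimes>\<^bsub>A\<^esub> x)) i \<otimes>\<^bsub>std_dp (ns ! i)\<^esub>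
        (\<lambda>i\<in>{..<length ns}. rank (es ! i \<otimes>\<^bsub>A\<^esub> y)) i"
      using rank_mult[OF at[OF i] in_b[OF i x] in_b[OF i y]] ee i nsi[OF i] by simp
  qed
  ultimately show ?thesis
    using mtl_hom_of_order_iso[OF _ P, of A h] le mtl_algebra_axioms by blast
qed

end

section \<open>The duality\<close>

text \<open>Homomorphisms are total functions with arbitrary values off the carrier; restricting
  makes equal arrows equal as sets of values.\<close>

definition mtl_arrow :: "'a mtl \<Rightarrow> ('a \<Rightarrow> 'b) \<Rightarrow> ('a \<rightharpoonup> 'b)" where
  "mtl_arrow A h = (Some \<circ> h) |` carrier A"

text \<open>Parametrised by its objects, so that \<open>DP_fin\<close> and the products of standard
  chains are treated alike.\<close>

definition mtl_cat :: "'a mtl set \<Rightarrow> ('a mtl, 'a \<rightharpoonup> 'a) cat" where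
  "mtl_cat S = \<lparr>Ob = S, Hom = (\<lambda>A B. {mtl_arrow A h |h. h \<in> mtl_hom A B}),
    Id = (\<lambda>A. Some |` carrier A), Comp = (\<circ>\<^sub>m)\<rparr>"

lemma DP_fin_eq: "DP_fin = mtl_cat {A. dp_algebra A \<and> finite (carrier A)}"
  by (simp add: DP_fin_def mtl_cat_def mtl_arrow_def fun_eq_iff)

lemma mtl_arrow_eq_iff: "mtl_arrow A h = mtl_arrow A k \<longleftrightarrow> (\<forall>x\<in>carrier A. h x = k x)"
  by (auto simp: mtl_arrow_def fun_eq_iff restrict_map_def)

lemma mtl_arrow_comp: "h \<in> mtl_hom A B \<Longrightarrow> mtl_arrow B k \<circ>\<^sub>m mtl_arrow A h = mtl_arrow A (k \<circ> h)"
  by (rule ext) (simp add: mtl_arrow_def restrict_map_def map_comp_def mtl_hom_closed)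

lemma mtl_arrow_id: "(\<And>x. x \<in> carrier A \<Longrightarrow> h x = x) \<Longrightarrow> mtl_arrow A h = Some |` carrier A"
  by (rule ext) (simp add: mtl_arrow_def restrict_map_def)

lemma category_mtl_cat: "category (mtl_cat S)"
proof
  fix A show "Id (mtl_cat S) A \<in> Hom (mtl_cat S) A A"
    using mtl_arrow_id[of A "\<lambda>x. x"] mtl_hom_id[of A]
    by (auto simp: mtl_cat_def intro!: exI[of _ "\<lambda>x. x"])
next
  fix A B C f g assume "f \<in> Hom (mtl_cat S) A B" "g \<in> Hom (mtl_cat S) B C"
  then obtain h k where hk: "h \<in> mtl_hom A B" "f = mtl_arrow A h" "k \<in> mtl_hom B C" "g = mtl_arrow B k"
    by (auto simp: mtl_cat_def)
  then show "Comp (mtl_cat S) g f \<in> Hom (mtl_cat S) A C"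
    using mtl_arrow_comp[OF hk(1), of k] mtl_hom_comp[OF hk(1,3)] by (auto simp: mtl_cat_def)
next
  fix A B f assume "f \<in> Hom (mtl_cat S) A B"
  then obtain h where h: "h \<in> mtl_hom A B" "f = mtl_arrow A h" by (auto simp: mtl_cat_def)
  have "dom f \<subseteq> carrier A" by (simp add: h(2) mtl_arrow_def)
  then show "Comp (mtl_cat S) f (Id (mtl_cat S) A) = f"
    by (simp add: mtl_cat_def map_comp_id_right)
  have "ran f \<subseteq> carrier B"
    unfolding h(2) by (auto simp: mtl_arrow_def ran_def restrict_map_def mtl_hom_closed[OF h(1)] split: if_splits)
  then show "Comp (mtl_cat S) (Id (mtl_cat S) B) f = f"
    by (simp add: mtl_cat_def map_comp_id_left)
qed (simp add: mtl_cat_def map_comp_assoc)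

lemma category_opposite: "category C \<Longrightarrow> category (opposite C)"
  by (auto simp: category_def opposite_def)

text \<open>In the opposite category the inverse of \<open>f\<close> plays the role of the arrow
  from \<open>X\<close> to \<open>Y\<close>, hence the existential.\<close>

lemma is_iso_opposite: "is_iso C X Y f \<Longrightarrow> \<exists>g. is_iso (opposite C) X Y g"
  by (auto simp: is_iso_def opposite_def)

lemma weak_equivalence_opposite:
  assumes "weak_equivalence C D F"
  shows "weak_equivalence (opposite C) (opposite D) \<lparr>FOb = FOb F, FArr = (\<lambda>X Y. FArr F Y X)\<rparr>"
proof -
  interpret weak_equivalence C D F by fact
  interpret C': category "opposite C" by (rule category_opposite) unfold_locales
  interpret D': category "opposite D" by (rule category_opposite) unfold_locales
  show ?thesis
  proof
    fix Z assume "Z \<in> Ob (opposite D)"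
    then have "Z \<in> Ob D" by (simp add: opposite_def)
    then obtain X f where "X \<in> Ob C" "is_iso D (FOb F X) Z f" using FOb_ess_surj[of Z] by blast
    then show "\<exists>X\<in>Ob (opposite C). \<exists>f. is_iso (opposite D)
        (FOb \<lparr>FOb = FOb F, FArr = (\<lambda>X Y. FArr F Y X)\<rparr> X) Z f"
      using is_iso_opposite by (fastforce simp: opposite_def)
  qed (auto simp: opposite_def FOb_in_Ob FArr_in_Hom FArr_Id FArr_Comp intro: FArr_bij)
qed

section \<open>Dualising arrows of families\<close>

definition dp_prod :: "nat list \<Rightarrow> (nat \<Rightarrow> nat) mtl" where
  "dp_prod ns = mtl_prod {..<length ns} (\<lambda>i. std_dp (ns ! i))"

text \<open>The \<open>i\<close>-th coordinate of the result reads the coordinate of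
  \<open>d\<close> to which \<open>h\<close> sends the \<open>i\<close>-th member and pulls that
  downset back along the component.\<close>

definition dual_map :: "nat list \<Rightarrow> (nat \<times> (nat \<rightharpoonup> nat)) list \<Rightarrow> (nat \<Rightarrow> nat) \<Rightarrow> (nat \<Rightarrow> nat)" where
  "dual_map ns h d = (\<lambda>i\<in>{..<length ns}. preimage_map (ns ! i) (snd (h ! i)) (d (fst (h ! i))))"

lemma dual_map_hom:
  assumes h: "h \<in> Hom (Fam Nat_top) ns ms"
  shows "dual_map ns h \<in> mtl_hom (dp_prod ms) (dp_prod ns)"
proof -
  have "(\<lambda>d. preimage_map (ns ! i) (snd (h ! i)) (d (fst (h ! i)))) \<in> mtl_hom (dp_prod ms) (std_dp (ns ! i))"
    if i: "i \<in> {..<length ns}" for i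
  proof -
    have j: "fst (h ! i) \<in> {..<length ms}"
      and u: "snd (h ! i) \<in> Hom Nat_top (ns ! i) (ms ! fst (h ! i))"
      using h i by (auto simp: Fam_Hom_iff)
    have "(\<lambda>d. d (fst (h ! i))) \<in> mtl_hom (dp_prod ms) (std_dp (ms ! fst (h ! i)))"
      unfolding dp_prod_def using j by (rule mtl_hom_proj)
    from mtl_hom_comp[OF this mtl_hom_of_coatom_embedding[OF coatom_embedding_preimage_map[OF u]]]
    show ?thesis by (simp add: comp_def)
  qed
  then show ?thesis
    unfolding dual_map_def[abs_def] dp_prod_def[of ns] by (rule mtl_hom_into_prod)
qed

text \<open>Test elements supported in one coordinate; \<open>dual_map_inj\<close> uses them to tell
  the coordinates apart.\<close>

lemma dp_prod_top_at:
  fixes ms :: "nat list"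
  shows "(\<lambda>i\<in>{..<length ms}. if i = j then c else 0) \<in> carrier (dp_prod ms) \<longleftrightarrow> (j < length ms \<longrightarrow> c \<le> Suc (ms ! j))"
  unfolding dp_prod_def by (auto simp: PiE_iff)

lemma dual_map_inj:
  assumes h: "h \<in> Hom (Fam Nat_top) ns ms" and h': "h' \<in> Hom (Fam Nat_top) ns ms"
    and eq: "\<And>d. d \<in> carrier (dp_prod ms) \<Longrightarrow> dual_map ns h d = dual_map ns h' d"
  shows "h = h'"
proof (rule nth_equalityI)
  show "length h = length h'" using h h' by (simp add: Fam_Hom_iff)
  fix i assume "i < length h"
  then have i: "i < length ns" using h by (simp add: Fam_Hom_iff)
  let ?n = "ns ! i"
  obtain j u where ju: "h ! i = (j, u)" by fastforce
  obtain j' u' where ju': "h' ! i = (j', u')" by fastforce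
  have j: "j < length ms" and u: "u \<in> Hom Nat_top ?n (ms ! j)"
    and j': "j' < length ms" and u': "u' \<in> Hom Nat_top ?n (ms ! j')"
    using h h' i ju ju' by (auto simp: Fam_Hom_iff dest!: spec[of _ i])
  have eq': "preimage_map ?n u (d j) = preimage_map ?n u' (d j')" if "d \<in> carrier (dp_prod ms)" for d
    using fun_cong[OF eq[OF that], of i] i by (simp add: dual_map_def ju ju')
  have \<delta>: "preimage_map ?n u c = preimage_map ?n u' (if j' = j then c else 0)" if "c \<le> Suc (ms ! j)" for c
    using eq'[of "\<lambda>i\<in>{..<length ms}. if i = j then c else 0"] dp_prod_top_at[where ms = ms and j = j and c = c] that j j' by simp
  have "j' = j"
  proof (rule ccontr)
    assume "j' \<noteq> j"
    \<comment> \<open>For different indices, the test element with the top at \<open>j\<close> would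
      give the top on one side and 0 on the other.\<close>
    then have "preimage_map ?n u (Suc (ms ! j)) = preimage_map ?n u' 0" using \<delta>[of "Suc (ms ! j)"] by simp
    then show False
      using coatom_embedding_preimage_map[OF u] coatom_embedding_preimage_map[OF u']
      by (simp add: coatom_embedding_def)
  qed
  then have "u = u'" using preimage_map_inj[OF u, of u'] u' \<delta> by simp
  then show "h ! i = h' ! i" using ju ju' \<open>j' = j\<close> by simp
qed

text \<open>Each coordinate of \<open>H\<close> is a homomorphism from a product to a chain, so it
  factors through one projection, which fixes the index; the remaining homomorphism of chains is the
  preimage map of an arrow.\<close>

lemma dual_map_surj:
  assumes H: "H \<in> mtl_hom (dp_prod ms) (dp_prod ns)"
  shows "\<exists>h \<in> Hom (Fam Nat_top) ns ms. \<forall>d \<in> carrier (dp_prod ms). H d = dual_map ns h d"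
proof -
  have "\<exists>p. fst p < length ms \<and> snd p \<in> Hom Nat_top (ns ! i) (ms ! fst p) \<and>
      (\<forall>d \<in> carrier (dp_prod ms). H d i = preimage_map (ns ! i) (snd p) (d (fst p)))" if i: "i < length ns" for i
  proof -
    have "(\<lambda>d. d i) \<in> mtl_hom (dp_prod ns) (std_dp (ns ! i))"
      unfolding dp_prod_def using i by (intro mtl_hom_proj) simp
    from mtl_hom_comp[OF H this]
    have "(\<lambda>d. H d i) \<in> mtl_hom (dp_prod ms) (std_dp (ns ! i))" by (simp add: comp_def)
    from mtl_hom_prod_to_chain[OF finite_lessThan this[unfolded dp_prod_def]]
    obtain j k where j: "j < length ms" and k: "k \<in> mtl_hom (std_dp (ms ! j)) (std_dp (ns ! i))"
      and Hk: "\<And>d. d \<in> carrier (dp_prod ms) \<Longrightarrow> H d i = k (d j)"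
      unfolding dp_prod_def by blast
    obtain u where u: "u \<in> Hom Nat_top (ns ! i) (ms ! j)"
      and ku: "\<And>c. c \<le> Suc (ms ! j) \<Longrightarrow> preimage_map (ns ! i) u c = k c"
      using preimage_map_surj[OF coatom_embedding_of_mtl_hom[OF k]] by blast
    have "H d i = preimage_map (ns ! i) u (d j)" if d: "d \<in> carrier (dp_prod ms)" for d
    proof -
      have "d j \<le> Suc (ms ! j)" using mtl_prod_memD[OF d[unfolded dp_prod_def], of j] j by simp
      then show ?thesis using Hk[OF d] ku by simp
    qed
    then show ?thesis using j u by (intro exI[of _ "(j, u)"]) simp
  qed
  then obtain p where p: "\<And>i. i < length ns \<Longrightarrow> fst (p i) < length ms"
    "\<And>i. i < length ns \<Longrightarrow> snd (p i) \<in> Hom Nat_top (ns ! i) (ms ! fst (p i))"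
    "\<And>i d. i < length ns \<Longrightarrow> d \<in> carrier (dp_prod ms) \<Longrightarrow>
      H d i = preimage_map (ns ! i) (snd (p i)) (d (fst (p i)))"
    by metis
  let ?h = "map p [0..<length ns]"
  have "?h \<in> Hom (Fam Nat_top) ns ms" using p by (simp add: Fam_Hom_iff)
  moreover have "H d = dual_map ns ?h d" if d: "d \<in> carrier (dp_prod ms)" for d
  proof -
    have "H d \<in> carrier (dp_prod ns)" using mtl_hom_closed[OF H d] .
    note Hd = this[unfolded dp_prod_def]
    have "dual_map ns ?h d = H d"
      unfolding dual_map_def
    proof (subst restrict_eq_in_prod[OF Hd], rule ballI)
      fix i assume "i \<in> {..<length ns}"
      then show "preimage_map (ns ! i) (snd (?h ! i)) (d (fst (?h ! i))) = H d i"
        using p(3)[OF _ d, of i] by simp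
    qed
    then show ?thesis ..
  qed
  ultimately show ?thesis by blast
qed

text \<open>The objects of the target are by definition the products \<open>dp_prod ns\<close>, so
  essential surjectivity is immediate and the content lies in the bijection on arrows.\<close>

lemma weakly_equivalent_Fam_Nat_top_dp_prod:
  "weakly_equivalent (Fam Nat_top) (opposite (mtl_cat (range dp_prod)))"
proof -
  let ?D = "opposite (mtl_cat (range dp_prod))"
  let ?F = "\<lparr>FOb = dp_prod, FArr = (\<lambda>ns ms h. mtl_arrow (dp_prod ms) (dual_map ns h))\<rparr>"
  interpret C: category "Fam Nat_top" by (intro category_Fam category_Nat_top)
  interpret D: category ?D by (intro category_opposite category_mtl_cat)
  have Hom_D: "Hom ?D A B = {mtl_arrow B h |h. h \<in> mtl_hom B A}" for A B
    by (simp add: opposite_def mtl_cat_def)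
  have "weak_equivalence (Fam Nat_top) ?D ?F"
  proof
    fix ns ms h assume "h \<in> Hom (Fam Nat_top) ns ms"
    then show "FArr ?F ns ms h \<in> Hom ?D (FOb ?F ns) (FOb ?F ms)"
      using dual_map_hom by (auto simp: Hom_D)
  next
    fix ns
    have "dual_map ns (Id (Fam Nat_top) ns) d = d" if d: "d \<in> carrier (dp_prod ns)" for d
      unfolding dual_map_def
    proof (subst restrict_eq_in_prod[OF d[unfolded dp_prod_def]], rule ballI)
      fix i assume i: "i \<in> {..<length ns}"
      have "d i \<le> Suc (ns ! i)" using mtl_prod_memD[OF d[unfolded dp_prod_def] i] by simp
      then show "preimage_map (ns ! i) (snd (Id (Fam Nat_top) ns ! i)) (d (fst (Id (Fam Nat_top) ns ! i))) = d i"
        using i preimage_map_id[of "d i" "ns ! i"] by (simp add: Nat_top_def)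
    qed
    then have "mtl_arrow (dp_prod ns) (dual_map ns (Id (Fam Nat_top) ns)) = Some |` carrier (dp_prod ns)"
      by (rule mtl_arrow_id)
    then show "FArr ?F ns ns (Id (Fam Nat_top) ns) = Id ?D (FOb ?F ns)"
      by (simp add: opposite_def mtl_cat_def)
  next
    fix ns ms ls f g assume f: "f \<in> Hom (Fam Nat_top) ns ms" and g: "g \<in> Hom (Fam Nat_top) ms ls"
    have "dual_map ns (Comp (Fam Nat_top) g f) d = dual_map ns f (dual_map ms g d)" for d
      unfolding dual_map_def[of ns]
    proof (rule restrict_ext)
      fix i assume "i \<in> {..<length ns}"
      then have "i < length f" "fst (f ! i) < length ms"
        "snd (f ! i) \<in> Hom Nat_top (ns ! i) (ms ! fst (f ! i))"
        "snd (g ! fst (f ! i)) \<in> Hom Nat_top (ms ! fst (f ! i)) (ls ! fst (g ! fst (f ! i)))"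
        using f g by (auto simp: Fam_Hom_iff)
      then show "preimage_map (ns ! i) (snd (Comp (Fam Nat_top) g f ! i)) (d (fst (Comp (Fam Nat_top) g f ! i))) =
          preimage_map (ns ! i) (snd (f ! i)) (dual_map ms g d (fst (f ! i)))"
        by (simp add: dual_map_def preimage_map_comp[symmetric]) (simp add: Nat_top_def)
    qed
    then show "FArr ?F ns ls (Comp (Fam Nat_top) g f) = Comp ?D (FArr ?F ms ls g) (FArr ?F ns ms f)"
      by (simp add: opposite_def mtl_cat_def mtl_arrow_comp[OF dual_map_hom[OF g]] mtl_arrow_eq_iff)
  next
    fix ns ms
    have "inj_on (FArr ?F ns ms) (Hom (Fam Nat_top) ns ms)"
      using dual_map_inj by (auto simp: inj_on_def mtl_arrow_eq_iff)
    moreover have "Hom ?D (FOb ?F ns) (FOb ?F ms) \<subseteq> FArr ?F ns ms ` Hom (Fam Nat_top) ns ms"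
    proof
      fix f assume "f \<in> Hom ?D (FOb ?F ns) (FOb ?F ms)"
      then obtain H where H: "H \<in> mtl_hom (dp_prod ms) (dp_prod ns)" "f = mtl_arrow (dp_prod ms) H"
        by (auto simp: Hom_D)
      then obtain h where h: "h \<in> Hom (Fam Nat_top) ns ms" "\<forall>d \<in> carrier (dp_prod ms). H d = dual_map ns h d"
        using dual_map_surj by blast
      then have "f = FArr ?F ns ms h" using H(2) by (simp add: mtl_arrow_eq_iff)
      then show "f \<in> FArr ?F ns ms ` Hom (Fam Nat_top) ns ms" using h(1) by blast
    qed
    moreover have "FArr ?F ns ms ` Hom (Fam Nat_top) ns ms \<subseteq> Hom ?D (FOb ?F ns) (FOb ?F ms)"
      using dual_map_hom by (auto simp: Hom_D)
    ultimately show "bij_betw (FArr ?F ns ms) (Hom (Fam Nat_top) ns ms) (Hom ?D (FOb ?F ns) (FOb ?F ms))"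
      by (auto simp: bij_betw_def)
  next
    fix A assume A: "A \<in> Ob ?D"
    then obtain ns where "A = dp_prod ns" by (auto simp: opposite_def mtl_cat_def)
    moreover have "ns \<in> Ob (Fam Nat_top)" by (simp add: Fam_def Nat_top_def)
    ultimately show "\<exists>ns\<in>Ob (Fam Nat_top). \<exists>f. is_iso ?D (FOb ?F ns) A f"
      using D.is_iso_Id[OF A] by auto
  qed (auto simp: opposite_def mtl_cat_def)
  then show ?thesis unfolding weakly_equivalent_def by blast
qed

text \<open>A product of standard chains is finite and so can be copied into the infinite type. The
  copies are DP-algebras, and the decomposition shows that every finite DP-algebra is isomorphic to
  one of them.\<close>

lemma weakly_equivalent_dp_prod_DP_fin:
  "weakly_equivalent (mtl_cat (range dp_prod)) (DP_fin :: ('b::infinite mtl, _) cat)"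
proof -
  have fin: "finite (carrier (dp_prod ns))" for ns
    unfolding dp_prod_def by (simp add: finite_PiE)
  have "\<forall>A. \<exists>f :: (nat \<Rightarrow> nat) \<Rightarrow> 'b. finite (carrier A) \<longrightarrow> inj_on f (carrier A)"
    using arb_inj_on_finite_infinite by metis
  then obtain e :: "(nat \<Rightarrow> nat) mtl \<Rightarrow> (nat \<Rightarrow> nat) \<Rightarrow> 'b"
    where e: "\<And>A. finite (carrier A) \<Longrightarrow> inj_on (e A) (carrier A)" by metis
  define g where "g A = mtl_image (e A) A" for A
  define i where "i A = inv_into (carrier A) (e A)" for A
  have inj: "inj_on (e A) (carrier A)" and alg: "mtl_algebra A" if A: "A \<in> range dp_prod" for A
  proof -
    obtain ns where ns: "A = dp_prod ns" using A by blast
    show "inj_on (e A) (carrier A)" unfolding ns using fin by (rule e)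
    show "mtl_algebra A" unfolding ns dp_prod_def by (rule mtl_algebra_prod) (rule mtl_algebra_std_dp)
  qed
  have e_hom: "e A \<in> mtl_hom A (g A)" if "A \<in> range dp_prod" for A
    unfolding g_def using inj[OF that] by (rule mtl_hom_image)
  have i_hom: "i A \<in> mtl_hom (g A) A" if "A \<in> range dp_prod" for A
    unfolding i_def
    by (rule mtl_hom_inv_into[OF alg e_hom]) (use that inj in \<open>auto simp: bij_betw_def g_def\<close>)
  have ie: "i A (e A x) = x" if "A \<in> range dp_prod" "x \<in> carrier A" for A x
    unfolding i_def using inj[OF that(1)] that(2) by simp
  have ei: "e A (i A y) = y" if "A \<in> range dp_prod" "y \<in> carrier (g A)" for A y
    unfolding i_def using that(2) by (simp add: g_def f_inv_into_f)
  have "weak_equivalence (mtl_cat (range dp_prod)) (DP_fin :: ('b mtl, _) cat)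
      \<lparr>FOb = g, FArr = (\<lambda>A B u. mtl_arrow B (e B) \<circ>\<^sub>m (u \<circ>\<^sub>m mtl_arrow (g A) (i A)))\<rparr>"
    unfolding DP_fin_eq
  proof (rule weak_equivalence_transport[where A = carrier and B = carrier and \<theta>' = "\<lambda>A. mtl_arrow (g A) (i A)"])
    fix A assume A: "A \<in> Ob (mtl_cat (range dp_prod))"
    then have A': "A \<in> range dp_prod" by (simp add: mtl_cat_def)
    then obtain ns where ns: "A = dp_prod ns" by blast
    have "dp_algebra (g A)"
      unfolding g_def using inj[OF A'] unfolding ns dp_prod_def by (rule dp_algebra_image_prod)
    then show "g A \<in> Ob (mtl_cat {A. dp_algebra A \<and> finite (carrier A)})"
      using fin[of ns] by (simp add: mtl_cat_def g_def ns)
    show "mtl_arrow (g A) (i A) \<circ>\<^sub>m mtl_arrow A (e A) = Some |` carrier A"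
      unfolding mtl_arrow_comp[OF e_hom[OF A']] using ie[OF A'] by (simp add: mtl_arrow_id)
    show "mtl_arrow A (e A) \<circ>\<^sub>m mtl_arrow (g A) (i A) = Some |` carrier (g A)"
      unfolding mtl_arrow_comp[OF i_hom[OF A']] using ei[OF A'] by (simp add: mtl_arrow_id)
  next
    fix A B u assume "A \<in> Ob (mtl_cat (range dp_prod))" "B \<in> Ob (mtl_cat (range dp_prod))"
      "u \<in> Hom (mtl_cat (range dp_prod)) A B"
    then obtain h where AB: "A \<in> range dp_prod" "B \<in> range dp_prod" and h: "h \<in> mtl_hom A B" "u = mtl_arrow A h"
      by (auto simp: mtl_cat_def)
    have "mtl_arrow B (e B) \<circ>\<^sub>m (u \<circ>\<^sub>m mtl_arrow (g A) (i A)) = mtl_arrow (g A) (e B \<circ> (h \<circ> i A))"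
      unfolding h(2) mtl_arrow_comp[OF i_hom[OF AB(1)]] mtl_arrow_comp[OF mtl_hom_comp[OF i_hom[OF AB(1)] h(1)]] ..
    moreover have "e B \<circ> (h \<circ> i A) \<in> mtl_hom (g A) (g B)"
      using mtl_hom_comp[OF mtl_hom_comp[OF i_hom[OF AB(1)] h(1)] e_hom[OF AB(2)]] .
    ultimately show "mtl_arrow B (e B) \<circ>\<^sub>m (u \<circ>\<^sub>m mtl_arrow (g A) (i A))
        \<in> Hom (mtl_cat {A. dp_algebra A \<and> finite (carrier A)}) (g A) (g B)"
      by (auto simp: mtl_cat_def)
  next
    fix A B v assume "A \<in> Ob (mtl_cat (range dp_prod))" "B \<in> Ob (mtl_cat (range dp_prod))"
      "v \<in> Hom (mtl_cat {A :: 'b mtl. dp_algebra A \<and> finite (carrier A)}) (g A) (g B)"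
    then obtain h where AB: "A \<in> range dp_prod" "B \<in> range dp_prod"
      and h: "h \<in> mtl_hom (g A) (g B)" "v = mtl_arrow (g A) h"
      by (auto simp: mtl_cat_def)
    have "mtl_arrow (g B) (i B) \<circ>\<^sub>m (v \<circ>\<^sub>m mtl_arrow A (e A)) = mtl_arrow A (i B \<circ> (h \<circ> e A))"
      unfolding h(2) mtl_arrow_comp[OF e_hom[OF AB(1)]] mtl_arrow_comp[OF mtl_hom_comp[OF e_hom[OF AB(1)] h(1)]] ..
    moreover have "i B \<circ> (h \<circ> e A) \<in> mtl_hom A B"
      using mtl_hom_comp[OF mtl_hom_comp[OF e_hom[OF AB(1)] h(1)] i_hom[OF AB(2)]] .
    ultimately show "mtl_arrow (g B) (i B) \<circ>\<^sub>m (v \<circ>\<^sub>m mtl_arrow A (e A)) \<in> Hom (mtl_cat (range dp_prod)) A B"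
      by (auto simp: mtl_cat_def)
  next
    fix A :: "'b mtl" assume "A \<in> Ob (mtl_cat {A. dp_algebra A \<and> finite (carrier A)})"
    then have "finite_dp A" by (simp add: mtl_cat_def finite_dp_of_dp_algebra)
    then interpret finite_dp A .
    \<comment> \<open>The decomposition lands in functions on numbers; composing with the copying
      map returns to the type of \<open>A\<close>.\<close>
    obtain ns h where h: "h \<in> mtl_hom A (dp_prod ns)" "bij_betw h (carrier A) (carrier (dp_prod ns))"
      using iso_prod_std_dp unfolding dp_prod_def by blast
    let ?P = "dp_prod ns"
    let ?k = "inv_into (carrier A) h"
    have P: "?P \<in> range dp_prod" by simp
    have k: "?k \<in> mtl_hom ?P A" using mtl_hom_inv_into[OF mtl_algebra_axioms h] .
    have hk: "h (?k y) = y" if "y \<in> carrier ?P" for y using bij_betw_inv_into_right[OF h(2) that] .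
    have kh: "?k (h x) = x" if "x \<in> carrier A" for x using bij_betw_inv_into_left[OF h(2) that] .
    note ki = mtl_hom_comp[OF i_hom[OF P] k] and eh = mtl_hom_comp[OF h(1) e_hom[OF P]]
    have "is_iso (mtl_cat {A. dp_algebra A \<and> finite (carrier A)}) (g ?P) A (mtl_arrow (g ?P) (?k \<circ> i ?P))"
      unfolding is_iso_def
    proof (intro conjI bexI[where x = "mtl_arrow A (e ?P \<circ> h)"])
      show "Comp (mtl_cat {A. dp_algebra A \<and> finite (carrier A)}) (mtl_arrow A (e ?P \<circ> h))
          (mtl_arrow (g ?P) (?k \<circ> i ?P)) = Id (mtl_cat {A. dp_algebra A \<and> finite (carrier A)}) (g ?P)"
        by (simp add: mtl_cat_def mtl_arrow_comp[OF ki], rule mtl_arrow_id)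
          (simp add: hk ei mtl_hom_closed[OF i_hom[OF P]])
      show "Comp (mtl_cat {A. dp_algebra A \<and> finite (carrier A)}) (mtl_arrow (g ?P) (?k \<circ> i ?P))
          (mtl_arrow A (e ?P \<circ> h)) = Id (mtl_cat {A. dp_algebra A \<and> finite (carrier A)}) A"
        by (simp add: mtl_cat_def mtl_arrow_comp[OF eh], rule mtl_arrow_id)
          (simp add: kh ie mtl_hom_closed[OF h(1)])
    qed (use ki eh in \<open>auto simp: mtl_cat_def\<close>)
    then show "\<exists>X\<in>Ob (mtl_cat (range dp_prod)). \<exists>f.
        is_iso (mtl_cat {A. dp_algebra A \<and> finite (carrier A)}) (g X) A f"
      by (auto simp: mtl_cat_def)
  qed (simp_all add: category_mtl_cat, simp_all add: mtl_cat_def)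
  then show ?thesis unfolding weakly_equivalent_def by blast
qed

lemma weakly_equivalent_MC_top_DP_fin:
  "weakly_equivalent (MC_top :: ('a::infinite rel list, _) cat)
    (opposite (DP_fin :: ('b::infinite mtl, _) cat))"
proof -
  have "weakly_equivalent (opposite (mtl_cat (range dp_prod))) (opposite (DP_fin :: ('b mtl, _) cat))"
    using weakly_equivalent_dp_prod_DP_fin weak_equivalence_opposite unfolding weakly_equivalent_def by blast
  then show ?thesis
    unfolding MC_top_eq_Fam
    using weakly_equivalent_trans[OF weakly_equivalent_Fam[OF weakly_equivalent_Chain_top_Nat_top]
      weakly_equivalent_trans[OF weakly_equivalent_Fam_Nat_top_dp_prod]] by blast
qed

theorem theorem18:
  shows "equivalent
      (MC_top :: ('a::infinite rel list, (nat \<times> ('a \<rightharpoonup> 'a)) list) cat)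
      (full_subcat
        (HF :: (('t::infinite rel \<times> 'j::infinite rel) list,
                (nat \<times> ('t \<rightharpoonup> 't) \<times> ('j \<rightharpoonup> 'j)) list) cat)
        (\<lambda>X. \<forall>(T, J) \<in> set X. is_chain_of_size 1 T))
    \<and> dually_equivalent
      (MC_top :: ('a rel list, (nat \<times> ('a \<rightharpoonup> 'a)) list) cat)
      (DP_fin :: ('b::infinite mtl, 'b \<rightharpoonup> 'b) cat)"
  unfolding dually_equivalent_def
  by (intro conjI weakly_equivalent_imp_equivalent weakly_equivalent_MC_top_HF_one
    weakly_equivalent_MC_top_DP_fin)

end
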